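(* For $w\in D_n$, the closed interval $[e,w]$ in the absolute order $\mathrm{Abs}(D_n)$ is a lattice if and only if $\mu(w)=(k,1)$ for some $k\le n-1$, or $\mu(w)=(1,1,1,1)$. Here $\mu(w)$ is the integer partition whose parts are the absolute lengths of all balanced cycles of $w$, arranged in decreasing order.
   Context: $B_n$ is the group of permutations $w$ of $\{\pm1,\dots,\pm n\}$ with $w(-i)=-w(i)$ for all $i$; $e$ is the identity. For $a_1,\dots,a_k\in\{\pm1,\dots,\pm n\}$ with pairwise distinct absolute values, the paired $k$-cycle $(\!(a_1,\dots,a_k)\!)$ is the permutation with cycle form $(a_1\,a_2\cdots a_k)(-a_1\,-a_2\cdots -a_k)$, and the balanced $k$-cycle $[a_1,\dots,a_k]$ is the permutation with cycle form $(a_1\,a_2\cdots a_k\,-a_1\,-a_2\cdots -a_k)$. Every $w\in B_n$ is a product of disjoint paired or balanced cycles, called the cycles of $w$. The Coxeter group $D_n$ is the subgroup of $B_n$ generated by the set $\mathcal T=\{(\!(i,j)\!),(\!(i,-j)\!):1\le i<j\le n\}$, which is the set of all reflections of $D_n$; equivalently, $D_n$ consists of the $w\in B_n$ with an even number of balanced cycles. Absolute order: for $w\in D_n$, the absolute length $\ell_{\mathcal T}(w)$ is the least $k$ such that $w$ is a product of $k$ elements of $\mathcal T$; $\mathrm{Abs}(D_n)$ is the partial order on $D_n$ given by $u\preceq v$ iff $\ell_{\mathcal T}(u)+\ell_{\mathcal T}(u^{-1}v)=\ell_{\mathcal T}(v)$. The interval $[e,w]$ is $\{z\in D_n: e\preceq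 z\preceq w\}$ with the induced order. In the definition of $\mu(w)$ the absolute length of a balanced cycle is taken in $B_n$ (with respect to all reflections of $B_n$, namely $\mathcal T$ together with the $[i]$, $1\le i\le n$), so a balanced $k$-cycle contributes the part $k$.
   Formalization: The case of no balanced cycles, where μ(w) is the empty partition, is added to the right-hand side: the printed equivalence fails there (for w=e, [e,e] is a one-element lattice). For all other w the equivalence is as printed. *)

theory Defs
  imports
    "HOL-Algebra.Generated_Groups"
    "HOL-Algebra.Lattice"
    "HOL-Combinatorics.Cycles"
    "HOL-Library.Multiset"
begin

definition signed_points :: "nat \<Rightarrow> int set" where
  "signed_points n = {i. 1 \<le> \<bar>i\<bar> \<and> \<bar>i\<bar> \<le> int n}"

text \<open>A permutation of the signed points is encoded as a function on all integers that is the
  identity elsewhere. Products are read from right to left.\<close>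

definition hyperoctahedral :: "nat \<Rightarrow> (int \<Rightarrow> int) monoid" where
  "hyperoctahedral n =
     \<lparr>carrier = {w. w permutes signed_points n \<and> (\<forall>i. w (- i) = - w i)}, monoid.mult = (\<circ>), one = id\<rparr>"

lemma group_hyperoctahedral: "group (hyperoctahedral n)"
proof (rule groupI)
  fix w assume w: "w \<in> carrier (hyperoctahedral n)"
  then have p: "w permutes signed_points n" and m: "\<And>i. w (- i) = - w i"
    by (auto simp: hyperoctahedral_def)
  have "inv_into UNIV w (- i) = - inv_into UNIV w i" for i
    by (metis m p permutes_inverses)
  then have "inv_into UNIV w \<in> carrier (hyperoctahedral n)"
    using permutes_inv[OF p] by (simp add: hyperoctahedral_def)
  moreover have "inv_into UNIV w \<otimes>\<^bsub>hyperoctahedral n\<^esub> w = \<one>\<^bsub>hyperoctahedral n\<^esub>"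
    using permutes_inv_o(2)[OF p] by (simp add: hyperoctahedral_def)
  ultimately show "\<exists>y\<in>carrier (hyperoctahedral n). y \<otimes>\<^bsub>hyperoctahedral n\<^esub> w = \<one>\<^bsub>hyperoctahedral n\<^esub>"
    by blast
qed (auto simp: hyperoctahedral_def permutes_compose permutes_id comp_assoc)

definition cycle_word :: "nat \<Rightarrow> int list \<Rightarrow> bool" where
  "cycle_word n as \<longleftrightarrow> as \<noteq> [] \<and> set as \<subseteq> signed_points n \<and> distinct (map abs as)"

definition paired_cycle :: "int list \<Rightarrow> int \<Rightarrow> int" where
  "paired_cycle as = cycle_of_list as \<circ> cycle_of_list (map uminus as)"

definition balanced_cycle :: "int list \<Rightarrow> int \<Rightarrow> int" where
  "balanced_cycle as = cycle_of_list (as @ map uminus as)"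

definition is_paired_cycle :: "nat \<Rightarrow> (int \<Rightarrow> int) \<Rightarrow> bool" where
  "is_paired_cycle n c \<longleftrightarrow> (\<exists>as. cycle_word n as \<and> c = paired_cycle as)"

definition is_balanced_cycle :: "nat \<Rightarrow> (int \<Rightarrow> int) \<Rightarrow> bool" where
  "is_balanced_cycle n c \<longleftrightarrow> (\<exists>as. cycle_word n as \<and> c = balanced_cycle as)"

definition prod_comp :: "('a \<Rightarrow> 'a) list \<Rightarrow> 'a \<Rightarrow> 'a" where
  "prod_comp fs = foldr (\<circ>) fs id"

definition cycle_decomposition :: "nat \<Rightarrow> (int \<Rightarrow> int) \<Rightarrow> (int \<Rightarrow> int) list \<Rightarrow> bool" where
  "cycle_decomposition n w cs \<longleftrightarrow>
     (\<forall>c\<in>set cs. is_paired_cycle n c \<or> is_balanced_cycle n c) \<and>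
     sorted_wrt (\<lambda>c d. disjnt {x. c x \<noteq> x} {x. d x \<noteq> x}) cs \<and>
     w = prod_comp cs"

definition balanced_cycles_of :: "nat \<Rightarrow> (int \<Rightarrow> int) \<Rightarrow> (int \<Rightarrow> int) set" where
  "balanced_cycles_of n w =
     {c. is_balanced_cycle n c \<and> (\<exists>cs. cycle_decomposition n w cs \<and> c \<in> set cs)}"

definition reflections_D :: "nat \<Rightarrow> (int \<Rightarrow> int) set" where
  "reflections_D n =
     {paired_cycle [i, j] | i j. 1 \<le> i \<and> i < j \<and> j \<le> int n} \<union>
     {paired_cycle [i, - j] | i j. 1 \<le> i \<and> i < j \<and> j \<le> int n}"

definition reflections_B :: "nat \<Rightarrow> (int \<Rightarrow> int) set" where
  "reflections_B n = reflections_D n \<union> {balanced_cycle [i] | i. 1 \<le> i \<and> i \<le> int n}"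

definition coxeter_D :: "nat \<Rightarrow> (int \<Rightarrow> int) set" where
  "coxeter_D n = generate (hyperoctahedral n) (reflections_D n)"

definition word_length :: "('a \<Rightarrow> 'a) set \<Rightarrow> ('a \<Rightarrow> 'a) \<Rightarrow> nat" where
  "word_length S w = (LEAST k. \<exists>ts. length ts = k \<and> set ts \<subseteq> S \<and> w = prod_comp ts)"

definition abs_le :: "nat \<Rightarrow> (int \<Rightarrow> int) \<Rightarrow> (int \<Rightarrow> int) \<Rightarrow> bool" where
  "abs_le n u v \<longleftrightarrow>
     word_length (reflections_D n) u + word_length (reflections_D n) (inv_into UNIV u \<circ> v) =
     word_length (reflections_D n) v"

definition abs_interval :: "nat \<Rightarrow> (int \<Rightarrow> int) \<Rightarrow> (int \<Rightarrow> int) gorder" where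
  "abs_interval n w =
     \<lparr>carrier = {z \<in> coxeter_D n. abs_le n id z \<and> abs_le n z w}, eq = (=), le = abs_le n\<rparr>"

text \<open>The parts are lengths with respect to all reflections of the hyperoctahedral group, since a
  single balanced cycle does not lie in the group of type D. The partition is a weakly decreasing
  list; it is empty exactly when all cycles of the element are paired.\<close>

definition mu :: "nat \<Rightarrow> (int \<Rightarrow> int) \<Rightarrow> nat list" where
  "mu n w = rev (sorted_list_of_multiset
     (image_mset (word_length (reflections_B n)) (mset_set (balanced_cycles_of n w))))"

end

theory Submission
  imports Defs "HOL-Combinatorics.Orbits"
begin

text \<open>The absolute length of an element is the codimension of its fixed space, which is counted here by
  invariant functions with values in \<open>{-1, 0, 1}\<close>. Inside an interval an element is determined by its moved
  space (Brady and Watt), so \<open>[e, w]\<close> is a poset of subspaces ordered by inclusion. As every upper interval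
  is again an interval below an element of the same kind, it suffices to join two reflections. One of
  their two products is the join unless the pair is crossing. In that case, either some upper bound has
  both reflections inside one paired cycle, and the join is a paired 4-cycle, or every upper bound has all
  the indices in balanced cycles. Since the number of balanced cycles is even, the upper bound may then be
  forced to contain a further balanced cycle of \<open>w\<close>. For the listed partitions this surplus cycle is unique
  and a join exists; for all other partitions there are two choices, and no element lies below both
  while keeping the parity.\<close>

text \<open>An odd integer function with \<open>f \<circ> z = f\<close> is a vector of the fixed
  space of \<open>z\<close>. So \<open>inv_funs z\<close> stands for that space,
  \<open>linked z i j\<close> says that a root is orthogonal to it, and inclusion of the sets
  \<open>inv_funs\<close> reverses inclusion of moved spaces. Cardinalities over the field with
  three elements replace dimensions: 3 is the least modulus at which signs remain visible, and no
  link is gained or lost, since the signed indicators of cycles already have values in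
  \<open>{-1, 0, 1}\<close>. The order is handled inside Abs(B_n). Every even element has a shortest
  word made of reflections of type D, so both lengths agree on D_n; yet a balanced 1-cycle, which is
  odd, may be split off in intermediate steps. What is left of type D is the parity of the number of
  balanced cycles. It can be tracked because distinct balanced cycles of an element below
  \<open>u\<close> lie on distinct balanced cycles of \<open>u\<close>.\<close>

abbreviation signed_perms :: "nat \<Rightarrow> (int \<Rightarrow> int) set" where
  "signed_perms n \<equiv> carrier (hyperoctahedral n)"

text \<open>For \<open>j = - i\<close> this is the balanced 1-cycle \<open>[i]\<close>.\<close>

definition reflect :: "int \<Rightarrow> int \<Rightarrow> int \<Rightarrow> int" where
  "reflect i j x = (if i = 0 \<or> j = 0 then x else if x = i then j else if x = j then i else if x = - i then - j
     else if x = - j then - i else x)"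

definition inv_funs :: "(int \<Rightarrow> int) \<Rightarrow> (int \<Rightarrow> int) set" where
  "inv_funs z = {f. (\<forall>x. f (- x) = - f x) \<and> (\<forall>x. f (z x) = f x)}"

text \<open>The root \<open>e\<^sub>i - e\<^sub>j\<close> lies in the moved space of \<open>z\<close>; for \<open>j = - i\<close> this says that \<open>i\<close> belongs
  to a balanced cycle.\<close>

definition linked :: "(int \<Rightarrow> int) \<Rightarrow> int \<Rightarrow> int \<Rightarrow> bool" where
  "linked z i j \<longleftrightarrow> (\<forall>f\<in>inv_funs z. f i = f j)"

text \<open>Modulo 3 these functions form a vector space whose dimension is that of the fixed space.\<close>

definition ternary :: "nat \<Rightarrow> (int \<Rightarrow> int) \<Rightarrow> (int \<Rightarrow> int) set" where
  "ternary n z = {f \<in> inv_funs z. (\<forall>x. f x \<in> {-1, 0, 1}) \<and> (\<forall>x. x \<notin> signed_points n \<longrightarrow> f x = 0)}"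

section \<open>Signed permutations, invariant functions and linked points\<close>

lemma finite_signed_points [simp]: "finite (signed_points n)"
proof -
  have "signed_points n \<subseteq> {- int n..int n}" by (auto simp: signed_points_def)
  then show ?thesis by (rule finite_subset) simp
qed

lemma uminus_signed_points [simp]: "- i \<in> signed_points n \<longleftrightarrow> i \<in> signed_points n"
  by (simp add: signed_points_def)

lemma signed_points_nonzero: "i \<in> signed_points n \<Longrightarrow> i \<noteq> 0"
  by (auto simp: signed_points_def)

lemma signed_points_neq_uminus: "i \<in> signed_points n \<Longrightarrow> i \<noteq> - i"
  by (auto simp: signed_points_def)

lemma signed_perms_iff:
  "z \<in> signed_perms n \<longleftrightarrow> z permutes signed_points n \<and> (\<forall>i. z (- i) = - z i)"
  by (simp add: hyperoctahedral_def)

lemma signed_perms_permutes: "z \<in> signed_perms n \<Longrightarrow> z permutes signed_points n"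
  and signed_perms_uminus: "z \<in> signed_perms n \<Longrightarrow> z (- i) = - z i"
  by (simp_all add: signed_perms_iff)

lemma signed_perms_permutation: "z \<in> signed_perms n \<Longrightarrow> permutation z"
  using signed_perms_permutes finite_signed_points permutation_permutes by blast

lemma signed_perms_comp: "x \<in> signed_perms n \<Longrightarrow> y \<in> signed_perms n \<Longrightarrow> x \<circ> y \<in> signed_perms n"
  by (simp add: signed_perms_iff permutes_compose)

lemma signed_perms_id [simp]: "id \<in> signed_perms n"
  by (simp add: signed_perms_iff permutes_id)

lemma signed_perms_inv: "x \<in> signed_perms n \<Longrightarrow> inv_into UNIV x \<in> signed_perms n"
  using group.inv_closed[OF group_hyperoctahedral]
  by (metis (no_types, lifting) permutes_inv permutes_inv_eq signed_perms_iff)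

lemma signed_perms_mem: "z \<in> signed_perms n \<Longrightarrow> z i \<in> signed_points n \<longleftrightarrow> i \<in> signed_points n"
  using permutes_in_image signed_perms_permutes by metis

lemma signed_perms_inj: "z \<in> signed_perms n \<Longrightarrow> z i = z j \<longleftrightarrow> i = j"
  by (metis inj_eq permutes_inj signed_perms_permutes)

lemma signed_perms_fix: "z \<in> signed_perms n \<Longrightarrow> i \<notin> signed_points n \<Longrightarrow> z i = i"
  using permutes_not_in signed_perms_permutes by metis

lemma reflect_reflect [simp]: "reflect i j (reflect i j x) = x"
  by (auto simp: reflect_def)

lemma reflect_comp_self [simp]: "reflect i j \<circ> reflect i j = id" "reflect i j \<circ> (reflect i j \<circ> z) = z"
  by auto

lemma reflect_commute: "reflect i j = reflect j i"
  by (auto simp: reflect_def fun_eq_iff)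

lemma reflect_uminus: "reflect (- i) (- j) = reflect i j"
  by (auto simp: reflect_def fun_eq_iff)

lemma reflect_odd: "reflect i j (- x) = - reflect i j x"
  by (auto simp: reflect_def)

lemma reflect_simps [simp]:
  assumes "i \<noteq> 0" "j \<noteq> 0"
  shows "reflect i j i = j" "reflect i j j = i" "reflect i j (- i) = - j" "reflect i j (- j) = - i"
  using assms by (auto simp: reflect_def)

lemma reflect_other: "x \<noteq> i \<Longrightarrow> x \<noteq> j \<Longrightarrow> x \<noteq> - i \<Longrightarrow> x \<noteq> - j \<Longrightarrow> reflect i j x = x"
  by (auto simp: reflect_def)

lemma reflect_in:
  assumes "i \<in> signed_points n" "j \<in> signed_points n"
  shows "reflect i j \<in> signed_perms n"
proof -
  have "reflect i j x = x" if "x \<notin> signed_points n" for x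
    using that assms by (intro reflect_other) auto
  moreover have "\<exists>!x. reflect i j x = y" for y
    by (rule ex1I[of _ "reflect i j y"]) auto
  ultimately show ?thesis
    by (simp add: signed_perms_iff reflect_odd permutes_def)
qed

lemma inv_funs_odd: "f \<in> inv_funs z \<Longrightarrow> f (- x) = - f x"
  and inv_funs_inv: "f \<in> inv_funs z \<Longrightarrow> f (z x) = f x"
  by (auto simp: inv_funs_def)

lemma inv_fun_reflect: "(\<And>x. f (- x) = - f x) \<Longrightarrow> f i = f j \<Longrightarrow> f (reflect i j x) = (f x :: int)"
  by (auto simp: reflect_def)

lemma linked_refl [simp]: "linked z i i"
  and linked_sym: "linked z i j \<Longrightarrow> linked z j i"
  and linked_trans: "linked z i j \<Longrightarrow> linked z j k \<Longrightarrow> linked z i k"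
  by (auto simp: linked_def)

lemma linked_neg: "linked z i j \<Longrightarrow> linked z (- i) (- j)"
  by (auto simp: linked_def inv_funs_def)

lemma linked_neg_iff: "linked z (- i) (- j) \<longleftrightarrow> linked z i j"
  using linked_neg by fastforce

lemma linked_commute: "linked z i j \<longleftrightarrow> linked z j i"
  using linked_sym by blast

lemma linked_app: "linked z i (z i)"
  by (auto simp: linked_def inv_funs_def)

lemma linked_zero: "linked z i (- i) \<longleftrightarrow> (\<forall>f\<in>inv_funs z. f i = 0)"
  by (auto simp: linked_def inv_funs_def)

lemma linked_zero_neg: "linked z (- i) i \<longleftrightarrow> linked z i (- i)"
  using linked_sym by blast

lemma linked_zero_zero: "linked z i (- i) \<Longrightarrow> linked z j (- j) \<Longrightarrow> linked z i j"
  unfolding linked_zero by (metis linked_def)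

lemma linked_zero_cong: "linked z i j \<Longrightarrow> linked z i (- i) \<longleftrightarrow> linked z j (- j)"
  unfolding linked_zero unfolding linked_def by metis

lemma inv_funs_mono_linked: "inv_funs u \<subseteq> inv_funs z \<Longrightarrow> linked z i j \<Longrightarrow> linked u i j"
  by (auto simp: linked_def)

lemma orbit_self: "z \<in> signed_perms n \<Longrightarrow> i \<in> orbit z i"
  by (simp add: permutation_self_in_orbit signed_perms_permutation)

lemma orbit_step_iff: "z \<in> signed_perms n \<Longrightarrow> z s \<in> orbit z i \<longleftrightarrow> s \<in> orbit z i"
  by (metis orbit_self orbit.step orbit_swap orbit_trans orbit.base)

lemma orbit_symm: "z \<in> signed_perms n \<Longrightarrow> j \<in> orbit z i \<longleftrightarrow> i \<in> orbit z j"
  by (metis orbit_self orbit_swap)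

lemma orbit_neg: assumes z: "z \<in> signed_perms n" shows "- j \<in> orbit z (- i) \<longleftrightarrow> j \<in> orbit z i"
proof -
  have *: "- s \<in> orbit z (- k)" if "s \<in> orbit z k" for s k
    using that
  proof (induction rule: orbit.induct)
    case base
    then show ?case using orbit.base[of z "- k"] z by (simp add: signed_perms_uminus)
  next
    case (step s)
    then show ?case using orbit.step[of "- s" z "- k"] z by (simp add: signed_perms_uminus)
  qed
  show ?thesis using *[of j i] *[of "-j" "-i"] by auto
qed

lemma orbit_signed_points: "z \<in> signed_perms n \<Longrightarrow> i \<in> signed_points n \<Longrightarrow> orbit z i \<subseteq> signed_points n"
  using permutes_orbit_subset signed_perms_permutes by metis

lemma orbit_linked: "j \<in> orbit z i \<Longrightarrow> linked z i j"
  by (induction rule: orbit.induct) (auto intro: linked_app linked_trans)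

text \<open>The signed indicator of the cycle through \<open>i\<close>. It is identically zero when
  this cycle is balanced, since the orbit is then closed under negation.\<close>

definition orbit_fun :: "(int \<Rightarrow> int) \<Rightarrow> int \<Rightarrow> int \<Rightarrow> int" where
  "orbit_fun z i s = of_bool (s \<in> orbit z i) - of_bool (- s \<in> orbit z i)"

lemma orbit_fun_ternary:
  assumes "z \<in> signed_perms n" "i \<in> signed_points n"
  shows "orbit_fun z i \<in> ternary n z"
proof -
  have "- z x \<in> orbit z i \<longleftrightarrow> - x \<in> orbit z i" for x
    using assms orbit_step_iff[of z n "-x" i] by (simp add: signed_perms_uminus)
  moreover have "x \<notin> orbit z i" if "x \<notin> signed_points n" for x
    using orbit_signed_points[OF assms] that by auto
  ultimately show ?thesis
    using assms orbit_step_iff[of z n] by (auto simp: ternary_def inv_funs_def orbit_fun_def)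
qed

text \<open>If the cycle of \<open>i\<close> is paired, its signed indicator is 1 at
  \<open>i\<close> and at most 0 at \<open>j\<close>; otherwise the cycle of \<open>j\<close> is
  paired and the roles are exchanged. The separating function is ternary, so linking can be tested
  modulo 3.\<close>

lemma linked_separate:
  assumes z: "z \<in> signed_perms n" and ij: "i \<in> signed_points n" "j \<in> signed_points n"
    and "\<not> (j \<in> orbit z i \<or> (- i \<in> orbit z i \<and> - j \<in> orbit z j))"
  shows "\<exists>f\<in>ternary n z. f i \<noteq> f j"
proof (cases "- i \<in> orbit z i")
  case False
  then have "orbit_fun z i i = 1" "orbit_fun z i j \<le> 0"
    using assms orbit_self[of z n] by (auto simp: orbit_fun_def)
  then show ?thesis using orbit_fun_ternary[OF z ij(1)] by (metis not_one_le_zero)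
next
  case True
  then have "orbit_fun z j j = 1" "orbit_fun z j i \<le> 0"
    using assms orbit_self[of z n] orbit_symm[of z n] by (auto simp: orbit_fun_def)
  then show ?thesis using orbit_fun_ternary[OF z ij(2)] by (metis not_one_le_zero)
qed

lemma ternary_inv_funs: "f \<in> ternary n z \<Longrightarrow> f \<in> inv_funs z"
  by (simp add: ternary_def)

lemma linked_zero_iff: assumes z: "z \<in> signed_perms n"
  shows "linked z i (- i) \<longleftrightarrow> - i \<in> orbit z i"
proof (cases "i \<in> signed_points n")
  case True
  show ?thesis
  proof
    assume "linked z i (- i)"
    then have "orbit_fun z i i = 0"
      using orbit_fun_ternary[OF z True] by (auto simp: linked_zero dest: ternary_inv_funs)
    then show "- i \<in> orbit z i"
      using orbit_self[OF z, of i] by (auto simp: orbit_fun_def of_bool_def split: if_splits)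
  qed (rule orbit_linked)
next
  case False
  show ?thesis
  proof
    assume l: "linked z i (- i)"
    \<comment> \<open>Off the signed points \<open>z\<close> is the identity, so the odd delta
      function at \<open>i\<close> is invariant; it vanishes at \<open>i\<close> only for
      \<open>i = 0\<close>.\<close>
    have "(\<lambda>x. of_bool (x = i) - of_bool (x = - i)) \<in> inv_funs z"
    proof -
      have "z x = i \<longleftrightarrow> x = i" "z x = - i \<longleftrightarrow> x = - i" for x
        using signed_perms_fix[OF z] False signed_perms_inj[OF z] uminus_signed_points by metis+
      then show ?thesis by (auto simp: inv_funs_def)
    qed
    then have "i = - i" using l by (auto simp: linked_zero of_bool_def split: if_splits)
    then show "- i \<in> orbit z i" using orbit_self[OF z] by simp
  qed (rule orbit_linked)
qed

text \<open>Invariant functions are constant on orbits and vanish on balanced cycles, and the signed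
  indicators show that there are no further relations.\<close>

lemma linked_iff:
  assumes z: "z \<in> signed_perms n" and ij: "i \<in> signed_points n" "j \<in> signed_points n"
  shows "linked z i j \<longleftrightarrow> j \<in> orbit z i \<or> (linked z i (- i) \<and> linked z j (- j))"
proof
  assume "linked z i j"
  then show "j \<in> orbit z i \<or> (linked z i (- i) \<and> linked z j (- j))"
    using linked_separate[OF z ij] unfolding linked_zero_iff[OF z]
    by (auto simp: linked_def dest: ternary_inv_funs)
qed (auto intro: orbit_linked linked_zero_zero)

lemma not_linked_separate:
  assumes z: "z \<in> signed_perms n" and ij: "i \<in> signed_points n" "j \<in> signed_points n"
    and "\<not> linked z i j"
  shows "\<exists>f\<in>ternary n z. f i \<noteq> f j"
  using linked_separate[OF assms(1-3)] assms(4) linked_iff[OF assms(1-3)] linked_zero_iff[OF z] by blast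

section \<open>Multiplication by a reflection\<close>

text \<open>The scalar product with the root \<open>e\<^sub>j - e\<^sub>i\<close>; each coordinate
  is counted at \<open>s\<close> and at \<open>- s\<close>, whence the factor 2.\<close>

lemma sum_odd_reflect:
  fixes g f :: "int \<Rightarrow> int"
  assumes ij: "i \<in> signed_points n" "j \<in> signed_points n" "i \<noteq> j"
    and g: "\<And>x. g (- x) = - g x"
  shows "(\<Sum>s\<in>signed_points n. (of_bool (s = j) - of_bool (s = - j) - of_bool (s = i) + of_bool (s = - i)) * g s)
    = 2 * (g j - g i)"
proof -
  have "(\<Sum>s\<in>signed_points n. of_bool (s = a) * g s) = g a" if "a \<in> signed_points n" for a
  proof -
    have "(\<Sum>s\<in>signed_points n. of_bool (s = a) * g s) = (\<Sum>s\<in>signed_points n. if s = a then g s else 0)"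
      by (rule sum.cong) auto
    then show ?thesis using that by simp
  qed
  then have e: "(\<Sum>s\<in>signed_points n. of_bool (s = i) * g s) = g i"
    "(\<Sum>s\<in>signed_points n. of_bool (s = j) * g s) = g j"
    "(\<Sum>s\<in>signed_points n. of_bool (s = - i) * g s) = - g i"
    "(\<Sum>s\<in>signed_points n. of_bool (s = - j) * g s) = - g j"
    using ij by (simp_all add: g)
  show ?thesis
    by (simp only: distrib_right left_diff_distrib sum.distrib sum_subtractf e) simp
qed

text \<open>A reflection moves \<open>f\<close> by a multiple of the root. For
  \<open>j = - i\<close> both terms of the vector on the right fall on the same coordinate, and the
  factor 2 on the left compensates for this.\<close>

lemma reflect_diff:
  fixes f :: "int \<Rightarrow> int"
  assumes ij: "i \<in> signed_points n" "j \<in> signed_points n" "i \<noteq> j"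
    and odd: "\<And>x. f (- x) = - f x"
  shows "(if j = - i then 2 else 1) * (f (reflect i j s) - f s)
    = (f i - f j) * (of_bool (s = j) - of_bool (s = - j) - of_bool (s = i) + of_bool (s = - i))"
proof -
  have ne: "i \<noteq> 0" "j \<noteq> 0" "i \<noteq> - i" "j \<noteq> - j" using ij signed_points_nonzero signed_points_neq_uminus by auto
  consider "s = i" | "s = j" | "s = - i" | "s = - j" | "s \<noteq> i" "s \<noteq> j" "s \<noteq> - i" "s \<noteq> - j" by auto
  then show ?thesis
  proof cases
    case 5
    then show ?thesis by (simp add: reflect_other)
  qed (use ne ij odd in auto)
qed

text \<open>Let \<open>f\<close> be invariant under the product and \<open>y\<close> under
  \<open>z\<close>. Applying \<open>z\<close> inside the scalar product of
  \<open>f \<circ> reflect i j\<close> with \<open>y\<close> turns it into that of \<open>f\<close>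
  with \<open>y\<close>. Up to a nonzero factor the difference is \<open>f i - f j\<close> times
  \<open>y i - y j\<close>, so one of these vanishes.\<close>

lemma linked_reflect_or:
  assumes z: "z \<in> signed_perms n" and ij: "i \<in> signed_points n" "j \<in> signed_points n" "i \<noteq> j"
  shows "linked (reflect i j \<circ> z) i j \<or> linked z i j"
proof (rule ccontr)
  assume "\<not> ?thesis"
  then obtain f y where f: "f \<in> inv_funs (reflect i j \<circ> z)" "f i \<noteq> f j"
    and y: "y \<in> inv_funs z" "y i \<noteq> y j"
    by (auto simp: linked_def)
  have odd: "f (- x) = - f x" "y (- x) = - y x" for x
    using f y by (auto simp: inv_funs_odd)
  have "(\<Sum>s\<in>signed_points n. f (reflect i j s) * y s)
      = (\<Sum>s\<in>signed_points n. f (reflect i j (z s)) * y (z s))"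
    using sum.permute[OF signed_perms_permutes[OF z], of "\<lambda>s. f (reflect i j s) * y s"]
    by (simp add: comp_def)
  also have "\<dots> = (\<Sum>s\<in>signed_points n. f s * y s)"
    using f y by (intro sum.cong) (auto simp: inv_funs_def)
  finally have "(\<Sum>s\<in>signed_points n. (f (reflect i j s) - f s) * y s) = 0"
    by (simp only: left_diff_distrib sum_subtractf)
  then have "(\<Sum>s\<in>signed_points n. ((if j = - i then 2 else 1) * (f (reflect i j s) - f s)) * y s) = 0"
    by (simp flip: sum_distrib_left add: mult.assoc)
  then have "(f i - f j) * (2 * (y j - y i)) = 0"
    unfolding reflect_diff[OF ij, of f, OF odd(1)] mult.assoc sum_distrib_left[symmetric]
      sum_odd_reflect[OF ij, of y, OF odd(2)] .
  then show False using f y by auto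
qed

text \<open>The root is exhibited in the image of \<open>1 - z\<close>: the odd delta functions of
  the points passed on the way from \<open>i\<close> to \<open>j\<close> add up to \<open>f\<close>,
  and their changes under \<open>z\<close> telescope.\<close>

lemma telescope:
  assumes z: "z \<in> signed_perms n" and j: "j \<in> orbit z i"
  shows "\<exists>f. (\<forall>x. f (- x) = - f x) \<and> (\<forall>x. f x = f (z x) +
     (of_bool (z x = j) - of_bool (z x = - j) - of_bool (z x = i) + of_bool (z x = - i) :: int))"
  using j
proof (induction rule: orbit.induct)
  case base
  let ?e = "\<lambda>a x. of_bool (x = a) - of_bool (x = - a) :: int"
  have "?e (z i) (z x) = ?e i x" for x
    using signed_perms_inj[OF z, of x i] signed_perms_inj[OF z, of x "- i"] signed_perms_uminus[OF z, of i] by simp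
  then have *: "?e i x = ?e i (z x) + (?e (z i) (z x) - ?e i (z x))" for x by simp
  show ?case
  proof (intro exI[of _ "?e i"] conjI allI)
    show "?e i x = ?e i (z x) + (of_bool (z x = z i) - of_bool (z x = - z i) - of_bool (z x = i) + of_bool (z x = - i))" for x
      using *[of x] by linarith
  qed auto
next
  case (step k)
  let ?e = "\<lambda>a x. of_bool (x = a) - of_bool (x = - a) :: int"
  from step.IH obtain f :: "int \<Rightarrow> int" where f: "\<forall>x. f (- x) = - f x"
    "\<forall>x. f x = f (z x) + (of_bool (z x = k) - of_bool (z x = - k) - of_bool (z x = i) + of_bool (z x = - i))"
    by blast
  have e: "?e (z k) (z x) = ?e k x" for x
    using signed_perms_inj[OF z, of x k] signed_perms_inj[OF z, of x "- k"] signed_perms_uminus[OF z, of k] by simp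
  have *: "f x + ?e k x = f (z x) + ?e k (z x) + (?e (z k) (z x) - ?e i (z x))" for x
    using f(2)[rule_format, of x] e[of x] by linarith
  show ?case
  proof (intro exI[of _ "\<lambda>x. f x + ?e k x"] conjI allI)
    show "f (- x) + ?e k (- x) = - (f x + ?e k x)" for x
      using f(1)[rule_format, of x] by auto
    show "f x + ?e k x = f (z x) + ?e k (z x) + (of_bool (z x = z k) - of_bool (z x = - z k) - of_bool (z x = i) + of_bool (z x = - i))" for x
      using *[of x] by linarith
  qed
qed

text \<open>A common orbit gives \<open>c = 1\<close>. On two balanced cycles the routes from
  \<open>i\<close> to \<open>- i\<close> and from \<open>j\<close> to \<open>- j\<close> solve the
  equation for \<open>- 2 e\<^sub>i\<close> and \<open>- 2 e\<^sub>j\<close>; their difference gives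
  the root with \<open>c = 2\<close>.\<close>

lemma linked_telescope:
  assumes z: "z \<in> signed_perms n" and ij: "i \<in> signed_points n" "j \<in> signed_points n" and l: "linked z i j"
  shows "\<exists>f c. c \<noteq> 0 \<and> (\<forall>x. f (- x) = - f x) \<and> (\<forall>x. f x = f (z x) +
     c * (of_bool (z x = j) - of_bool (z x = - j) - of_bool (z x = i) + of_bool (z x = - i) :: int))"
proof (cases "j \<in> orbit z i")
  case True
  then show ?thesis
    using telescope[OF z True] by (metis mult_1 zero_neq_one)
next
  case False
  then have "- i \<in> orbit z i" "- j \<in> orbit z j"
    using l ij linked_iff[OF z] linked_zero_iff[OF z] by auto
  then obtain f g :: "int \<Rightarrow> int" where f: "\<forall>x. f (- x) = - f x" "\<forall>x. f x = f (z x) +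
     (of_bool (z x = - i) - of_bool (z x = i) - of_bool (z x = i) + of_bool (z x = - i) :: int)"
   and g: "\<forall>x. g (- x) = - g x" "\<forall>x. g x = g (z x) +
     (of_bool (z x = - j) - of_bool (z x = j) - of_bool (z x = j) + of_bool (z x = - j) :: int)"
    using telescope[OF z, of "- i" i] telescope[OF z, of "- j" j] by (metis minus_minus)
  have a: "f x - g x = f (z x) - g (z x) +
    2 * (of_bool (z x = j) - of_bool (z x = - j) - of_bool (z x = i) + of_bool (z x = - i))" for x
    using f(2)[rule_format, of x] g(2)[rule_format, of x] by (simp only: algebra_simps)
  have b: "f (- x) - g (- x) = - (f x - g x)" for x
    using f(1)[rule_format, of x] g(1)[rule_format, of x] by linarith
  show ?thesis
    by (intro exI[of _ "\<lambda>x. f x - g x"] exI[of _ 2] conjI allI a b) simp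
qed

text \<open>The telescoping function moves under \<open>z\<close> exactly by a multiple of the root; as \<open>z\<close> preserves
  the norm, it acts on this function like the reflection.\<close>

lemma linked_reflect_nand:
  assumes z: "z \<in> signed_perms n" and ij: "i \<in> signed_points n" "j \<in> signed_points n" "i \<noteq> j"
    and l: "linked z i j"
  shows "\<not> linked (reflect i j \<circ> z) i j"
proof -
  define d where "d s = (of_bool (s = j) - of_bool (s = - j) - of_bool (s = i) + of_bool (s = - i) :: int)" for s
  from linked_telescope[OF z ij(1,2) l] obtain f :: "int \<Rightarrow> int" and c where c: "c \<noteq> 0"
    and odd': "\<forall>x. f (- x) = - f x" and f': "\<forall>x. f x = f (z x) + c * d (z x)"
    unfolding d_def by blast
  note odd = odd'[rule_format] and f = f'[rule_format]
  have d_odd: "d (- x) = - d x" for x by (auto simp: d_def)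
  have "(\<Sum>s\<in>signed_points n. f s * f s) = (\<Sum>s\<in>signed_points n. (f (z s) + c * d (z s)) * (f (z s) + c * d (z s)))"
    using f by metis
  also have "\<dots> = (\<Sum>s\<in>signed_points n. (f s + c * d s) * (f s + c * d s))"
    using sum.permute[OF signed_perms_permutes[OF z], of "\<lambda>s. (f s + c * d s) * (f s + c * d s)"]
    by (simp add: comp_def)
  finally have "c * (\<Sum>s\<in>signed_points n. d s * (2 * f s + c * d s)) = 0"
    by (simp add: algebra_simps sum.distrib sum_distrib_left)
  moreover have "(\<Sum>s\<in>signed_points n. d s * (2 * f s + c * d s)) = 2 * ((2 * f j + c * d j) - (2 * f i + c * d i))"
    unfolding d_def by (rule sum_odd_reflect[OF ij]) (auto simp: odd)
  ultimately have eq: "2 * f j + c * d j = 2 * f i + c * d i"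
    using c by simp
  have ne: "i \<noteq> - i" "j \<noteq> - j" "i \<noteq> 0" "j \<noteq> 0"
    using ij signed_points_neq_uminus signed_points_nonzero by auto
  have "f (reflect i j s) = f s + c * d s" for s
  proof (cases "j = - i")
    case True
    then have "f i = c" using eq ne by (simp add: d_def odd)
    then show ?thesis using True ne by (auto simp: reflect_def d_def odd)
  next
    case False
    then have *: "d j = 1" "d i = -1" "d (- j) = -1" "d (- i) = 1"
      using ne ij by (auto simp: d_def)
    then have **: "f j = f i - c" using eq by simp
    consider "s = i" | "s = j" | "s = - i" | "s = - j" | "s \<notin> {i, j, - i, - j}" by auto
    then show ?thesis
    proof cases
      case 5 then show ?thesis by (auto simp: reflect_def d_def)
    qed (use * ** odd ne in simp_all)
  qed
  then have "f \<in> inv_funs (reflect i j \<circ> z)"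
    unfolding inv_funs_def mem_Collect_eq comp_def using odd f[symmetric] by metis
  moreover have "f i \<noteq> f j"
  proof (cases "j = - i")
    case True
    then show ?thesis using eq ne c by (auto simp: d_def odd)
  next
    case False
    then have "d j = 1" "d i = -1" using ne ij by (auto simp: d_def)
    then show ?thesis using eq c by auto
  qed
  ultimately show ?thesis by (auto simp: linked_def)
qed

text \<open>This is the reason why multiplication by a reflection always changes the dimension of
  the fixed space by exactly one.\<close>

lemma linked_reflect_iff:
  assumes "z \<in> signed_perms n" "i \<in> signed_points n" "j \<in> signed_points n" "i \<noteq> j"
  shows "linked (reflect i j \<circ> z) i j \<longleftrightarrow> \<not> linked z i j"
  using linked_reflect_or[OF assms] linked_reflect_nand[OF assms] by blast

text \<open>A function with equal values at \<open>i\<close> and \<open>j\<close> does not notice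
  the reflection, so for it invariance under \<open>z\<close> and under the product mean the
  same.\<close>

lemma inv_funs_reflect:
  assumes "linked z i j"
  shows "inv_funs z = {f \<in> inv_funs (reflect i j \<circ> z). f i = f j}"
proof -
  have a: "f \<in> inv_funs (reflect i j \<circ> z) \<and> f i = f j" if "f \<in> inv_funs z" for f
    using that assms inv_fun_reflect[of f i j] by (auto simp: linked_def inv_funs_def)
  have b: "f \<in> inv_funs z" if "f \<in> inv_funs (reflect i j \<circ> z)" "f i = f j" for f
    using that inv_fun_reflect[of f i j] by (auto simp: inv_funs_def)
  show ?thesis using a b by blast
qed

section \<open>Counting invariant functions\<close>

text \<open>Residues modulo 3 chosen symmetrically about 0, so that reduction keeps functions
  odd.\<close>

definition bmod3 :: "int \<Rightarrow> int" where "bmod3 x = (x + 1) mod 3 - 1"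

lemma bmod3_range: "bmod3 x \<in> {-1, 0, 1}"
  unfolding bmod3_def by (simp, presburger)

lemma bmod3_minus: "bmod3 (- x) = - bmod3 x"
  unfolding bmod3_def by presburger

lemma bmod3_eq_iff: "bmod3 x = bmod3 y \<longleftrightarrow> 3 dvd (x - y)"
  unfolding bmod3_def by presburger

lemma bmod3_dvd: "3 dvd (bmod3 x - x)"
  unfolding bmod3_def by presburger

lemma bmod3_id: "x \<in> {-1, 0, 1} \<Longrightarrow> bmod3 x = x"
  unfolding bmod3_def by auto

lemma bmod3_0 [simp]: "bmod3 0 = 0"
  by (simp add: bmod3_id)

lemma card_odd_ternary:
  "T \<subseteq> {1..int n} \<Longrightarrow> card {f :: int \<Rightarrow> int. (\<forall>x. f (- x) = - f x) \<and> (\<forall>x. f x \<in> {-1, 0, 1}) \<and>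
     (\<forall>x. \<bar>x\<bar> \<notin> T \<longrightarrow> f x = 0)} = 3 ^ card T" (is "_ \<Longrightarrow> card ?A = _")
  and finite_odd_ternary: "T \<subseteq> {1..int n} \<Longrightarrow> finite {f :: int \<Rightarrow> int. (\<forall>x. f (- x) = - f x) \<and> (\<forall>x. f x \<in> {-1, 0, 1}) \<and>
     (\<forall>x. \<bar>x\<bar> \<notin> T \<longrightarrow> f x = 0)}"
proof -
  assume T: "T \<subseteq> {1..int n}"
  define P where "P = (T \<rightarrow>\<^sub>E {-1, 0, 1 :: int})"
  have fin: "finite T" using T finite_subset by blast
  have b: "bij_betw (\<lambda>f. restrict f T) ?A P"
  proof (rule bij_betw_byWitness[where f' = "\<lambda>g x. if \<bar>x\<bar> \<in> T then sgn x * g \<bar>x\<bar> else 0"])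
    show "\<forall>f\<in>?A. (\<lambda>x. if \<bar>x\<bar> \<in> T then sgn x * restrict f T \<bar>x\<bar> else 0) = f"
      using T by (force simp: fun_eq_iff sgn_if abs_if split: if_splits)
    show "\<forall>g\<in>P. restrict (\<lambda>x. if \<bar>x\<bar> \<in> T then sgn x * g \<bar>x\<bar> else 0) T = g"
      using T by (force simp: P_def fun_eq_iff restrict_def PiE_def extensional_def)
    show "(\<lambda>f. restrict f T) ` ?A \<subseteq> P"
      by (auto simp: P_def)
    have "g \<bar>x\<bar> \<in> {-1, 0, 1}" if "g \<in> P" "\<bar>x\<bar> \<in> T" for g x
      using that by (auto simp: P_def PiE_def Pi_def)
    then have "sgn x * g \<bar>x\<bar> \<in> {-1, 0, 1}" if "g \<in> P" "\<bar>x\<bar> \<in> T" for g x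
      using that by (fastforce simp: sgn_if)
    then have "(if \<bar>x\<bar> \<in> T then sgn x * g \<bar>x\<bar> else 0) \<in> {-1, 0, 1}" if "g \<in> P" for g x
      using that by (metis insertCI)
    then show "(\<lambda>g x. if \<bar>x\<bar> \<in> T then sgn x * g \<bar>x\<bar> else 0) ` P \<subseteq> ?A"
      unfolding image_subset_iff mem_Collect_eq by (simp add: sgn_minus)
  qed
  have c: "card P = 3 ^ card T" "finite P"
    using fin by (simp_all add: P_def card_PiE finite_PiE numeral_3_eq_3)
  show "card ?A = 3 ^ card T" "finite ?A"
    using bij_betw_same_card[OF b] bij_betw_finite[OF b] c by simp_all
qed

lemma ternary_id: "ternary n id = {f. (\<forall>x. f (- x) = - f x) \<and> (\<forall>x. f x \<in> {-1, 0, 1}) \<and>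
     (\<forall>x. \<bar>x\<bar> \<notin> {1..int n} \<longrightarrow> f x = 0)}"
  by (auto simp: ternary_def inv_funs_def signed_points_def)

lemma card_ternary_id: "card (ternary n id) = 3 ^ n"
  unfolding ternary_id by (subst card_odd_ternary[of _ n]) auto

lemma ternary_subset_id: "ternary n z \<subseteq> ternary n id"
  by (auto simp: ternary_def inv_funs_def)

lemma finite_ternary [simp]: "finite (ternary n z)"
proof -
  have "finite (ternary n id)"
    unfolding ternary_id by (rule finite_odd_ternary[of _ n]) simp
  then show ?thesis using ternary_subset_id finite_subset by blast
qed

lemma card_ternary_pos: "card (ternary n z) > 0"
proof -
  have "(\<lambda>_. 0) \<in> ternary n z" by (simp add: ternary_def inv_funs_def)
  then show ?thesis by (auto simp: card_gt_0_iff)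
qed

text \<open>Over the field with three elements \<open>f i - f j\<close> is a linear form on the
  invariant functions. It is nonzero, and a function \<open>h\<close> on which it does not vanish
  splits off a line.\<close>

lemma card_ternary_kernel:
  assumes y: "y \<in> signed_perms n" and ij: "i \<in> signed_points n" "j \<in> signed_points n"
    and nl: "\<not> linked y i j"
  shows "card (ternary n y) = 3 * card {f \<in> ternary n y. f i = f j}"
proof -
  obtain h where h: "h \<in> ternary n y" "h i \<noteq> h j"
    using not_linked_separate[OF y ij nl] by blast
  define d where "d = h i - h j"
  have hv: "h x \<in> {-1, 0, 1}" for x using h by (simp add: ternary_def)
  have "d \<in> {-2, -1, 1, 2}"
    using hv[of i] hv[of j] h(2) unfolding d_def by auto
  \<comment> \<open>A unit modulo 3 is its own inverse, so multiplying by \<open>d\<close> amounts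
    to dividing by \<open>d\<close>.\<close>
  then have dd: "3 dvd (d * d - 1)" by auto
  have d_dvd: "3 dvd c" if "3 dvd c * d" for c
  proof -
    have "3 dvd c * (d * d) - c * (d * d - 1)" using that dd by (metis dvd_diff dvd_mult dvd_mult2 mult.assoc)
    then show ?thesis by (simp add: algebra_simps)
  qed
  have closed: "(\<lambda>x. bmod3 (f x + c * h x)) \<in> ternary n y" if "f \<in> ternary n y" for f c
  proof -
    have "bmod3 (f (- x) + c * h (- x)) = - bmod3 (f x + c * h x)" for x
      using that h(1) bmod3_minus[of "f x + c * h x"] by (simp add: ternary_def inv_funs_def)
    moreover have "bmod3 (f (y x) + c * h (y x)) = bmod3 (f x + c * h x)" for x
      using that h(1) by (simp add: ternary_def inv_funs_def)
    ultimately show ?thesis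
      using that h(1) bmod3_range by (simp add: ternary_def inv_funs_def)
  qed
  \<comment> \<open>The multiple of \<open>h\<close> that has to be removed from \<open>g\<close> to
    make its values at \<open>i\<close> and \<open>j\<close> agree.\<close>
  define C where "C g = bmod3 ((g i - g j) * d)" for g :: "int \<Rightarrow> int"
  let ?K = "{f \<in> ternary n y. f i = f j}"
  have "bij_betw (\<lambda>(f, c :: int) x. bmod3 (f x + c * h x)) (?K \<times> {-1, 0, 1}) (ternary n y)"
  proof (rule bij_betw_byWitness[where f' = "\<lambda>g. (\<lambda>x. bmod3 (g x + (- C g) * h x), C g)"])
    show "\<forall>p\<in>?K \<times> {-1, 0, 1 :: int}. (\<lambda>g. (\<lambda>x. bmod3 (g x + (- C g) * h x), C g))
      ((\<lambda>(f, c) x. bmod3 (f x + c * h x)) p) = p"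
    proof
      fix p :: "(int \<Rightarrow> int) \<times> int" assume "p \<in> ?K \<times> {-1, 0, 1}"
      then obtain f c where p: "p = (f, c)" "f \<in> ternary n y" "f i = f j" "c \<in> {-1, 0, 1}" by auto
      define g where "g = (\<lambda>x. bmod3 (f x + c * h x))"
      have g: "3 dvd (g x - (f x + c * h x))" for x unfolding g_def by (rule bmod3_dvd)
      have "3 dvd (g i - g j - c * d)"
        using dvd_diff[OF g[of i] g[of j]] p(3) unfolding d_def by (simp add: algebra_simps)
      then have "3 dvd ((g i - g j - c * d) * d + c * (d * d - 1))"
        using dd by (meson dvd_add dvd_mult dvd_mult2)
      then have "bmod3 ((g i - g j) * d) = bmod3 c"
        unfolding bmod3_eq_iff by (simp add: algebra_simps)
      then have C: "C g = c" using p(4) by (simp add: C_def bmod3_id)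
      have "bmod3 (g x + (- c) * h x) = bmod3 (f x)" for x
        unfolding bmod3_eq_iff using g[of x] by (simp add: algebra_simps)
      moreover have "bmod3 (f x) = f x" for x
        using p(2) by (intro bmod3_id) (simp add: ternary_def)
      ultimately show "(\<lambda>g. (\<lambda>x. bmod3 (g x + (- C g) * h x), C g)) ((\<lambda>(f, c) x. bmod3 (f x + c * h x)) p) = p"
        using C unfolding p(1) by (simp add: g_def fun_eq_iff)
    qed
    show "\<forall>g\<in>ternary n y. (\<lambda>(f, c) x. bmod3 (f x + c * h x)) (\<lambda>x. bmod3 (g x + (- C g) * h x), C g) = g"
    proof
      fix g assume g: "g \<in> ternary n y"
      have "bmod3 (bmod3 (g x + (- C g) * h x) + C g * h x) = bmod3 (g x)" for x
        unfolding bmod3_eq_iff using bmod3_dvd[of "g x + (- C g) * h x"] by (simp add: algebra_simps)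
      moreover have "bmod3 (g x) = g x" for x
        using g by (intro bmod3_id) (simp add: ternary_def)
      ultimately show "(\<lambda>(f, c) x. bmod3 (f x + c * h x)) (\<lambda>x. bmod3 (g x + (- C g) * h x), C g) = g"
        by (simp add: fun_eq_iff)
    qed
    show "(\<lambda>(f, c) x. bmod3 (f x + c * h x)) ` (?K \<times> {-1, 0, 1 :: int}) \<subseteq> ternary n y"
      using closed by auto
    show "(\<lambda>g. (\<lambda>x. bmod3 (g x + (- C g) * h x), C g)) ` ternary n y \<subseteq> ?K \<times> {-1, 0, 1}"
    proof
      fix p assume "p \<in> (\<lambda>g. (\<lambda>x. bmod3 (g x + (- C g) * h x), C g)) ` ternary n y"
      then obtain g where g: "g \<in> ternary n y" and p: "p = (\<lambda>x. bmod3 (g x + (- C g) * h x), C g)" by auto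
      have "3 dvd ((g i - g j) * d - C g)"
        using bmod3_dvd[of "(g i - g j) * d"] unfolding C_def by (metis dvd_minus_iff minus_diff_eq)
      then have "3 dvd (((g i - g j) * d - C g) * d - (g i - g j) * (d * d - 1))"
        using dd by (meson dvd_diff dvd_mult dvd_mult2)
      then have "bmod3 (g i + (- C g) * h i) = bmod3 (g j + (- C g) * h j)"
        unfolding bmod3_eq_iff d_def by (simp add: algebra_simps)
      then show "p \<in> ?K \<times> {-1, 0, 1}"
        unfolding p using closed[OF g, of "- C g"] bmod3_range[of "(g i - g j) * d"]
        by (simp add: C_def)
    qed
  qed
  then have "card (?K \<times> {-1, 0, 1 :: int}) = card (ternary n y)"
    by (rule bij_betw_same_card)
  then show ?thesis by (simp add: card_cartesian_product)
qed

lemma ternary_reflect: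
  assumes "linked z i j"
  shows "ternary n z = {f \<in> ternary n (reflect i j \<circ> z). f i = f j}"
  using inv_funs_reflect[OF assms] by (auto simp: ternary_def)

lemma card_ternary_reflect:
  assumes z: "z \<in> signed_perms n" and ij: "i \<in> signed_points n" "j \<in> signed_points n" "i \<noteq> j" and l: "linked z i j"
  shows "card (ternary n (reflect i j \<circ> z)) = 3 * card (ternary n z)"
  using card_ternary_kernel[of "reflect i j \<circ> z" n i j] ternary_reflect[OF l, of n] linked_reflect_iff[OF z ij] l
    signed_perms_comp[OF reflect_in z] ij by simp

lemma card_ternary_reflect_not:
  assumes z: "z \<in> signed_perms n" and ij: "i \<in> signed_points n" "j \<in> signed_points n" "i \<noteq> j" and l: "\<not> linked z i j"
  shows "card (ternary n z) = 3 * card (ternary n (reflect i j \<circ> z))"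
  using card_ternary_reflect[of "reflect i j \<circ> z" n i j] linked_reflect_iff[OF z ij] l
    signed_perms_comp[OF reflect_in z] ij by simp

section \<open>Reflections, parity and absolute length\<close>

definition signed_reflections :: "nat \<Rightarrow> (int \<Rightarrow> int) set" where
  "signed_reflections n = {reflect i j | i j. i \<in> signed_points n \<and> j \<in> signed_points n \<and> \<bar>i\<bar> \<noteq> \<bar>j\<bar>}"

lemma paired_cycle_reflect: "i \<noteq> 0 \<Longrightarrow> j \<noteq> 0 \<Longrightarrow> \<bar>i\<bar> \<noteq> \<bar>j\<bar> \<Longrightarrow> paired_cycle [i, j] = reflect i j"
  by (auto simp: paired_cycle_def reflect_def fun_eq_iff Transposition.transpose_def)

lemma balanced_cycle_reflect: "i \<noteq> 0 \<Longrightarrow> balanced_cycle [i] = reflect i (- i)"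
  by (auto simp: balanced_cycle_def reflect_def fun_eq_iff Transposition.transpose_def)

lemma reflections_D_eq: "reflections_D n = signed_reflections n"
proof
  show "reflections_D n \<subseteq> signed_reflections n"
  proof
    fix t assume "t \<in> reflections_D n"
    then obtain i j where ij: "1 \<le> i" "i < j" "j \<le> int n" and "t = paired_cycle [i, j] \<or> t = paired_cycle [i, - j]"
      by (auto simp: reflections_D_def)
    then have "t = reflect i j \<or> t = reflect i (- j)"
      using paired_cycle_reflect[of i j] paired_cycle_reflect[of i "- j"] by auto
    moreover have "i \<in> signed_points n" "j \<in> signed_points n" "- j \<in> signed_points n" "\<bar>i\<bar> \<noteq> \<bar>j\<bar>" "\<bar>i\<bar> \<noteq> \<bar>- j\<bar>"
      using ij by (auto simp: signed_points_def)
    ultimately show "t \<in> signed_reflections n"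
      unfolding signed_reflections_def by blast
  qed
  have lt: "reflect i j \<in> reflections_D n"
    if "i \<in> signed_points n" "j \<in> signed_points n" "\<bar>i\<bar> < \<bar>j\<bar>" for i j
  proof -
    have pos: "reflect i j \<in> reflections_D n"
      if "1 \<le> i" "\<bar>j\<bar> \<le> int n" "i < \<bar>j\<bar>" for i j
    proof (cases "j > 0")
      case True
      then show ?thesis
        using that paired_cycle_reflect[of i j] unfolding reflections_D_def by auto
    next
      case False
      have "paired_cycle [i, - (- j)] \<in> reflections_D n"
        unfolding reflections_D_def using that False
        by (intro UnI2 CollectI exI[of _ i] exI[of _ "- j"]) auto
      then show ?thesis
        using that paired_cycle_reflect[of i j] by auto
    qed
    show ?thesis
      using pos[of i j] pos[of "- i" "- j"] that by (cases "i > 0") (auto simp: signed_points_def reflect_uminus)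
  qed
  show "signed_reflections n \<subseteq> reflections_D n"
  proof
    fix t assume "t \<in> signed_reflections n"
    then obtain i j where "t = reflect i j" "i \<in> signed_points n" "j \<in> signed_points n" "\<bar>i\<bar> \<noteq> \<bar>j\<bar>"
      by (auto simp: signed_reflections_def)
    then show "t \<in> reflections_D n"
      using lt[of i j] lt[of j i] reflect_commute[of i j] by (cases "\<bar>i\<bar> < \<bar>j\<bar>") auto
  qed
qed

lemma reflections_B_eq:
  "reflections_B n = {reflect i j | i j. i \<in> signed_points n \<and> j \<in> signed_points n \<and> i \<noteq> j}"
proof
  show "reflections_B n \<subseteq> {reflect i j | i j. i \<in> signed_points n \<and> j \<in> signed_points n \<and> i \<noteq> j}"
  proof
    fix t assume "t \<in> reflections_B n"
    then consider "t \<in> signed_reflections n" | i where "t = balanced_cycle [i]" "1 \<le> i" "i \<le> int n"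
      unfolding reflections_B_def reflections_D_eq by blast
    then show "t \<in> {reflect i j | i j. i \<in> signed_points n \<and> j \<in> signed_points n \<and> i \<noteq> j}"
    proof cases
      case 1 then show ?thesis unfolding signed_reflections_def by blast
    next
      case 2
      then have "t = reflect i (- i)" "i \<in> signed_points n" "- i \<in> signed_points n" "i \<noteq> - i"
        by (auto simp: balanced_cycle_reflect signed_points_def)
      then show ?thesis by blast
    qed
  qed
  show "{reflect i j | i j. i \<in> signed_points n \<and> j \<in> signed_points n \<and> i \<noteq> j} \<subseteq> reflections_B n"
  proof
    fix t assume "t \<in> {reflect i j | i j. i \<in> signed_points n \<and> j \<in> signed_points n \<and> i \<noteq> j}"
    then obtain i j where t: "t = reflect i j" "i \<in> signed_points n" "j \<in> signed_points n" "i \<noteq> j" by blast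
    show "t \<in> reflections_B n"
    proof (cases "\<bar>i\<bar> = \<bar>j\<bar>")
      case True
      then have j: "j = - i" using t by auto
      have "reflect i (- i) = reflect \<bar>i\<bar> (- \<bar>i\<bar>)"
        using reflect_commute[of i "- i"] by (cases "i > 0") auto
      then have "t = balanced_cycle [\<bar>i\<bar>]" "1 \<le> \<bar>i\<bar>" "\<bar>i\<bar> \<le> int n"
        using t j by (auto simp: balanced_cycle_reflect signed_points_def)
      then show ?thesis unfolding reflections_B_def by blast
    qed (use t in \<open>auto simp: reflections_B_def reflections_D_eq signed_reflections_def\<close>)
  qed
qed

text \<open>On B_n this is the homomorphism to \<open>{1, -1}\<close> whose kernel is D_n; it
  records the parity of the number of positive points with negative image.\<close>

definition sign_prod :: "nat \<Rightarrow> (int \<Rightarrow> int) \<Rightarrow> int" where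
  "sign_prod n z = (\<Prod>s\<in>{1..int n}. sgn (z s))"

text \<open>After the sign of \<open>y s\<close> is taken out, the remaining factor depends on
  \<open>\<bar>y s\<bar>\<close>, and \<open>s \<mapsto> \<bar>y s\<bar>\<close> permutes the
  positive points.\<close>

lemma sign_prod_comp:
  assumes x: "x \<in> signed_perms n" and y: "y \<in> signed_perms n"
  shows "sign_prod n (x \<circ> y) = sign_prod n x * sign_prod n y"
proof -
  have mem: "s \<in> {1..int n} \<longleftrightarrow> s \<in> signed_points n \<and> s > 0" for s
    by (auto simp: signed_points_def)
  have "sgn (x (y s)) = sgn (y s) * sgn (x \<bar>y s\<bar>)" for s
    using signed_perms_uminus[OF x, of "y s"] signed_perms_uminus[OF x, of 0]
    by (cases "y s" "0::int" rule: linorder_cases) (auto simp: sgn_minus)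
  then have "sign_prod n (x \<circ> y) = sign_prod n y * (\<Prod>s\<in>{1..int n}. sgn (x \<bar>y s\<bar>))"
    by (simp add: sign_prod_def prod.distrib)
  also have "(\<Prod>s\<in>{1..int n}. sgn (x \<bar>y s\<bar>)) = sign_prod n x"
  proof -
    have "inj_on (\<lambda>s. \<bar>y s\<bar>) {1..int n}"
    proof (rule inj_onI)
      fix s s' assume s: "s \<in> {1..int n}" "s' \<in> {1..int n}" "\<bar>y s\<bar> = \<bar>y s'\<bar>"
      then have "y s = y s' \<or> y s = y (- s')"
        using signed_perms_uminus[OF y] by auto
      then show "s = s'" using signed_perms_inj[OF y] s by auto
    qed
    moreover have "(\<lambda>s. \<bar>y s\<bar>) ` {1..int n} \<subseteq> {1..int n}"
    proof
      fix r assume "r \<in> (\<lambda>s. \<bar>y s\<bar>) ` {1..int n}"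
      then obtain s where s: "r = \<bar>y s\<bar>" "s \<in> {1..int n}" by blast
      then have "y s \<in> signed_points n" using signed_perms_mem[OF y, of s] mem by blast
      then show "r \<in> {1..int n}" using s(1) by (simp add: signed_points_def)
    qed
    ultimately have "bij_betw (\<lambda>s. \<bar>y s\<bar>) {1..int n} {1..int n}"
      by (simp add: bij_betw_def endo_inj_surj)
    then show ?thesis
      unfolding sign_prod_def by (rule prod.reindex_bij_betw)
  qed
  finally show ?thesis by (simp only: mult.commute)
qed

lemma sign_prod_id [simp]: "sign_prod n id = 1"
  by (auto simp: sign_prod_def sgn_if intro!: prod.neutral)

lemma sign_prod_diag:
  assumes "\<And>s. s \<in> {1..int n} \<Longrightarrow> z s = (if s \<in> A then - s else s)" "A \<subseteq> {1..int n}"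
  shows "sign_prod n z = (- 1) ^ card A"
proof -
  have "sign_prod n z = (\<Prod>s\<in>{1..int n}. if s \<in> A then - 1 else 1)"
    unfolding sign_prod_def using assms by (intro prod.cong) auto
  also have "\<dots> = (- 1) ^ card ({1..int n} \<inter> A)"
    by (simp add: prod.If_cases)
  also have "{1..int n} \<inter> A = A" using assms by auto
  finally show ?thesis .
qed

lemma sign_prod_reflect_neg:
  assumes "i \<in> signed_points n"
  shows "sign_prod n (reflect i (- i)) = - 1"
proof -
  have "sign_prod n (reflect i (- i)) = (- 1) ^ card {\<bar>i\<bar>}"
    using assms by (intro sign_prod_diag) (auto simp: reflect_def signed_points_def)
  then show ?thesis by simp
qed

lemma sign_prod_reflect:
  assumes ij: "i \<in> signed_points n" "j \<in> signed_points n" "\<bar>i\<bar> \<noteq> \<bar>j\<bar>"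
  shows "sign_prod n (reflect i j) = 1"
proof -
  have pos: "sign_prod n (reflect i j) = 1" if "0 < i" "0 < j" for i j
    unfolding sign_prod_def using that by (intro prod.neutral) (auto simp: reflect_def)
  \<comment> \<open>Conjugation by the balanced cycle \<open>[i]\<close> contributes its sign -1
    twice, so the sign of \<open>i\<close> may be chosen at will.\<close>
  have e: "reflect i j = reflect i (- i) \<circ> (reflect (- i) j \<circ> reflect i (- i))"
    using ij by (auto simp: reflect_def fun_eq_iff)
  have i: "reflect i (- i) \<in> signed_perms n" using ij by (intro reflect_in) auto
  have m: "reflect (- i) j \<in> signed_perms n" using ij by (intro reflect_in) auto
  have "sign_prod n (reflect i j) = sign_prod n (reflect (- i) j)"
    by (subst e, subst sign_prod_comp[OF i signed_perms_comp[OF m i]], subst sign_prod_comp[OF m i])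
      (simp add: sign_prod_reflect_neg ij)
  moreover have "i \<noteq> 0" "j \<noteq> 0" using ij signed_points_nonzero by auto
  ultimately show ?thesis
    using pos[of i j] pos[of "- i" "- j"] pos[of "- i" j] pos[of i "- j"] reflect_uminus[of i j] reflect_uminus[of "- i" j]
    by (cases "i > 0"; cases "j > 0") auto
qed

definition even_perms :: "nat \<Rightarrow> (int \<Rightarrow> int) set" where
  "even_perms n = {z \<in> signed_perms n. sign_prod n z = 1}"

lemma even_perms_comp: "x \<in> even_perms n \<Longrightarrow> y \<in> even_perms n \<Longrightarrow> x \<circ> y \<in> even_perms n"
  by (simp add: even_perms_def sign_prod_comp signed_perms_comp)

lemma even_perms_signed: "x \<in> even_perms n \<Longrightarrow> x \<in> signed_perms n"
  by (simp add: even_perms_def)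

lemma even_perms_reflect:
  "i \<in> signed_points n \<Longrightarrow> j \<in> signed_points n \<Longrightarrow> \<bar>i\<bar> \<noteq> \<bar>j\<bar> \<Longrightarrow> reflect i j \<in> even_perms n"
  by (simp add: even_perms_def sign_prod_reflect reflect_in)

lemma signed_perms_inv_comp: "x \<in> signed_perms n \<Longrightarrow> inv_into UNIV x \<circ> x = id"
  "x \<in> signed_perms n \<Longrightarrow> x \<circ> inv_into UNIV x = id"
  by (meson permutes_inv_o signed_perms_permutes)+

lemma even_perms_inv: "x \<in> even_perms n \<Longrightarrow> inv_into UNIV x \<in> even_perms n"
  using sign_prod_comp[OF signed_perms_inv, of x n x]
  by (auto simp: even_perms_def signed_perms_inv signed_perms_inv_comp)

text \<open>A point that is neither fixed nor negated is linked to its image. If there is none,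
  \<open>z\<close> only changes signs; when \<open>z\<close> is even it changes at least two of
  them, and two negated points are linked because every invariant function vanishes at both.\<close>

lemma exists_linked_reflection:
  assumes z: "z \<in> signed_perms n" "z \<noteq> id"
  shows "\<exists>i j. i \<in> signed_points n \<and> j \<in> signed_points n \<and> i \<noteq> j \<and> linked z i j
    \<and> (z \<in> even_perms n \<longrightarrow> \<bar>i\<bar> \<noteq> \<bar>j\<bar>)"
proof (cases "\<exists>i. z i \<noteq> i \<and> z i \<noteq> - i")
  case True
  then obtain i where i: "z i \<noteq> i" "z i \<noteq> - i" by blast
  then have "i \<in> signed_points n" using signed_perms_fix[OF z(1)] by blast
  then show ?thesis
    using i linked_app[of z i] signed_perms_mem[OF z(1), of i]
    by (intro exI[of _ i] exI[of _ "z i"]) (auto simp: abs_if split: if_splits)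
next
  case False
  then have diag: "z i = i \<or> z i = - i" for i by blast
  obtain i where "z i \<noteq> i" using z(2) by (auto simp: fun_eq_iff)
  then have i: "z i = - i" "z \<bar>i\<bar> = - \<bar>i\<bar>" "i \<in> signed_points n" "i \<noteq> - i"
    using diag[of i] signed_perms_fix[OF z(1), of i] signed_perms_uminus[OF z(1), of i] by (auto simp: abs_if)
  have zero: "linked z k (- k)" if "z k = - k" for k
    using linked_app[of z k] that by simp
  show ?thesis
  proof (cases "z \<in> even_perms n")
    case False
    then show ?thesis using i zero by (intro exI[of _ i] exI[of _ "- i"]) auto
  next
    case True
    define A where "A = {s \<in> {1..int n}. z s = - s}"
    have "sign_prod n z = (- 1) ^ card A"
      using diag by (intro sign_prod_diag) (auto simp: A_def)
    then have ev: "even (card A)" using True by (auto simp: even_perms_def minus_one_power_iff split: if_splits)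
    have iA: "\<bar>i\<bar> \<in> A" using i by (auto simp: A_def signed_points_def)
    have "A \<noteq> {\<bar>i\<bar>}" using ev by auto
    then obtain k where k: "k \<in> A" "k \<noteq> \<bar>i\<bar>" using iA by blast
    then show ?thesis
      using i zero linked_zero_zero[of z i k] by (intro exI[of _ i] exI[of _ k]) (auto simp: A_def signed_points_def)
  qed
qed

lemma prod_comp_simps [simp]: "prod_comp [] = id" "prod_comp (t # ts) = t \<circ> prod_comp ts"
  by (simp_all add: prod_comp_def)

lemma prod_comp_append: "prod_comp (xs @ ys) = prod_comp xs \<circ> prod_comp ys"
  by (induction xs) (auto simp: comp_assoc)

lemma reflections_B_D: "reflections_D n \<subseteq> reflections_B n"
  by (auto simp: reflections_B_def)

lemma reflections_B_signed: "t \<in> reflections_B n \<Longrightarrow> t \<in> signed_perms n"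
  by (auto simp: reflections_B_eq intro: reflect_in)

lemma prod_comp_signed: "set ts \<subseteq> reflections_B n \<Longrightarrow> prod_comp ts \<in> signed_perms n"
proof (induction ts)
  case (Cons t ts)
  then show ?case using signed_perms_comp[OF reflections_B_signed, of t n "prod_comp ts"] by (simp add: comp_def)
qed simp

text \<open>Multiplication by a reflection divides the number of ternary invariant functions by at
  most 3, starting from \<open>3 ^ n\<close> for the identity.\<close>

lemma word_bound:
  "set ts \<subseteq> reflections_B n \<Longrightarrow> 3 ^ n \<le> card (ternary n (prod_comp ts)) * 3 ^ length ts"
proof (induction ts)
  case Nil
  then show ?case unfolding prod_comp_simps card_ternary_id by simp
next
  case (Cons t ts)
  let ?z = "prod_comp ts"
  have z: "?z \<in> signed_perms n" using Cons.prems by (intro prod_comp_signed) auto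
  obtain i j where ij: "i \<in> signed_points n" "j \<in> signed_points n" "i \<noteq> j" and t: "t = reflect i j"
    using Cons.prems by (auto simp: reflections_B_eq)
  have "card (ternary n ?z) \<le> 3 * card (ternary n (t \<circ> ?z))"
    using card_ternary_reflect[OF z ij] card_ternary_reflect_not[OF z ij] unfolding t by fastforce
  then have "card (ternary n ?z) * 3 ^ length ts \<le> card (ternary n (t \<circ> ?z)) * 3 ^ length (t # ts)"
    by simp
  then show ?case unfolding prod_comp_simps(2) using Cons.IH Cons.prems by (intro order_trans[OF Cons.IH]) (simp_all add: comp_def)
qed

text \<open>Multiplying by a linked reflection triples the number of ternary invariant functions, so
  the bound of \<open>word_bound\<close> is attained greedily. For even \<open>z\<close> the
  reflection can be taken of type D, and then the product is even again.\<close>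

lemma word_exists:
  assumes "z \<in> signed_perms n"
  shows "\<exists>ts. set ts \<subseteq> reflections_B n \<and> z = prod_comp ts \<and> card (ternary n z) * 3 ^ length ts = 3 ^ n
    \<and> (z \<in> even_perms n \<longrightarrow> set ts \<subseteq> reflections_D n)"
  using assms
proof (induction "3 ^ n - card (ternary n z)" arbitrary: z rule: less_induct)
  case less
  show ?case
  proof (cases "z = id")
    case True
    then show ?thesis by (intro exI[of _ "[]"]) (simp add: card_ternary_id)
  next
    case False
    obtain i j where ij: "i \<in> signed_points n" "j \<in> signed_points n" "i \<noteq> j" "linked z i j"
      and D: "z \<in> even_perms n \<longrightarrow> \<bar>i\<bar> \<noteq> \<bar>j\<bar>"
      using exists_linked_reflection[OF less.prems False] by blast
    let ?y = "reflect i j \<circ> z"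
    have y: "?y \<in> signed_perms n" using ij less.prems by (intro signed_perms_comp reflect_in)
    have c: "card (ternary n ?y) = 3 * card (ternary n z)"
      using card_ternary_reflect[OF less.prems ij(1-3)] ij(4) by simp
    have "card (ternary n ?y) \<le> 3 ^ n"
      using card_mono[OF finite_ternary ternary_subset_id] card_ternary_id by metis
    then have "3 ^ n - card (ternary n ?y) < 3 ^ n - card (ternary n z)"
      using c card_ternary_pos[of n z] by simp
    from less.hyps[OF this y] obtain ts where ts: "set ts \<subseteq> reflections_B n" "?y = prod_comp ts"
      "card (ternary n ?y) * 3 ^ length ts = 3 ^ n" "?y \<in> even_perms n \<longrightarrow> set ts \<subseteq> reflections_D n" by blast
    have "reflect i j \<in> reflections_B n" using ij by (auto simp: reflections_B_eq)
    moreover have "z = prod_comp (reflect i j # ts)"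
      using ts(2) by (simp flip: ts(2))
    moreover have "set (reflect i j # ts) \<subseteq> reflections_D n" if "z \<in> even_perms n"
      using that D ij ts(4) even_perms_comp[OF even_perms_reflect that]
      by (auto simp: reflections_D_eq signed_reflections_def)
    moreover have "card (ternary n z) * 3 ^ length (reflect i j # ts) = 3 ^ n"
      using ts(3) c by simp
    ultimately show ?thesis
      using ts(1) by (intro exI[of _ "reflect i j # ts"]) auto
  qed
qed

abbreviation len :: "nat \<Rightarrow> (int \<Rightarrow> int) \<Rightarrow> nat" where
  "len n \<equiv> word_length (reflections_B n)"

lemma word_length_card:
  assumes "set ts \<subseteq> R" "z = prod_comp ts" "card (ternary n z) * 3 ^ length ts = 3 ^ n" "R \<subseteq> reflections_B n"
  shows "word_length R z = length ts"
  unfolding word_length_def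
proof (rule Least_equality)
  fix k assume "\<exists>us. length us = k \<and> set us \<subseteq> R \<and> z = prod_comp us"
  then obtain us where us: "length us = k" "set us \<subseteq> R" "z = prod_comp us" by blast
  then have "card (ternary n z) * 3 ^ length ts \<le> card (ternary n z) * 3 ^ k"
    using word_bound[of us n] assms by auto
  then show "length ts \<le> k" using card_ternary_pos[of n z] by simp
qed (use assms in blast)

lemma len_word:
  assumes "z \<in> signed_perms n"
  obtains ts where "set ts \<subseteq> reflections_B n" "z = prod_comp ts" "length ts = len n z"
    "card (ternary n z) * 3 ^ len n z = 3 ^ n"
    "z \<in> even_perms n \<Longrightarrow> word_length (reflections_D n) z = len n z"
proof -
  obtain ts where ts: "set ts \<subseteq> reflections_B n" "z = prod_comp ts" "card (ternary n z) * 3 ^ length ts = 3 ^ n"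
    "z \<in> even_perms n \<longrightarrow> set ts \<subseteq> reflections_D n"
    using word_exists[OF assms] by blast
  have "len n z = length ts"
    using ts by (intro word_length_card) auto
  moreover have "word_length (reflections_D n) z = length ts" if "z \<in> even_perms n"
    using ts that reflections_B_D by (intro word_length_card) auto
  ultimately show ?thesis
    using ts that[of ts] by simp
qed

lemma len_card: "z \<in> signed_perms n \<Longrightarrow> card (ternary n z) * 3 ^ len n z = 3 ^ n"
  by (erule len_word)

text \<open>Both lengths are the codimension of the fixed space, so Abs(D_n) is the order that
  Abs(B_n) induces on the even elements.\<close>

lemma word_length_D: "z \<in> even_perms n \<Longrightarrow> word_length (reflections_D n) z = len n z"
  using len_word[OF even_perms_signed] by blast

lemma coxeter_D_eq: "coxeter_D n = even_perms n"
proof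
  show "coxeter_D n \<subseteq> even_perms n"
  proof
    fix z assume "z \<in> coxeter_D n"
    then have "z \<in> generate (hyperoctahedral n) (reflections_D n)" by (simp add: coxeter_D_def)
    then show "z \<in> even_perms n"
    proof (induction rule: generate.induct)
      case one
      then show ?case by (simp add: even_perms_def) (simp add: hyperoctahedral_def flip: id_def)
    next
      case (incl h)
      then show ?case by (auto simp: reflections_D_eq signed_reflections_def intro: even_perms_reflect)
    next
      case (inv h)
      then obtain i j where h: "h = reflect i j" "h \<in> even_perms n"
        by (auto simp: reflections_D_eq signed_reflections_def intro: even_perms_reflect)
      have "inv\<^bsub>hyperoctahedral n\<^esub> h = h"
      proof (rule group.inv_equality[OF group_hyperoctahedral])
        show "h \<otimes>\<^bsub>hyperoctahedral n\<^esub> h = \<one>\<^bsub>hyperoctahedral n\<^esub>"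
          by (simp add: h hyperoctahedral_def fun_eq_iff)
      qed (use h even_perms_signed in auto)
      then show ?case using h by simp
    next
      case (eng h1 h2)
      then show ?case using even_perms_comp[of h1 n h2] by (simp add: hyperoctahedral_def comp_def)
    qed
  qed
  show "even_perms n \<subseteq> coxeter_D n"
  proof
    fix z assume z: "z \<in> even_perms n"
    then obtain ts where "set ts \<subseteq> reflections_D n" "z = prod_comp ts"
      using word_exists[of z n] by (auto simp: even_perms_signed)
    moreover have "prod_comp ts \<in> coxeter_D n" if "set ts \<subseteq> reflections_D n" for ts
      using that
    proof (induction ts)
      case Nil
      then show ?case using generate.one[of "hyperoctahedral n" "reflections_D n"]
        by (simp add: coxeter_D_def hyperoctahedral_def id_def)
    next
      case (Cons t ts)
      have "t \<in> generate (hyperoctahedral n) (reflections_D n)" using Cons.prems by (intro generate.incl) simp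
      moreover have "prod_comp ts \<in> generate (hyperoctahedral n) (reflections_D n)"
        using Cons by (simp add: coxeter_D_def)
      ultimately have "t \<otimes>\<^bsub>hyperoctahedral n\<^esub> prod_comp ts \<in> coxeter_D n"
        unfolding coxeter_D_def by (rule generate.eng)
      then show ?case by (simp add: hyperoctahedral_def comp_def)
    qed
    ultimately show "z \<in> coxeter_D n" by blast
  qed
qed

lemma len_reflect:
  assumes z: "z \<in> signed_perms n" and ij: "i \<in> signed_points n" "j \<in> signed_points n" "i \<noteq> j"
  shows "linked z i j \<Longrightarrow> len n z = Suc (len n (reflect i j \<circ> z))"
    and "\<not> linked z i j \<Longrightarrow> len n (reflect i j \<circ> z) = Suc (len n z)"
proof -
  let ?y = "reflect i j \<circ> z"
  have y: "?y \<in> signed_perms n" using z ij by (intro signed_perms_comp reflect_in)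
  note c = len_card[OF z] len_card[OF y] card_ternary_pos[of n z] card_ternary_pos[of n ?y]
  {
    assume "linked z i j"
    then have "card (ternary n z) * 3 ^ len n z = card (ternary n z) * 3 ^ Suc (len n ?y)"
      using card_ternary_reflect[OF z ij] c by simp
    then show "len n z = Suc (len n ?y)" using card_ternary_pos[of n z] by (auto simp del: power_Suc)
  }
  {
    assume "\<not> linked z i j"
    then have "card (ternary n ?y) * 3 ^ len n ?y = card (ternary n ?y) * 3 ^ Suc (len n z)"
      using card_ternary_reflect_not[OF z ij] c by simp
    then show "len n ?y = Suc (len n z)" using card_ternary_pos[of n ?y] by (auto simp del: power_Suc)
  }
qed

lemma len_id [simp]: "len n id = 0"
  using len_card[of id n] by (simp add: card_ternary_id)

lemma len_0: "z \<in> signed_perms n \<Longrightarrow> len n z = 0 \<Longrightarrow> z = id"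
  using exists_linked_reflection[of z n] len_reflect(1)[of z n] by force

lemma len_comp:
  assumes "x \<in> signed_perms n" "y \<in> signed_perms n"
  shows "len n (x \<circ> y) \<le> len n x + len n y"
proof -
  obtain ts where ts: "set ts \<subseteq> reflections_B n" "x = prod_comp ts" "length ts = len n x"
    using len_word[OF assms(1)] by blast
  obtain us where us: "set us \<subseteq> reflections_B n" "y = prod_comp us" "length us = len n y"
    using len_word[OF assms(2)] by blast
  have "length (ts @ us) = len n x + len n y" "set (ts @ us) \<subseteq> reflections_B n" "x \<circ> y = prod_comp (ts @ us)"
    using ts us by (auto simp: prod_comp_append)
  then show ?thesis
    unfolding word_length_def[of _ "x \<circ> y"] by (intro Least_le) blast
qed

section \<open>The absolute order\<close>

text \<open>The absolute order of B_n, with the quotient given as a factor \<open>y\<close> instead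
  of by an inverse, so that associativity suffices for most computations.\<close>

definition below :: "nat \<Rightarrow> (int \<Rightarrow> int) \<Rightarrow> (int \<Rightarrow> int) \<Rightarrow> bool" where
  "below n z u \<longleftrightarrow> z \<in> signed_perms n \<and> (\<exists>y\<in>signed_perms n. u = z \<circ> y \<and> len n u = len n z + len n y)"

lemma below_signed1: "below n z u \<Longrightarrow> z \<in> signed_perms n"
  by (simp add: below_def)

lemma below_signed2: "below n z u \<Longrightarrow> u \<in> signed_perms n"
  using signed_perms_comp unfolding below_def by blast

lemma below_refl: "z \<in> signed_perms n \<Longrightarrow> below n z z"
  unfolding below_def by (intro conjI bexI[of _ id]) auto

lemma below_id: "z \<in> signed_perms n \<Longrightarrow> below n id z"
  unfolding below_def by (intro conjI bexI[of _ z]) auto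

lemma below_len: "below n z u \<Longrightarrow> len n z \<le> len n u"
  by (auto simp: below_def)

lemma below_len_eq: "below n z u \<Longrightarrow> len n u \<le> len n z \<Longrightarrow> z = u"
  unfolding below_def using len_0[of _ n] by fastforce

lemma below_antisym: "below n z u \<Longrightarrow> below n u z \<Longrightarrow> z = u"
  using below_len below_len_eq by blast

lemma below_trans:
  assumes "below n z u" "below n u w"
  shows "below n z w"
proof -
  obtain y where y: "y \<in> signed_perms n" "u = z \<circ> y" "len n u = len n z + len n y" and z: "z \<in> signed_perms n"
    using assms(1) unfolding below_def by blast
  obtain v where v: "v \<in> signed_perms n" "w = u \<circ> v" "len n w = len n u + len n v"
    using assms(2) unfolding below_def by blast
  have yv: "y \<circ> v \<in> signed_perms n" using y v by (intro signed_perms_comp)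
  have w: "w = z \<circ> (y \<circ> v)" using y v by (simp add: comp_assoc)
  have "len n w \<le> len n z + len n (y \<circ> v)" unfolding w by (rule len_comp[OF z yv])
  then have "len n w = len n z + len n (y \<circ> v)"
    using len_comp[OF y(1) v(1)] y v by linarith
  then show ?thesis unfolding below_def using z yv w by blast
qed

text \<open>A common left factor cancels: both lengths drop by one and the cofactor stays the same.
  This identifies the elements above \<open>reflect i j\<close> in \<open>[e, u]\<close> with the
  interval \<open>[e, reflect i j \<circ> u]\<close>.\<close>

lemma below_reflect_both:
  assumes ij: "i \<in> signed_points n" "j \<in> signed_points n" "i \<noteq> j" and zu: "linked z i j" "linked u i j"
    and B: "z \<in> signed_perms n" "u \<in> signed_perms n"
  shows "below n (reflect i j \<circ> z) (reflect i j \<circ> u) \<longleftrightarrow> below n z u"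
proof -
  have "len n z = Suc (len n (reflect i j \<circ> z))" "len n u = Suc (len n (reflect i j \<circ> u))"
    using len_reflect(1)[OF B(1) ij zu(1)] len_reflect(1)[OF B(2) ij zu(2)] by auto
  moreover have "reflect i j \<circ> u = reflect i j \<circ> z \<circ> y \<longleftrightarrow> u = z \<circ> y" for y
    by (metis comp_assoc reflect_comp_self(2))
  moreover have "reflect i j \<circ> z \<in> signed_perms n"
    using ij B by (intro signed_perms_comp reflect_in)
  ultimately show ?thesis
    unfolding below_def using B by auto
qed

text \<open>Otherwise multiplication by the reflection would lengthen \<open>u\<close> and shorten
  \<open>z\<close>, against subadditivity of the length in the factorization of \<open>u\<close>
  through \<open>z\<close>. So moved spaces grow along the order.\<close>

lemma below_linked:
  assumes zu: "below n z u" and ij: "i \<in> signed_points n" "j \<in> signed_points n" and l: "linked z i j"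
  shows "linked u i j"
proof (rule ccontr)
  assume nl: "\<not> linked u i j"
  then have ne: "i \<noteq> j" by auto
  note zB = below_signed1[OF zu] and uB = below_signed2[OF zu]
  obtain y where y: "y \<in> signed_perms n" "u = z \<circ> y" "len n u = len n z + len n y"
    using zu unfolding below_def by blast
  have "reflect i j \<circ> u = (reflect i j \<circ> z) \<circ> y" using y by (simp add: comp_assoc)
  moreover have "reflect i j \<circ> z \<in> signed_perms n" using ij zB by (intro signed_perms_comp reflect_in)
  ultimately have "len n (reflect i j \<circ> u) \<le> len n (reflect i j \<circ> z) + len n y"
    using len_comp y(1) by metis
  then show False
    using len_reflect(1)[OF zB ij ne l] len_reflect(2)[OF uB ij ne nl] y(3) by simp
qed

lemma below_inv_funs:
  assumes zu: "below n z u" shows "inv_funs u \<subseteq> inv_funs z"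
proof
  fix f assume f: "f \<in> inv_funs u"
  note zB = below_signed1[OF zu]
  have "f (z x) = f x" for x
  proof (cases "x \<in> signed_points n")
    case True
    then have "linked u x (z x)"
      using below_linked[OF zu True] signed_perms_mem[OF zB] linked_app by blast
    then show ?thesis using f unfolding linked_def by metis
  qed (use signed_perms_fix[OF zB] in simp)
  then show "f \<in> inv_funs z" using f by (simp add: inv_funs_def)
qed

lemma linked_reflect_refl: "i \<noteq> 0 \<Longrightarrow> j \<noteq> 0 \<Longrightarrow> linked (reflect i j) i j"
  using linked_app[of "reflect i j" i] by simp

text \<open>Cancelling the reflection against itself leaves the identity, which lies below
  everything.\<close>

lemma below_reflect_iff:
  assumes ij: "i \<in> signed_points n" "j \<in> signed_points n" "i \<noteq> j" and u: "u \<in> signed_perms n"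
  shows "below n (reflect i j) u \<longleftrightarrow> linked u i j"
proof
  have l: "linked (reflect i j) i j" using ij signed_points_nonzero by (intro linked_reflect_refl) auto
  show "linked u i j" if "below n (reflect i j) u"
    using below_linked[OF that ij(1,2) l] .
  assume "linked u i j"
  then show "below n (reflect i j) u"
    using below_reflect_both[OF ij l _ reflect_in[OF ij(1,2)] u] below_id[of "reflect i j \<circ> u"]
      signed_perms_comp[OF reflect_in[OF ij(1,2)] u] by simp
qed

text \<open>Brady and Watt: inside an interval an element is determined by its moved space, and the order
  is inclusion of moved spaces. Splitting off a reflection cuts the moved space of \<open>z\<close> down to
  its intersection with that of \<open>reflect i j \<circ> u\<close>, which is checked by counting.\<close>

lemma below_if_inv_funs:
  assumes "below n x u" "below n z u" "inv_funs z \<subseteq> inv_funs x"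
  shows "below n x z"
  using assms
proof (induction "len n x" arbitrary: x z u rule: less_induct)
  case less
  note xB = below_signed1[OF less.prems(1)] and zB = below_signed1[OF less.prems(2)]
    and uB = below_signed2[OF less.prems(1)]
  show ?case
  proof (cases "x = id")
    case True
    then show ?thesis using below_id[OF zB] by simp
  next
    case False
    obtain i j where ij: "i \<in> signed_points n" "j \<in> signed_points n" "i \<noteq> j" and xl: "linked x i j"
      using exists_linked_reflection[OF xB False] by blast
    have zl: "linked z i j" using inv_funs_mono_linked[OF less.prems(3) xl] .
    have ul: "linked u i j" using below_linked[OF less.prems(1) ij(1,2) xl] .
    let ?x = "reflect i j \<circ> x" and ?z = "reflect i j \<circ> z" and ?u = "reflect i j \<circ> u"
    have tB: "reflect i j \<in> signed_perms n" using ij by (intro reflect_in)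
    note xB' = signed_perms_comp[OF tB xB] and zB' = signed_perms_comp[OF tB zB] and uB' = signed_perms_comp[OF tB uB]
    have xu: "below n ?x ?u" using below_reflect_both[OF ij xl ul xB uB] less.prems by simp
    have zu: "below n ?z ?u" using below_reflect_both[OF ij zl ul zB uB] less.prems by simp
    have "inv_funs ?z \<subseteq> inv_funs ?x"
    proof
      fix f assume f: "f \<in> inv_funs ?z"
      have "f (?x k) = f k" for k
      proof (cases "k \<in> signed_points n")
        case False
        then show ?thesis using signed_perms_fix[OF xB'] by simp
      next
        case True
        define l where "l = ?x k"
        have kl: "k \<in> signed_points n" "l \<in> signed_points n"
          using True signed_perms_mem[OF xB'] unfolding l_def by auto
        have "linked ?x k l" unfolding l_def by (rule linked_app)
        then have "linked x k l" "linked ?u k l"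
          using inv_funs_reflect[OF xl] inv_funs_mono_linked[of x ?x] below_linked[OF xu kl] by auto
        then have "linked z k l" using inv_funs_mono_linked[OF less.prems(3)] by blast
        have "linked ?z k l"
        proof (rule ccontr)
          \<comment> \<open>Both \<open>ternary n z\<close> and the functions of \<open>?z\<close>
            with equal values at \<open>k\<close> and \<open>l\<close> make up a third of
            \<open>ternary n ?z\<close>, so they would coincide. Functions invariant under
            \<open>?u\<close> have equal values at \<open>k\<close> and \<open>l\<close>; they would
            all be invariant under \<open>z\<close> and hence link \<open>i\<close> with
            \<open>j\<close> in \<open>?u\<close>, from which the reflection has been split
            off.\<close>
          assume nl: "\<not> linked ?z k l"
          let ?K = "{g \<in> ternary n ?z. g k = g l}"
          have "ternary n z \<subseteq> ?K"
            using ternary_reflect[OF zl, of n] \<open>linked z k l\<close> by (auto simp: linked_def dest: ternary_inv_funs)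
          moreover have "card (ternary n z) = card ?K"
            using card_ternary_kernel[OF zB' kl nl] card_ternary_reflect[OF zB ij zl] by simp
          ultimately have K: "ternary n z = ?K"
            by (intro card_subset_eq) auto
          have "g i = g j" if "g \<in> ternary n ?u" for g
          proof -
            have "g \<in> ternary n ?z" using that below_inv_funs[OF zu] by (auto simp: ternary_def)
            moreover have "g k = g l" using that \<open>linked ?u k l\<close> by (auto simp: linked_def dest: ternary_inv_funs)
            ultimately have "g \<in> ternary n z" using K by blast
            then show ?thesis using ternary_reflect[OF zl, of n] by blast
          qed
          then have "linked ?u i j" using not_linked_separate[OF uB' ij(1,2)] by blast
          then show False using linked_reflect_iff[OF uB ij] ul by blast
        qed
        then show ?thesis using f unfolding l_def linked_def by metis
      qed
      then show "f \<in> inv_funs ?x" using f by (simp add: inv_funs_def)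
    qed
    moreover have "len n ?x < len n x" using len_reflect(1)[OF xB ij xl] by simp
    ultimately have "below n ?x ?z" using less.hyps[OF _ xu zu] by blast
    then show ?thesis using below_reflect_both[OF ij xl zl xB zB] by simp
  qed
qed

lemma conj_reflect:
  assumes z: "z \<in> signed_perms n" and "a \<noteq> 0" "b \<noteq> 0"
  shows "z \<circ> reflect a b = reflect (z a) (z b) \<circ> z"
proof
  fix x
  have [simp]: "z y = z c \<longleftrightarrow> y = c" "z y = - z c \<longleftrightarrow> y = - c" for y c
    using signed_perms_inj[OF z, of y c] signed_perms_inj[OF z, of y "- c"] signed_perms_uminus[OF z, of c] by simp_all
  have z0: "z 0 = 0" using signed_perms_fix[OF z, of 0] by (auto simp: signed_points_def)
  have "z a \<noteq> 0" "z b \<noteq> 0"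
    using assms(2,3) signed_perms_inj[OF z, of a 0] signed_perms_inj[OF z, of b 0] z0 by auto
  then show "(z \<circ> reflect a b) x = (reflect (z a) (z b) \<circ> z) x"
    using assms(2,3) signed_perms_uminus[OF z] by (simp add: reflect_def)
qed

text \<open>Conjugation by \<open>z\<close> moves the reflection to the right of \<open>z\<close>,
  where \<open>below\<close> expects the cofactor.\<close>

lemma below_reflect_comp:
  assumes z: "z \<in> signed_perms n" and ij: "i \<in> signed_points n" "j \<in> signed_points n" "i \<noteq> j" "linked z i j"
  shows "below n (reflect i j \<circ> z) z"
proof -
  have "surj z" using z signed_perms_permutes permutes_surj by blast
  then obtain a b where ab: "i = z a" "j = z b" by (metis surjD)
  have S: "a \<in> signed_points n" "b \<in> signed_points n" "a \<noteq> b"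
    using ij ab signed_perms_mem[OF z] by auto
  have "a \<noteq> 0" "b \<noteq> 0" using S signed_points_nonzero by auto
  note conj = conj_reflect[OF z this]
  have t: "reflect i j \<circ> z = z \<circ> reflect a b" using conj ab by simp
  have "z = (reflect i j \<circ> z) \<circ> reflect a b" unfolding t by (simp add: comp_assoc)
  moreover have "len n (reflect a b) = 1"
    using len_reflect(1)[OF reflect_in[OF S(1,2)] S linked_reflect_refl] \<open>a \<noteq> 0\<close> \<open>b \<noteq> 0\<close>
    by simp
  moreover have "len n z = Suc (len n (reflect i j \<circ> z))"
    using len_reflect(1)[OF z ij] .
  ultimately show ?thesis
    unfolding below_def using S reflect_in[OF S(1,2)] signed_perms_comp[OF reflect_in[OF ij(1,2)] z]
    by (intro conjI bexI[of _ "reflect a b"]) auto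
qed

section \<open>Balanced cycles: the signed points at which all invariant functions vanish\<close>

definition zeros :: "nat \<Rightarrow> (int \<Rightarrow> int) \<Rightarrow> int set" where
  "zeros n z = {i \<in> signed_points n. linked z i (- i)}"

lemma zeros_signed: "i \<in> zeros n z \<Longrightarrow> i \<in> signed_points n"
  by (simp add: zeros_def)

lemma zero_notin_zeros [simp]: "0 \<notin> zeros n z"
  by (simp add: zeros_def signed_points_def)

lemma zeros_linked: "i \<in> zeros n z \<Longrightarrow> linked z i (- i)"
  by (simp add: zeros_def)

lemma zeros_neg [simp]: "- i \<in> zeros n z \<longleftrightarrow> i \<in> zeros n z"
  by (simp add: zeros_def linked_zero_neg)

lemma zeros_orbit_neg: "z \<in> signed_perms n \<Longrightarrow> i \<in> zeros n z \<Longrightarrow> - i \<in> orbit z i"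
  by (simp add: zeros_def linked_zero_iff)

lemma zeros_both: "i \<in> zeros n z \<Longrightarrow> j \<in> zeros n z \<Longrightarrow> linked z i j"
  by (simp add: zeros_def linked_zero_zero)

lemma zeros_cong: "linked z i j \<Longrightarrow> j \<in> signed_points n \<Longrightarrow> i \<in> zeros n z \<Longrightarrow> j \<in> zeros n z"
  by (simp add: zeros_def linked_zero_cong)

lemma zeros_mono: "below n z u \<Longrightarrow> zeros n z \<subseteq> zeros n u"
  using below_linked by (auto simp: zeros_def)

lemma zeros_orbit:
  "z \<in> signed_perms n \<Longrightarrow> i \<in> zeros n z \<Longrightarrow> j \<in> orbit z i \<Longrightarrow> j \<in> zeros n z"
  using zeros_cong[OF orbit_linked] orbit_signed_points zeros_signed by blast

lemma orbit_neg_zeros: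
  assumes z: "z \<in> signed_perms n" and "i \<in> zeros n z"
  shows "- j \<in> orbit z i \<longleftrightarrow> j \<in> orbit z i" "j \<in> orbit z (- i) \<longleftrightarrow> j \<in> orbit z i"
proof -
  have i: "- i \<in> orbit z i" "i \<in> orbit z (- i)"
    using zeros_orbit_neg[OF z assms(2)] orbit_symm[OF z] by auto
  have *: "s \<in> orbit z (- i) \<longleftrightarrow> s \<in> orbit z i" for s
    using orbit_trans[OF _ i(1), of s] orbit_trans[OF _ i(2), of s] by blast
  show "j \<in> orbit z (- i) \<longleftrightarrow> j \<in> orbit z i" by (rule *)
  show "- j \<in> orbit z i \<longleftrightarrow> j \<in> orbit z i"
    using *[of "- j"] orbit_neg[OF z, of j i] by simp
qed

text \<open>A cycle that meets neither reflected point, up to sign, keeps all of its steps in the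
  product.\<close>

lemma linked_avoid:
  assumes "orbit z k \<inter> {i, j, - i, - j} = {}" "s \<in> orbit z k" and y: "y = reflect i j \<circ> z"
  shows "linked y k s"
proof -
  have step: "linked y s (z s)" if "z s \<in> orbit z k" for s
  proof -
    have "reflect i j (z s) = z s" using that assms(1) by (intro reflect_other) auto
    then show ?thesis using linked_app[of y s] by (simp add: y)
  qed
  show ?thesis using assms(2)
    by (induction rule: orbit.induct) (blast intro: step orbit.intros linked_trans)+
qed

text \<open>The product with \<open>[j]\<close> turns the balanced cycle through \<open>j\<close>
  into a paired one and keeps the other balanced cycles. Indeed an invariant function of the product
  keeps its absolute value along the old cycle, and some such function is nonzero at
  \<open>j\<close>.\<close>

lemma linked_reflect_neg:
  assumes z: "z \<in> signed_perms n" and j: "j \<in> zeros n z" and i: "i \<in> signed_points n"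
  shows "linked (reflect j (- j) \<circ> z) i (- i) \<longleftrightarrow> linked z i (- i) \<and> i \<notin> orbit z j"
proof -
  let ?y = "reflect j (- j) \<circ> z"
  have jS: "j \<in> signed_points n" "- j \<in> signed_points n" "j \<noteq> - j"
    using j zeros_signed signed_points_neq_uminus by auto
  have jl: "linked z j (- j)" using j by (rule zeros_linked)
  show ?thesis
  proof (intro iffI conjI notI)
    assume l: "linked ?y i (- i)"
    then show "linked z i (- i)" using inv_funs_reflect[OF jl] inv_funs_mono_linked[of z ?y] by blast
    assume "i \<in> orbit z j"
    have "\<not> linked ?y j (- j)" using linked_reflect_iff[OF z jS] jl by blast
    then obtain f where f: "f \<in> inv_funs ?y" "f j \<noteq> 0" by (auto simp: linked_zero)
    have f0: "f 0 = 0" using inv_funs_odd[OF f(1), of 0] by simp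
    have *: "abs (f (z s)) = abs (f s)" for s
    proof -
      have "f (reflect j (- j) (z s)) = f s" using inv_funs_inv[OF f(1), of s] by simp
      moreover have "reflect j (- j) (z s) = z s \<or> reflect j (- j) (z s) = - z s"
        by (auto simp: reflect_def)
      ultimately show ?thesis using inv_funs_odd[OF f(1), of "z s"] by auto
    qed
    have "abs (f i) = abs (f j)"
      using \<open>i \<in> orbit z j\<close> by (induction rule: orbit.induct) (auto simp: *)
    then show False using f l by (auto simp: linked_zero)
  next
    assume *: "linked z i (- i) \<and> i \<notin> orbit z j"
    have iz: "i \<in> zeros n z" using * i by (simp add: zeros_def)
    have "j \<notin> orbit z i" using * orbit_symm[OF z] by blast
    then have "- j \<notin> orbit z i" using orbit_neg_zeros(1)[OF z iz] by blast
    then have "orbit z i \<inter> {j, - j, - j, - (- j)} = {}" using \<open>j \<notin> orbit z i\<close> by auto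
    then show "linked ?y i (- i)"
      using linked_avoid[of z i j "- j" "- i" ?y] zeros_orbit_neg[OF z iz] by simp
  qed
qed

text \<open>The product of the balanced cycles \<open>[i]\<close> and \<open>[j]\<close>. It serves
  as a probe: for \<open>i\<close> and \<open>j\<close> on balanced cycles of \<open>z\<close>, with
  distinct absolute values, it lies below \<open>z\<close> exactly when they are on different
  cycles.\<close>

definition double_neg :: "int \<Rightarrow> int \<Rightarrow> int \<Rightarrow> int" where
  "double_neg i j = reflect i (- i) \<circ> reflect j (- j)"

lemma double_neg_in: "i \<in> signed_points n \<Longrightarrow> j \<in> signed_points n \<Longrightarrow> double_neg i j \<in> signed_perms n"
  unfolding double_neg_def by (intro signed_perms_comp reflect_in) auto

lemma double_neg_zero:
  assumes "i \<in> signed_points n" "j \<in> signed_points n" "\<bar>i\<bar> \<noteq> \<bar>j\<bar>"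
  shows "linked (double_neg i j) i (- i)" "linked (double_neg i j) j (- j)"
proof -
  have "double_neg i j i = - i" "double_neg i j j = - j"
    using assms(3) signed_points_nonzero[OF assms(1)] signed_points_nonzero[OF assms(2)]
    by (auto simp: double_neg_def reflect_def)
  then show "linked (double_neg i j) i (- i)" "linked (double_neg i j) j (- j)"
    using linked_app[of "double_neg i j"] by metis+
qed

text \<open>Splitting off \<open>[i]\<close> makes the cycle of \<open>i\<close> paired, so
  \<open>[j]\<close> can be split off afterwards exactly when \<open>j\<close> is not on that
  cycle.\<close>

lemma below_double_neg:
  assumes z: "z \<in> signed_perms n" and ij: "i \<in> zeros n z" "j \<in> zeros n z" "\<bar>i\<bar> \<noteq> \<bar>j\<bar>"
  shows "below n (double_neg i j) z \<longleftrightarrow> j \<notin> orbit z i"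
proof -
  have S: "i \<in> signed_points n" "j \<in> signed_points n" "- i \<in> signed_points n" "- j \<in> signed_points n" "i \<noteq> - i" "j \<noteq> - j"
    using ij zeros_signed signed_points_neq_uminus by auto
  have l: "linked z i (- i)" "linked z j (- j)" using ij zeros_linked by auto
  let ?y = "reflect i (- i) \<circ> z"
  have y: "?y \<in> signed_perms n" using S z by (intro signed_perms_comp reflect_in)
  have "below n (double_neg i j) z \<longleftrightarrow> below n (reflect i (- i) \<circ> double_neg i j) ?y"
    using below_reflect_both[OF S(1,3,5) double_neg_zero(1)[OF S(1,2) ij(3)] l(1) double_neg_in[OF S(1,2)] z] by simp
  also have "reflect i (- i) \<circ> double_neg i j = reflect j (- j)" by (simp add: double_neg_def)
  also have "below n (reflect j (- j)) ?y \<longleftrightarrow> linked ?y j (- j)"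
    by (rule below_reflect_iff[OF S(2,4,6) y])
  also have "\<dots> \<longleftrightarrow> j \<notin> orbit z i"
    using linked_reflect_neg[OF z ij(1) S(2)] l by blast
  finally show ?thesis .
qed

text \<open>The probe \<open>double_neg i j\<close> lies below \<open>z\<close> iff it lies below
  \<open>u\<close>: its moved space is spanned by the coordinates \<open>i\<close> and
  \<open>j\<close>, which belong to the moved space of \<open>z\<close>, so
  \<open>below_if_inv_funs\<close> applies. Distinct balanced cycles of \<open>z\<close> thus lie on
  distinct balanced cycles of \<open>u\<close>, which can be used as labels.\<close>

lemma orbit_below:
  assumes zu: "below n z u" and ij: "i \<in> zeros n z" "j \<in> zeros n z"
  shows "j \<in> orbit z i \<longleftrightarrow> j \<in> orbit u i"
proof -
  note z = below_signed1[OF zu] and u = below_signed2[OF zu]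
  have iju: "i \<in> zeros n u" "j \<in> zeros n u" using ij zeros_mono[OF zu] by auto
  show ?thesis
  proof (cases "\<bar>i\<bar> = \<bar>j\<bar>")
    case True
    then have "j = i \<or> j = - i" by auto
    then show ?thesis
      using orbit_self[OF z] orbit_self[OF u] zeros_orbit_neg[OF z ij(1)] zeros_orbit_neg[OF u iju(1)] by auto
  next
    case False
    have "below n (double_neg i j) z \<longleftrightarrow> below n (double_neg i j) u"
    proof
      assume "below n (double_neg i j) u"
      moreover have "inv_funs z \<subseteq> inv_funs (double_neg i j)"
      proof
        fix f assume f: "f \<in> inv_funs z"
        then have "f i = 0" "f j = 0" "\<And>x. f (- x) = - f x"
          using ij zeros_linked by (auto simp: linked_zero inv_funs_odd)
        then show "f \<in> inv_funs (double_neg i j)"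
          using inv_fun_reflect[of f] by (simp add: inv_funs_def double_neg_def)
      qed
      ultimately show "below n (double_neg i j) z" using below_if_inv_funs zu by blast
    qed (use below_trans zu in blast)
    then show ?thesis
      using below_double_neg[OF z ij False] below_double_neg[OF u iju False] by blast
  qed
qed

lemma double_neg_reflect:
  "i \<noteq> 0 \<Longrightarrow> j \<noteq> 0 \<Longrightarrow> \<bar>i\<bar> \<noteq> \<bar>j\<bar> \<Longrightarrow> reflect i j \<circ> double_neg i j = reflect i (- j)"
  by (auto simp: double_neg_def reflect_def fun_eq_iff)

text \<open>The reflections \<open>reflect i j\<close> and \<open>reflect i (- j)\<close> multiply
  to \<open>[i][j]\<close>, so the question is again whether the probe lies below
  \<open>u\<close>.\<close>

lemma linked_reflect_zeros:
  assumes u: "u \<in> signed_perms n" and ij: "i \<in> zeros n u" "j \<in> zeros n u" "\<bar>i\<bar> \<noteq> \<bar>j\<bar>"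
  shows "linked (reflect i j \<circ> u) i (- j) \<longleftrightarrow> j \<notin> orbit u i"
proof -
  have S: "i \<in> signed_points n" "j \<in> signed_points n" "- j \<in> signed_points n" "i \<noteq> j" "i \<noteq> - j"
    using ij zeros_signed by auto
  let ?y = "reflect i j \<circ> u"
  have y: "?y \<in> signed_perms n" using S u by (intro signed_perms_comp reflect_in)
  have d: "linked (double_neg i j) i j"
    using double_neg_zero[OF S(1,2) ij(3)] by (rule linked_zero_zero)
  have "below n (double_neg i j) u \<longleftrightarrow> below n (reflect i j \<circ> double_neg i j) ?y"
    using below_reflect_both[OF S(1,2,4) d zeros_both[OF ij(1,2)] double_neg_in[OF S(1,2)] u] by simp
  also have "reflect i j \<circ> double_neg i j = reflect i (- j)"
    using S signed_points_nonzero[of i n] signed_points_nonzero[of j n] ij by (intro double_neg_reflect) auto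
  also have "below n (reflect i (- j)) ?y \<longleftrightarrow> linked ?y i (- j)"
    by (rule below_reflect_iff[OF S(1,3,5) y])
  finally show ?thesis using below_double_neg[OF u ij] by simp
qed

lemma orbit_fixed: "z s = s \<Longrightarrow> orbit z s = {s}"
  by (simp add: orbit_eq_singleton_iff)

lemma orbit_negated: "z \<in> signed_perms n \<Longrightarrow> z s = - s \<Longrightarrow> orbit z s \<subseteq> {s, - s}"
proof
  fix x assume "x \<in> orbit z s" "z \<in> signed_perms n" "z s = - s"
  then show "x \<in> {s, - s}"
    by (induction rule: orbit.induct) (auto simp: signed_perms_uminus)
qed

lemma linked_fixed:
  assumes z: "z \<in> signed_perms n" "z s = s" and "s \<in> signed_points n" "b \<in> signed_points n" "linked z s b"
  shows "b = s"
proof -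
  have "orbit z s = {s}" using z(2) by (rule orbit_fixed)
  then show ?thesis
    using linked_iff[OF z(1) assms(3,4)] assms(5) linked_zero_iff[OF z(1), of s] signed_points_neq_uminus[OF assms(3)]
    by auto
qed

text \<open>The product \<open>y\<close> bypasses \<open>s\<close>: it fixes \<open>s\<close> and
  sends the predecessor of \<open>s\<close> to \<open>z s\<close>. A function invariant under
  \<open>y\<close> becomes invariant under \<open>z\<close> once \<open>s\<close> is given the value
  of its successor, so no link between the remaining points is lost.\<close>

lemma remove_point:
  assumes z: "z \<in> signed_perms n" and s: "z s \<noteq> s" "z s \<noteq> - s" and y: "y = reflect s (z s) \<circ> z"
  shows "below n y z" "len n y < len n z"
    and "\<bar>a\<bar> \<noteq> \<bar>s\<bar> \<Longrightarrow> \<bar>b\<bar> \<noteq> \<bar>s\<bar> \<Longrightarrow> linked z a b \<Longrightarrow> linked y a b"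
proof -
  have S: "s \<in> signed_points n" "z s \<in> signed_points n" "s \<noteq> z s"
    using s signed_perms_fix[OF z] signed_perms_mem[OF z] by auto
  show "below n y z" unfolding y using below_reflect_comp[OF z S] linked_app by blast
  show "len n y < len n z" unfolding y using len_reflect(1)[OF z S linked_app] by simp
  assume a: "\<bar>a\<bar> \<noteq> \<bar>s\<bar>" and b: "\<bar>b\<bar> \<noteq> \<bar>s\<bar>" and l: "linked z a b"
  show "linked y a b" unfolding linked_def
  proof
    fix f assume f: "f \<in> inv_funs y"
    define g where "g x = (if x = s then f (z s) else if x = - s then - f (z s) else f x)" for x
    have s0: "s \<noteq> 0" "s \<noteq> - s" "z s \<noteq> 0" using S signed_points_nonzero signed_points_neq_uminus by auto
    have "g (z x) = g x" for x
    proof -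
      have zx: "z (- x) = - z x" for x by (rule signed_perms_uminus[OF z])
      have fn: "f (- x) = - f x" for x by (rule inv_funs_odd[OF f])
      have fi: "f (reflect s (z s) (z x)) = f x" using inv_funs_inv[OF f, of x] by (simp add: y)
      consider "x = s" | "x = - s" | "z x = s" | "z x = - s" | "x \<noteq> s" "x \<noteq> - s" "z x \<noteq> s" "z x \<noteq> - s" by blast
      then show ?thesis
      proof cases
        case 1 then show ?thesis using s by (auto simp: g_def)
      next
        case 2 then show ?thesis using s s0 by (auto simp: g_def zx fn)
      next
        case 3
        then have "x \<noteq> s" "x \<noteq> - s" using s zx[of s] by auto
        then show ?thesis using 3 fi s0 by (simp add: g_def)
      next
        case 4
        then have "x \<noteq> s" "x \<noteq> - s" using s zx[of s] by auto
        then show ?thesis using 4 fi s0 by (simp add: g_def fn)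
      next
        case 5
        then have "z x \<noteq> z s" "z x \<noteq> - z s"
          using signed_perms_inj[OF z, of x s] signed_perms_inj[OF z, of x "- s"] zx[of s] by auto
        then show ?thesis using 5 fi by (simp add: g_def reflect_other)
      qed
    qed
    moreover have "g (- x) = - g x" for x
      using inv_funs_odd[OF f] s0 by (simp add: g_def)
    ultimately have "g \<in> inv_funs z" by (simp add: inv_funs_def)
    then have "g a = g b" using l by (simp add: linked_def)
    then show "f a = f b" using a b by (auto simp: g_def split: if_splits)
  qed
qed

text \<open>A shortest even element below \<open>u\<close> that keeps \<open>T\<close> on balanced
  cycles has the required form. A moved point off \<open>T\<close> and \<open>- T\<close> could be
  bypassed by a reflection of type D, unless it forms a balanced 1-cycle; but then its cycle in
  \<open>u\<close> meets \<open>T\<close>, and \<open>orbit_below\<close> puts a point of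
  \<open>T\<close> on that 1-cycle.\<close>

lemma restrict_to:
  assumes u: "u \<in> even_perms n" and T: "T \<subseteq> zeros n u" "\<And>s. s \<in> zeros n u \<Longrightarrow> \<exists>a\<in>T. s \<in> orbit u a"
  shows "\<exists>z\<in>even_perms n. below n z u \<and> T \<subseteq> zeros n z \<and> (\<forall>s. s \<notin> T \<longrightarrow> - s \<notin> T \<longrightarrow> z s = s)"
proof -
  let ?Q = "\<lambda>z. z \<in> even_perms n \<and> below n z u \<and> T \<subseteq> zeros n z"
  have "?Q u" using u T even_perms_signed below_refl by blast
  then obtain z where z: "?Q z" and min: "\<And>y. ?Q y \<Longrightarrow> len n z \<le> len n y"
    using ex_has_least_nat[of ?Q u "len n"] by blast
  have zB: "z \<in> signed_perms n" using z even_perms_signed by blast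
  have uB: "u \<in> signed_perms n" using u even_perms_signed by blast
  have "z s = s" if s: "s \<notin> T" "- s \<notin> T" for s
  proof (rule ccontr)
    assume ne: "z s \<noteq> s"
    have sS: "s \<in> signed_points n" "z s \<in> signed_points n" using ne signed_perms_fix[OF zB] signed_perms_mem[OF zB] by auto
    show False
    proof (cases "z s = - s")
      case True
      have sz: "s \<in> zeros n z" using linked_app[of z s] True sS by (simp add: zeros_def)
      then obtain a where a: "a \<in> T" "s \<in> orbit u a" using T zeros_mono z by blast
      then have "s \<in> orbit z a" using orbit_below[of n z u a s] sz z by blast
      then have "a \<in> {s, - s}" using orbit_symm[OF zB] orbit_negated[OF zB True] by blast
      then show False using s a by auto
    next
      case False
      define y where "y = reflect s (z s) \<circ> z"
      note r = remove_point[OF zB ne False y_def]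
      have "\<bar>s\<bar> \<noteq> \<bar>z s\<bar>" using ne False by (auto simp: abs_if split: if_splits)
      then have "y \<in> even_perms n"
        unfolding y_def using sS z by (intro even_perms_comp even_perms_reflect) auto
      moreover have "a \<in> zeros n y" if "a \<in> T" for a
      proof -
        have "\<bar>a\<bar> \<noteq> \<bar>s\<bar>" using that s by (auto simp: abs_if split: if_splits)
        then show ?thesis using r(3)[of a "- a"] z that by (auto simp: zeros_def)
      qed
      ultimately have "?Q y" using r(1) z below_trans by blast
      then show False using min r(2) by force
    qed
  qed
  then show ?thesis using z by blast
qed

lemma zeros_fixed_off:
  assumes z: "z \<in> signed_perms n" and T: "\<forall>s. s \<notin> T \<longrightarrow> - s \<notin> T \<longrightarrow> z s = s"
    and a: "a \<in> signed_points n" "b \<in> signed_points n" "linked z a b" "a \<noteq> b"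
  shows "a \<in> T \<or> - a \<in> T"
  using linked_fixed[OF z _ a(1,2,3)] a(4) T by blast

text \<open>By \<open>restrict_to\<close> it suffices to look at an element supported on one point
  of each balanced cycle, up to sign. It cannot move a representative to another one, so it negates
  them all, and its sign is -1 to the power \<open>card R\<close>.\<close>

lemma even_card_balanced:
  assumes u: "u \<in> even_perms n" and R: "R \<subseteq> zeros n u \<inter> {1..int n}"
    and dist: "\<And>i j. i \<in> R \<Longrightarrow> j \<in> R \<Longrightarrow> j \<in> orbit u i \<Longrightarrow> i = j"
    and cover: "\<And>s. s \<in> zeros n u \<Longrightarrow> \<exists>a\<in>R. s \<in> orbit u a"
  shows "even (card R)"
proof -
  obtain z where z: "z \<in> even_perms n" "below n z u" "R \<subseteq> zeros n z" "\<forall>s. s \<notin> R \<longrightarrow> - s \<notin> R \<longrightarrow> z s = s"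
    using restrict_to[OF u _ cover] R by blast
  have zB: "z \<in> signed_perms n" using z even_perms_signed by blast
  have neg: "z a = - a" if a: "a \<in> R" for a
  proof -
    have az: "a \<in> zeros n z" using a z by blast
    have o: "z a \<in> orbit z a" by (rule orbit.base)
    have ne: "z a \<noteq> a" using zeros_orbit_neg[OF zB az] orbit_fixed[of z a] signed_points_neq_uminus[OF zeros_signed[OF az]] by auto
    have "z a \<in> R \<or> - z a \<in> R"
      using z(4) ne signed_perms_inj[OF zB, of "z a" a] by metis
    then obtain b where b: "b \<in> R" "z a = b \<or> z a = - b" by (metis minus_minus)
    then have "b \<in> orbit z a" using o orbit_neg_zeros(1)[OF zB az, of b] by auto
    then have "a = b" using dist[OF a b(1)] orbit_below[OF z(2) az] b(1) z(3) by blast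
    then show ?thesis using b ne by auto
  qed
  have "sign_prod n z = (- 1) ^ card R"
  proof (rule sign_prod_diag)
    fix s assume s: "s \<in> {1..int n}"
    have "- s \<notin> R" using R s by auto
    then show "z s = (if s \<in> R then - s else s)" using neg z(4) by auto
  qed (use R in auto)
  then show ?thesis using z(1) by (auto simp: even_perms_def minus_one_power_iff split: if_splits)
qed

section \<open>Crossing pairs of reflections\<close>

lemma even_card_reps:
  assumes u: "u \<in> even_perms n" and R: "R \<subseteq> zeros n u"
    and dist: "\<And>i j. i \<in> R \<Longrightarrow> j \<in> R \<Longrightarrow> j \<in> orbit u i \<Longrightarrow> i = j"
    and cover: "\<And>s. s \<in> zeros n u \<Longrightarrow> \<exists>a\<in>R. s \<in> orbit u a"
  shows "even (card R)"
proof -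
  have uB: "u \<in> signed_perms n" using u even_perms_signed by blast
  have abs_mem: "\<bar>j\<bar> \<in> orbit u \<bar>i\<bar> \<longleftrightarrow> j \<in> orbit u i" if "i \<in> zeros n u" for i j
    using orbit_neg_zeros[OF uB that] orbit_neg[OF uB] by (metis abs_if minus_minus)
  have inj: "inj_on abs R"
  proof (rule inj_onI)
    fix i j assume ij: "i \<in> R" "j \<in> R" "\<bar>i\<bar> = \<bar>j\<bar>"
    then have "j \<in> orbit u i"
      using abs_mem[of i j] R orbit_self[OF uB, of "\<bar>i\<bar>"] by auto
    then show "i = j" using dist ij by blast
  qed
  have "even (card (abs ` R))"
  proof (rule even_card_balanced[OF u])
    show "abs ` R \<subseteq> zeros n u \<inter> {1..int n}"
    proof
      fix x assume "x \<in> abs ` R"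
      then obtain i where i: "i \<in> R" "x = \<bar>i\<bar>" by blast
      then have "\<bar>i\<bar> \<in> zeros n u" using R zeros_neg by (auto simp: abs_if)
      then show "x \<in> zeros n u \<inter> {1..int n}"
        using i zeros_signed[of "\<bar>i\<bar>"] by (auto simp: signed_points_def)
    qed
    show "i = j" if "i \<in> abs ` R" "j \<in> abs ` R" "j \<in> orbit u i" for i j
      using that abs_mem dist R by blast
    show "\<exists>a\<in>abs ` R. s \<in> orbit u a" if s: "s \<in> zeros n u" for s
    proof -
      obtain a where a: "a \<in> R" "s \<in> orbit u a" using cover[OF s] by blast
      then have "s \<in> orbit u \<bar>a\<bar>"
        using orbit_neg_zeros(2)[OF uB, of a] R by (auto simp: abs_if)
      then show ?thesis using a by blast
    qed
  qed
  then show ?thesis using card_image[OF inj] by simp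
qed

lemma zeros_two_orbits:
  assumes u: "u \<in> even_perms n" and i: "i \<in> zeros n u"
  shows "\<exists>j\<in>zeros n u. j \<notin> orbit u i"
proof (rule ccontr)
  assume "\<not> ?thesis"
  then have "even (card {i})" using i by (intro even_card_reps[OF u]) auto
  then show False by simp
qed

text \<open>An element below the product cannot link \<open>i\<close> and \<open>j\<close>, so the
  reflection can be multiplied back with lengths adding up.\<close>

lemma below_prepend:
  assumes ij: "i \<in> signed_points n" "j \<in> signed_points n" "i \<noteq> j" and l: "linked z i j"
    and z: "z \<in> signed_perms n" and v: "below n v (reflect i j \<circ> z)"
  shows "linked (reflect i j \<circ> v) i j" "below n (reflect i j \<circ> v) z"
proof -
  note vB = below_signed1[OF v]
  have "\<not> linked v i j"
    using below_linked[OF v ij(1,2)] linked_reflect_iff[OF z ij] l by blast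
  then show l': "linked (reflect i j \<circ> v) i j" using linked_reflect_iff[OF vB ij] by blast
  show "below n (reflect i j \<circ> v) z"
    using below_reflect_both[OF ij l' l signed_perms_comp[OF reflect_in[OF ij(1,2)] vB] z] v by simp
qed

lemma inv_funs_reflectI:
  assumes "inv_funs w \<subseteq> inv_funs v" "linked w i j"
  shows "inv_funs w \<subseteq> inv_funs (reflect i j \<circ> v)"
proof
  fix f assume f: "f \<in> inv_funs w"
  then have "f i = f j" "\<And>x. f (- x) = - f x" "\<And>x. f (v x) = f x"
    using assms by (auto simp: linked_def inv_funs_def)
  then show "f \<in> inv_funs (reflect i j \<circ> v)"
    using inv_fun_reflect[of f i j] by (simp add: inv_funs_def)
qed

lemma inv_funs_reflect_single:
  assumes "linked w i j" shows "inv_funs w \<subseteq> inv_funs (reflect i j)"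
  using inv_funs_reflectI[of w id i j] assms by (auto simp: inv_funs_def)

text \<open>Both reflections, but neither of their two products, lie below \<open>z\<close>.\<close>

definition crossing :: "(int \<Rightarrow> int) \<Rightarrow> int \<Rightarrow> int \<Rightarrow> int \<Rightarrow> int \<Rightarrow> bool" where
  "crossing z i j k l \<longleftrightarrow> linked z i j \<and> linked z k l \<and>
     \<not> linked (reflect i j \<circ> z) k l \<and> \<not> linked (reflect k l \<circ> z) i j"

lemma crossing_swap: "crossing z i j k l \<longleftrightarrow> crossing z k l i j"
  by (auto simp: crossing_def)

lemma crossing_uminus: "crossing z i j (- k) (- l) \<longleftrightarrow> crossing z i j k l"
  by (simp add: crossing_def reflect_uminus linked_neg_iff)

text \<open>A product of the two reflections that lies below \<open>z\<close> would lie below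
  \<open>u\<close>.\<close>

lemma crossing_mono:
  assumes zu: "below n z u" and S: "i \<in> signed_points n" "j \<in> signed_points n" "k \<in> signed_points n" "l \<in> signed_points n"
    "i \<noteq> j" "k \<noteq> l" and z: "linked z i j" "linked z k l" and u: "crossing u i j k l"
  shows "crossing z i j k l"
proof -
  have lu: "linked u i j" "linked u k l" using u by (auto simp: crossing_def)
  note B = below_signed1[OF zu] below_signed2[OF zu]
  have "below n (reflect i j \<circ> z) (reflect i j \<circ> u)" "below n (reflect k l \<circ> z) (reflect k l \<circ> u)"
    using below_reflect_both[OF S(1,2,5) z(1) lu(1) B] below_reflect_both[OF S(3,4,6) z(2) lu(2) B] zu by auto
  then show ?thesis using u z below_linked S unfolding crossing_def by blast
qed

lemma nonzero_orbit:
  assumes z: "z \<in> signed_perms n" and i: "i \<in> signed_points n" "i \<notin> zeros n z" and j: "j \<in> orbit z i"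
  shows "- j \<notin> orbit z i" "j \<notin> zeros n z" "j \<in> signed_points n"
proof -
  show jS: "j \<in> signed_points n" using orbit_signed_points[OF z i(1)] j by blast
  have "- i \<notin> orbit z i" using i linked_zero_iff[OF z] by (simp add: zeros_def)
  moreover have "- i \<in> orbit z (- j)" using j orbit_symm[OF z] orbit_neg[OF z] by blast
  ultimately show "- j \<notin> orbit z i" using orbit_trans[of "- i" z "- j" i] by blast
  show "j \<notin> zeros n z" using zeros_cong[of z j i n] orbit_linked[OF j] linked_sym i by blast
qed

text \<open>Multiplication by the reflection cuts a paired cycle into two arcs; up to sign, only the
  steps that enter \<open>i\<close> or \<open>j\<close> are redirected.\<close>

lemma split_orbit:
  assumes z: "z \<in> signed_perms n" and i: "i \<in> signed_points n" "i \<notin> zeros n z" and j: "j \<in> orbit z i"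
    and s: "s \<in> orbit z i" and y: "y = reflect i j \<circ> z"
  shows "linked y i s \<or> linked y j s"
proof -
  have step: "z s = i \<or> z s = j \<or> linked y s (z s)" if "z s \<in> orbit z i" for s
  proof -
    have "z s \<noteq> - i" "z s \<noteq> - j"
      using that nonzero_orbit(1)[OF z i] j orbit_self[OF z, of i] by auto
    then have "z s = i \<or> z s = j \<or> reflect i j (z s) = z s" using reflect_other by blast
    then show ?thesis using linked_app[of y s] by (auto simp: y)
  qed
  show ?thesis using s
  proof (induction rule: orbit.induct)
    case base
    show ?case using step[OF orbit.base] by auto
  next
    case (step s)
    then have "z s \<in> orbit z i" by (intro orbit.step)
    then show ?case using \<open>\<And>s. z s \<in> orbit z i \<Longrightarrow> _\<close>[of s] step.IH linked_trans by (metis linked_refl)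
  qed
qed

text \<open>A reflection does not affect links on cycles that it misses up to sign, so the cycles of
  a crossing pair must touch. As paired and balanced cycles are disjoint, only these two
  configurations remain.\<close>

lemma crossing_cases:
  assumes z: "z \<in> signed_perms n" and S: "i \<in> signed_points n" "j \<in> signed_points n" "k \<in> signed_points n" "l \<in> signed_points n"
    and c: "crossing z i j k l"
  shows "{i, j, k, l} \<subseteq> zeros n z \<or>
    i \<notin> zeros n z \<and> k \<notin> zeros n z \<and> j \<in> orbit z i \<and> l \<in> orbit z k \<and> (k \<in> orbit z i \<or> - k \<in> orbit z i)"
proof -
  let ?y = "reflect i j \<circ> z"
  have l: "linked z i j" "linked z k l" and n: "\<not> linked ?y k l" using c by (auto simp: crossing_def)
  have ij: "i \<in> zeros n z \<longleftrightarrow> j \<in> zeros n z" and kl: "k \<in> zeros n z \<longleftrightarrow> l \<in> zeros n z"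
    using zeros_cong l linked_sym S by blast+
  have oij: "j \<in> orbit z i" if "i \<notin> zeros n z" using linked_iff[OF z S(1,2)] l that S by (auto simp: zeros_def)
  have okl: "l \<in> orbit z k" if "k \<notin> zeros n z" using linked_iff[OF z S(3,4)] l that S by (auto simp: zeros_def)
  have touch: "orbit z k \<inter> {i, j, - i, - j} \<noteq> {}" if "l \<in> orbit z k"
    using linked_avoid[of z k i j l ?y] that n by blast
  consider "i \<in> zeros n z" "k \<in> zeros n z" | "i \<in> zeros n z" "k \<notin> zeros n z" | "i \<notin> zeros n z" "k \<in> zeros n z"
    | "i \<notin> zeros n z" "k \<notin> zeros n z" by blast
  then show ?thesis
  proof cases
    case 1 then show ?thesis using ij kl by blast
  next
    case 2
    then have "s \<notin> zeros n z" if "s \<in> orbit z k" for s using nonzero_orbit(2)[OF z S(3) _ that] by blast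
    then show ?thesis using touch[OF okl] 2 ij zeros_neg by blast
  next
    case 3
    have "orbit z s \<inter> {i, j, - i, - j} = {}" if "s \<in> zeros n z" for s
      using zeros_orbit[OF z that] 3 ij zeros_neg by blast
    then have "linked ?y s (- s)" if "s \<in> zeros n z" for s
      using linked_avoid[of z s i j "- s" ?y] zeros_orbit_neg[OF z that] that by blast
    then have "linked ?y k l" using 3 kl linked_zero_zero by blast
    then show ?thesis using n by blast
  next
    case 4
    obtain s where s: "s \<in> orbit z k" "s \<in> {i, j, - i, - j}" using touch[OF okl] 4 by blast
    have "i \<in> orbit z k \<or> - i \<in> orbit z k"
    proof -
      have "i \<in> orbit z j" "- i \<in> orbit z (- j)" using oij[OF 4(1)] orbit_symm[OF z] orbit_neg[OF z] by blast+
      then show ?thesis using s orbit_trans[of i z j k] orbit_trans[of "- i" z "- j" k] by auto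
    qed
    then have "k \<in> orbit z i \<or> - k \<in> orbit z i"
      using orbit_symm[OF z, of i k] orbit_symm[OF z, of "- i" k] orbit_neg[OF z, of k "- i"] by simp
    then show ?thesis using 4 oij okl by blast
  qed
qed

text \<open>A Hurwitz move: conjugation by \<open>reflect i j\<close> exchanges the indices
  \<open>i\<close> and \<open>j\<close>.\<close>

lemma reflect_triple:
  assumes "i \<noteq> 0" "j \<noteq> 0" "s \<noteq> 0" "\<bar>i\<bar> \<noteq> \<bar>j\<bar>" "\<bar>j\<bar> \<noteq> \<bar>s\<bar>" "\<bar>i\<bar> \<noteq> \<bar>s\<bar>"
  shows "reflect i s \<circ> reflect i j = reflect i j \<circ> reflect j s"
proof
  fix x
  have d: "i \<noteq> j" "i \<noteq> - j" "- i \<noteq> j" "j \<noteq> s" "j \<noteq> - s" "- j \<noteq> s" "i \<noteq> s" "i \<noteq> - s" "- i \<noteq> s"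
    "i \<noteq> - i" "j \<noteq> - j" "s \<noteq> - s" using assms by auto
  have o: "reflect a b c = c" if "\<bar>a\<bar> \<noteq> \<bar>c\<bar>" "\<bar>b\<bar> \<noteq> \<bar>c\<bar>" for a b c
    using that by (intro reflect_other) auto
  consider "x = i" | "x = j" | "x = s" | "x = - i" | "x = - j" | "x = - s"
    | "\<bar>x\<bar> \<noteq> \<bar>i\<bar>" "\<bar>x\<bar> \<noteq> \<bar>j\<bar>" "\<bar>x\<bar> \<noteq> \<bar>s\<bar>" by (metis abs_eq_iff)
  then show "(reflect i s \<circ> reflect i j) x = (reflect i j \<circ> reflect j s) x"
    by cases (use assms o in simp_all)
qed

text \<open>Cutting a paired cycle at \<open>i\<close> and \<open>j\<close> leaves \<open>s\<close>
  on one of the two arcs. If it is the arc of \<open>j\<close>, the first alternative holds; if it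
  is that of \<open>i\<close>, a Hurwitz move yields the product in the other order.\<close>

lemma not_crossing_triple:
  assumes z: "z \<in> signed_perms n" and i: "i \<in> signed_points n" "i \<notin> zeros n z"
    and o: "j \<in> orbit z i" "s \<in> orbit z i" and ne: "i \<noteq> j" "j \<noteq> s" "i \<noteq> s"
  shows "linked (reflect i j \<circ> z) j s \<or> linked (reflect j s \<circ> z) i j"
proof (cases "linked (reflect i j \<circ> z) j s")
  case False
  let ?y = "reflect i j \<circ> z"
  have S: "j \<in> signed_points n" "s \<in> signed_points n" using nonzero_orbit(3)[OF z i] o by auto
  have abs: "\<bar>i\<bar> \<noteq> \<bar>j\<bar>" "\<bar>j\<bar> \<noteq> \<bar>s\<bar>" "\<bar>i\<bar> \<noteq> \<bar>s\<bar>"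
    using nonzero_orbit(1)[OF z i] o orbit_self[OF z, of i] ne by (auto simp: abs_eq_iff)
  have l: "linked z i j" "linked z j s" using orbit_linked[OF o(1)] orbit_linked[OF o(2)] linked_sym linked_trans by blast+
  have y: "?y \<in> signed_perms n" using z i S by (intro signed_perms_comp reflect_in)
  have w: "reflect j s \<circ> z \<in> signed_perms n" using z S by (intro signed_perms_comp reflect_in)
  have "linked ?y i s" using split_orbit[OF z i o refl] False by blast
  then have "len n z = Suc (Suc (len n (reflect i s \<circ> ?y)))"
    using len_reflect(1)[OF y i(1) S(2) ne(3)] len_reflect(1)[OF z i(1) S(1) ne(1) l(1)] by simp
  also have "reflect i s \<circ> ?y = reflect i j \<circ> (reflect j s \<circ> z)"
    using reflect_triple[OF _ _ _ abs] signed_points_nonzero[OF i(1)] signed_points_nonzero[OF S(1)]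
      signed_points_nonzero[OF S(2)] by (simp add: comp_assoc[symmetric] del: comp_apply)
  finally have "len n (reflect i j \<circ> (reflect j s \<circ> z)) \<noteq> Suc (len n (reflect j s \<circ> z))"
    using len_reflect(1)[OF z S ne(2) l(2)] by linarith
  then show ?thesis using len_reflect(2)[OF w i(1) S(1) ne(1)] by blast
qed blast

text \<open>A common index would leave only three points on a paired cycle, and two reflections on
  such a triple never cross.\<close>

lemma crossing_distinct:
  assumes z: "z \<in> signed_perms n" and i: "i \<in> signed_points n" "i \<notin> zeros n z"
    and o: "j \<in> orbit z i" "k \<in> orbit z i" "l \<in> orbit z i" and ne: "i \<noteq> j" "k \<noteq> l"
    and c: "crossing z i j k l" "reflect i j \<noteq> reflect k l"
  shows "\<bar>k\<bar> \<noteq> \<bar>i\<bar> \<and> \<bar>k\<bar> \<noteq> \<bar>j\<bar> \<and> \<bar>l\<bar> \<noteq> \<bar>i\<bar> \<and> \<bar>l\<bar> \<noteq> \<bar>j\<bar>"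
proof -
  have S: "j \<in> signed_points n" "k \<in> signed_points n" "l \<in> signed_points n" using nonzero_orbit(3)[OF z i] o by auto
  have nz: "j \<notin> zeros n z" "k \<notin> zeros n z" "l \<notin> zeros n z" using nonzero_orbit(2)[OF z i] o by auto
  have mem: "b \<in> orbit z a" if "a \<in> orbit z i" "b \<in> orbit z i" for a b
    using orbit_trans[OF that(2)] orbit_symm[OF z] that(1) by blast
  note oi = orbit_self[OF z, of i]
  have tri: "\<not> (\<not> linked (reflect a b \<circ> z) b s \<and> \<not> linked (reflect b s \<circ> z) a b)"
    if "a \<in> orbit z i" "b \<in> orbit z i" "s \<in> orbit z i" "a \<noteq> b" "b \<noteq> s" "a \<noteq> s" for a b s
    using not_crossing_triple[OF z nonzero_orbit(3)[OF z i that(1)] nonzero_orbit(2)[OF z i that(1)]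
       mem[OF that(1,2)] mem[OF that(1,3)] that(4-6)] by blast
  have eq: "\<bar>a\<bar> = \<bar>b\<bar> \<Longrightarrow> a = b" if "a \<in> orbit z i" "b \<in> orbit z i" for a b
    using that nonzero_orbit(1)[OF z i, of a] nonzero_orbit(1)[OF z i, of b] by (auto simp: abs_eq_iff)
  note c' = c(1)[unfolded crossing_def]
  have "k \<noteq> i"
  proof
    assume "k = i"
    then have "l \<noteq> j" "l \<noteq> i" using c(2) ne by auto
    then show False using tri[OF o(1) oi o(3)] c' ne \<open>k = i\<close> reflect_commute[of i j] linked_commute[of _ i j] by auto
  qed
  moreover have "k \<noteq> j"
  proof
    assume "k = j"
    then have "l \<noteq> j" "l \<noteq> i" using c(2) ne reflect_commute[of i j] by auto
    then show False using tri[OF oi o(1) o(3)] c' ne \<open>k = j\<close> by auto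
  qed
  moreover have "l \<noteq> i"
  proof
    assume "l = i"
    then have "k \<noteq> j" "k \<noteq> i" using c(2) ne reflect_commute[of i j] by auto
    then show False using tri[OF o(1) oi o(2)] c' ne \<open>l = i\<close> reflect_commute[of i j] reflect_commute[of i k]
       linked_commute[of _ i j] linked_commute[of _ i k] by auto
  qed
  moreover have "l \<noteq> j"
  proof
    assume "l = j"
    then have "k \<noteq> j" "k \<noteq> i" using c(2) ne by auto
    then show False using tri[OF oi o(1) o(2)] c' ne \<open>l = j\<close> reflect_commute[of j k] linked_commute[of _ j k] by auto
  qed
  ultimately show ?thesis using eq o oi by blast
qed

lemma crossing_split:
  assumes z: "z \<in> signed_perms n" and i: "i \<in> signed_points n" "i \<notin> zeros n z"
    and o: "j \<in> orbit z i" "k \<in> orbit z i" "l \<in> orbit z i"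
    and c: "crossing z i j k l" and y: "y = reflect i j \<circ> z"
  shows "linked y i k \<and> linked y j l \<or> linked y j k \<and> linked y i l"
proof -
  have "\<not> linked y k l" using c by (simp add: crossing_def y)
  then show ?thesis
    using split_orbit[OF z i o(1,2) y] split_orbit[OF z i o(1,3) y] linked_trans linked_sym by blast
qed

text \<open>With \<open>i\<close>, \<open>k\<close> on one arc and \<open>j\<close>,
  \<open>l\<close> on the other after the first cut, the two further cuts are independent. If the
  four absolute values are distinct, the product of the three reflections is a paired 4-cycle. Its
  moved space is spanned by the roots for \<open>i, j\<close>, for \<open>i, k\<close> and for
  \<open>j, l\<close>.\<close>

lemma crossing_join_aux:
  assumes z: "z \<in> even_perms n" and S: "i \<in> signed_points n" "j \<in> signed_points n" "k \<in> signed_points n" "l \<in> signed_points n"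
    and abs: "\<bar>i\<bar> \<noteq> \<bar>j\<bar>" "\<bar>i\<bar> \<noteq> \<bar>k\<bar>" "\<bar>j\<bar> \<noteq> \<bar>l\<bar>"
    and i: "i \<notin> zeros n z" and ij: "linked z i j"
    and y: "linked (reflect i j \<circ> z) i k" "linked (reflect i j \<circ> z) j l"
  shows "\<exists>x\<in>even_perms n. below n x z \<and> linked x i j \<and> linked x k l \<and>
    (\<forall>w. linked w i j \<and> linked w k l \<and> linked w i k \<longrightarrow> inv_funs w \<subseteq> inv_funs x)"
proof -
  let ?y = "reflect i j \<circ> z"
  have zB: "z \<in> signed_perms n" using z even_perms_signed by blast
  have ne: "i \<noteq> j" "i \<noteq> k" "j \<noteq> l" using abs by auto
  have yB: "?y \<in> signed_perms n" using S zB by (intro signed_perms_comp reflect_in)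
  have yz: "linked z a b" if "linked ?y a b" for a b
    using inv_funs_reflect[OF ij] inv_funs_mono_linked[of z ?y] that by blast
  have jz: "j \<notin> zeros n z" using zeros_cong[of z j i n] ij linked_sym i S by blast
  then have "\<not> linked ?y j (- j)" using yz[of j "- j"] S(2) unfolding zeros_def by blast
  then have l: "l \<in> orbit ?y j" using linked_iff[OF yB S(2,4)] y(2) by blast
  have nij: "\<not> linked ?y i j" using linked_reflect_iff[OF zB S(1,2) ne(1)] ij by blast
  have nji: "\<not> linked ?y j (- i)"
  proof
    assume "linked ?y j (- i)"
    then have "linked z i (- i)" using yz ij linked_trans by blast
    then show False using i S by (simp add: zeros_def)
  qed
  \<comment> \<open>The arcs stay apart up to sign: a common point would link \<open>j\<close> in
    \<open>?y\<close> with \<open>i\<close>, which the cut prevents, or with \<open>- i\<close>,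
    which would put \<open>i\<close> on a balanced cycle of \<open>z\<close>.\<close>
  have "orbit ?y j \<inter> {i, k, - i, - k} = {}"
  proof -
    have "s \<notin> orbit ?y j" if "s \<in> {i, k, - i, - k}" for s
    proof
      assume "s \<in> orbit ?y j"
      then have js: "linked ?y j s" by (rule orbit_linked)
      have "linked ?y k i" "linked ?y (- k) (- i)" using y(1) linked_sym linked_neg by blast+
      then have "linked ?y j i \<or> linked ?y j (- i)" using js that linked_trans by blast
      then show False using nij nji linked_sym by blast
    qed
    then show ?thesis by blast
  qed
  then have jl: "linked (reflect i k \<circ> ?y) j l" using linked_avoid[OF _ l refl] by blast
  let ?v = "reflect i k \<circ> reflect j l"
  let ?x = "reflect i j \<circ> ?v"
  have "reflect i k \<circ> ?y \<in> signed_perms n" using S by (intro signed_perms_comp[OF _ yB] reflect_in)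
  then have "below n (reflect j l) (reflect i k \<circ> ?y)"
    using below_reflect_iff[OF S(2,4) ne(3)] jl by blast
  note v = below_prepend[OF S(1,3) ne(2) y(1) yB this]
  note x = below_prepend[OF S(1,2) ne(1) ij zB v(2)]
  have "linked ?v j l"
    using inv_funs_reflect[OF v(1)] inv_funs_mono_linked[of ?v "reflect j l"] linked_reflect_refl[of j l]
      signed_points_nonzero[OF S(2)] signed_points_nonzero[OF S(4)] by simp
  then have "linked ?x j l" "linked ?x i k"
    using inv_funs_reflect[OF x(1)] inv_funs_mono_linked[of ?x ?v] v(1) by auto
  then have kl: "linked ?x k l" using x(1) linked_trans linked_sym by blast
  have "inv_funs w \<subseteq> inv_funs ?x" if "linked w i j" "linked w k l" "linked w i k" for w
  proof -
    have "linked w j l" using that linked_trans linked_sym by blast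
    then show ?thesis using that by (intro inv_funs_reflectI inv_funs_reflect_single)
  qed
  moreover have "?x \<in> even_perms n"
    using S abs by (intro even_perms_comp even_perms_reflect)
  ultimately show ?thesis using x kl by blast
qed

lemma crossing_join:
  assumes z: "z \<in> even_perms n" and i: "i \<in> signed_points n" "i \<notin> zeros n z"
    and o: "j \<in> orbit z i" "k \<in> orbit z i" "l \<in> orbit z i" and ne: "i \<noteq> j" "k \<noteq> l"
    and c: "crossing z i j k l" "reflect i j \<noteq> reflect k l"
  shows "\<exists>x\<in>even_perms n. below n x z \<and> linked x i j \<and> linked x k l \<and>
    (\<forall>w. linked w i j \<and> linked w k l \<and> linked w i k \<longrightarrow> inv_funs w \<subseteq> inv_funs x)"
proof -
  have zB: "z \<in> signed_perms n" using z even_perms_signed by blast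
  have S: "j \<in> signed_points n" "k \<in> signed_points n" "l \<in> signed_points n" using nonzero_orbit(3)[OF zB i] o by auto
  note abs = crossing_distinct[OF zB i o ne c]
  have ij: "linked z i j" using orbit_linked[OF o(1)] .
  have aij: "\<bar>i\<bar> \<noteq> \<bar>j\<bar>"
    using nonzero_orbit(1)[OF zB i o(1)] orbit_self[OF zB, of i] ne by (auto simp: abs_eq_iff)
  have jz: "j \<notin> zeros n z" using nonzero_orbit(2)[OF zB i o(1)] .
  consider "linked (reflect i j \<circ> z) i k" "linked (reflect i j \<circ> z) j l"
    | "linked (reflect i j \<circ> z) j k" "linked (reflect i j \<circ> z) i l"
    using crossing_split[OF zB i o c(1) refl] by blast
  then show ?thesis
  proof cases
    case 1
    show ?thesis using crossing_join_aux[OF z i(1) S _ _ _ i(2) ij 1] aij abs by auto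
  next
    case 2
    obtain x where "x \<in> even_perms n" "below n x z" "linked x j i" "linked x k l"
      "\<And>w. linked w j i \<and> linked w k l \<and> linked w j k \<longrightarrow> inv_funs w \<subseteq> inv_funs x"
      using crossing_join_aux[OF z S(1) i(1) S(2,3) _ _ _ jz] 2 aij abs linked_sym[OF ij] reflect_commute[of i j]
      by (metis)
    then show ?thesis using linked_sym linked_trans by blast
  qed
qed

text \<open>The two ways in which the signs of a crossing pair can match up cannot both occur below an
  element in which one of the two reflections splits a single balanced cycle.\<close>

lemma crossing_unique_sign:
  assumes u: "u \<in> signed_perms n" and z1: "below n z1 u" and z2: "below n z2 u"
    and i: "i \<in> signed_points n" "i \<notin> zeros n z1" "i \<notin> zeros n z2" and ne: "i \<noteq> j"
    and o1: "j \<in> orbit z1 i" "k \<in> orbit z1 i" "l \<in> orbit z1 i"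
    and o2: "j \<in> orbit z2 i" "- k \<in> orbit z2 i" "- l \<in> orbit z2 i"
    and c: "crossing z1 i j k l" "crossing z2 i j k l"
  shows "linked (reflect i j \<circ> u) i (- j)"
proof -
  let ?u = "reflect i j \<circ> u"
  note B1 = below_signed1[OF z1] and B2 = below_signed1[OF z2]
  have S: "j \<in> signed_points n" "k \<in> signed_points n" "l \<in> signed_points n" using nonzero_orbit(3)[OF B1 i(1,2)] o1 by auto
  have S': "- k \<in> signed_points n" "- l \<in> signed_points n" using S by auto
  have ij: "linked z1 i j" "linked z2 i j" using o1 o2 orbit_linked by auto
  have iju: "linked u i j" using below_linked[OF z1 i(1) S(1) ij(1)] .
  have y: "below n (reflect i j \<circ> z1) ?u" "below n (reflect i j \<circ> z2) ?u"
    using below_reflect_both[OF i(1) S(1) ne ij(1) iju B1 u] below_reflect_both[OF i(1) S(1) ne ij(2) iju B2 u] z1 z2 by auto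
  have n: "\<not> linked ?u i j" using linked_reflect_iff[OF u i(1) S(1) ne] iju by blast
  have p1: "linked ?u i k \<and> linked ?u j l \<or> linked ?u j k \<and> linked ?u i l"
    using crossing_split[OF B1 i(1,2) o1 c(1) refl] below_linked[OF y(1)] i(1) S by blast
  have c2: "crossing z2 i j (- k) (- l)" using c(2) crossing_uminus by blast
  have p2: "linked ?u i (- k) \<and> linked ?u j (- l) \<or> linked ?u j (- k) \<and> linked ?u i (- l)"
    using crossing_split[OF B2 i(1,3) o2 c2 refl] below_linked[OF y(2)] i(1) S S' by blast
  have zz: "linked ?u a (- a)" if "linked ?u a b" "linked ?u a (- b)" for a b
    using linked_trans[OF that(2) linked_sym[OF linked_neg[OF that(1)]]] .
  have op: "linked ?u a (- b)" if "linked ?u a c" "linked ?u b (- c)" for a b c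
    using linked_trans[OF that(1)] linked_neg[OF linked_sym[OF that(2)]] by simp
  show ?thesis
  proof (rule ccontr)
    assume m: "\<not> linked ?u i (- j)"
    have m': "\<not> linked ?u j (- i)" using m linked_neg[of ?u j "- i"] linked_sym by fastforce
    \<comment> \<open>Each sign places \<open>k\<close> on the side of \<open>i\<close> or of
      \<open>j\<close>. If both signs choose the same side, \<open>i\<close> and \<open>j\<close>
      both become zeros of \<open>?u\<close> and are linked there; if they choose different sides,
      \<open>i\<close> is linked with \<open>- j\<close>.\<close>
    consider "linked ?u i k" "linked ?u j l" "linked ?u i (- k)" "linked ?u j (- l)"
      | "linked ?u i k" "linked ?u j (- k)" | "linked ?u j k" "linked ?u i (- k)"
      | "linked ?u j k" "linked ?u i l" "linked ?u j (- k)" "linked ?u i (- l)" using p1 p2 by blast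
    then show False
    proof cases
      case 1 then show False using n linked_zero_zero zz by blast
    next
      case 2 then show False using op m by blast
    next
      case 3 then show False using op m' by blast
    next
      case 4 then show False using n linked_zero_zero zz by blast
    qed
  qed
qed

section \<open>Existence of joins\<close>

text \<open>The three alternatives correspond to the partitions \<open>()\<close>, \<open>(k, 1)\<close> and \<open>(1, 1, 1, 1)\<close>. Parity lets
  the last two be relaxed, which makes the predicate visibly monotone.\<close>

definition small_zeros :: "nat \<Rightarrow> (int \<Rightarrow> int) \<Rightarrow> bool" where
  "small_zeros n u \<longleftrightarrow> zeros n u = {} \<or>
     (\<exists>m\<in>zeros n u. u m = - m \<and>
        (\<forall>i\<in>zeros n u. \<forall>j\<in>zeros n u. \<bar>i\<bar> \<noteq> \<bar>m\<bar> \<longrightarrow> \<bar>j\<bar> \<noteq> \<bar>m\<bar> \<longrightarrow> j \<in> orbit u i)) \<or>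
     ((\<forall>i\<in>zeros n u. u i = - i) \<and> card (zeros n u) \<le> 8)"

lemma finite_zeros [simp]: "finite (zeros n u)"
  by (rule finite_subset[of _ "signed_points n"]) (auto simp: zeros_def)

lemma zeros_neg_value:
  assumes zu: "below n z u" and m: "m \<in> zeros n z" "u m = - m"
  shows "z m = - m"
proof -
  note z = below_signed1[OF zu] and u = below_signed2[OF zu]
  have o: "z m \<in> orbit z m" by (rule orbit.base)
  then have "z m \<in> orbit u m" using orbit_below[OF zu m(1)] zeros_orbit[OF z m(1)] by blast
  then have "z m \<in> {m, - m}" using orbit_negated[OF u m(2)] by blast
  moreover have "z m \<noteq> m"
    using zeros_orbit_neg[OF z m(1)] orbit_fixed[of z m] signed_points_neq_uminus[OF zeros_signed[OF m(1)]] by auto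
  ultimately show ?thesis by blast
qed

text \<open>An even element with a balanced cycle has at least two, and they lie on different cycles
  of \<open>u\<close>. The points other than \<open>m\<close> and \<open>- m\<close> offer only one
  such cycle.\<close>

lemma zeros_contain_special:
  assumes z: "z \<in> even_perms n" and zu: "below n z u" and ne: "a \<in> zeros n z"
    and m: "\<forall>i\<in>zeros n u. \<forall>j\<in>zeros n u. \<bar>i\<bar> \<noteq> \<bar>m\<bar> \<longrightarrow> \<bar>j\<bar> \<noteq> \<bar>m\<bar> \<longrightarrow> j \<in> orbit u i"
  shows "m \<in> zeros n z"
proof (rule ccontr)
  assume nm: "m \<notin> zeros n z"
  have ab: "\<bar>i\<bar> \<noteq> \<bar>m\<bar>" if "i \<in> zeros n z" for i using that nm by (auto simp: abs_eq_iff)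
  obtain b where b: "b \<in> zeros n z" "b \<notin> orbit z a" using zeros_two_orbits[OF z ne] by blast
  then have "b \<notin> orbit u a" using orbit_below[OF zu ne] by blast
  then show False using m b ne ab zeros_mono[OF zu] by blast
qed

text \<open>Lets the induction in \<open>joins_exist\<close> pass from \<open>u\<close> to
  \<open>reflect i j \<circ> u\<close>. The balanced cycles of \<open>z\<close> are labelled by
  those of \<open>u\<close>, and parity keeps the special 1-cycle as long as any balanced cycle is
  left.\<close>

lemma small_zeros_mono:
  assumes u: "small_zeros n u" and z: "z \<in> even_perms n" and zu: "below n z u"
  shows "small_zeros n z"
proof -
  have sub: "zeros n z \<subseteq> zeros n u" using zeros_mono[OF zu] .
  consider "zeros n u = {}" | m where "u m = - m"
      "\<forall>i\<in>zeros n u. \<forall>j\<in>zeros n u. \<bar>i\<bar> \<noteq> \<bar>m\<bar> \<longrightarrow> \<bar>j\<bar> \<noteq> \<bar>m\<bar> \<longrightarrow> j \<in> orbit u i"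
    | "\<forall>i\<in>zeros n u. u i = - i" "card (zeros n u) \<le> 8"
    using u unfolding small_zeros_def by blast
  then show ?thesis
  proof cases
    case 1
    then show ?thesis using sub by (simp add: small_zeros_def)
  next
    case 2
    show ?thesis
    proof (cases "zeros n z = {}")
      case False
      then obtain a where "a \<in> zeros n z" by blast
      then have m: "m \<in> zeros n z" using zeros_contain_special[OF z zu _ 2(2)] by blast
      moreover have "z m = - m" using zeros_neg_value[OF zu m 2(1)] .
      moreover have "j \<in> orbit z i" if "i \<in> zeros n z" "j \<in> zeros n z" "\<bar>i\<bar> \<noteq> \<bar>m\<bar>" "\<bar>j\<bar> \<noteq> \<bar>m\<bar>" for i j
        using orbit_below[OF zu that(1,2)] 2(2) that sub by blast
      ultimately show ?thesis unfolding small_zeros_def by blast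
    qed (simp add: small_zeros_def)
  next
    case 3
    have "card (zeros n z) \<le> 8" using card_mono[OF finite_zeros sub] 3(2) by linarith
    moreover have "\<forall>i\<in>zeros n z. z i = - i" using zeros_neg_value[OF zu] 3(1) sub by blast
    ultimately show ?thesis by (simp add: small_zeros_def)
  qed
qed

text \<open>The common upper bounds of two reflections in \<open>[e, u]\<close>, expressed through
  links.\<close>

definition pair_bound :: "nat \<Rightarrow> (int \<Rightarrow> int) \<Rightarrow> int \<Rightarrow> int \<Rightarrow> int \<Rightarrow> int \<Rightarrow> (int \<Rightarrow> int) \<Rightarrow> bool" where
  "pair_bound n u i j k l z \<longleftrightarrow> z \<in> even_perms n \<and> below n z u \<and> linked z i j \<and> linked z k l"

text \<open>The product of the two reflections lies below \<open>u\<close>, its moved space is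
  spanned by the two roots, and the moved space of every upper bound contains both.\<close>

lemma join_noncrossing:
  assumes u: "u \<in> even_perms n"
    and S: "i \<in> signed_points n" "j \<in> signed_points n" "k \<in> signed_points n" "l \<in> signed_points n"
    and abs: "\<bar>i\<bar> \<noteq> \<bar>j\<bar>" "\<bar>k\<bar> \<noteq> \<bar>l\<bar>" and ij: "linked u i j" and kl: "linked (reflect i j \<circ> u) k l"
  shows "\<exists>x. pair_bound n u i j k l x \<and> (\<forall>z. pair_bound n u i j k l z \<longrightarrow> below n x z)"
proof -
  have ne: "i \<noteq> j" "k \<noteq> l" using abs by auto
  have uB: "u \<in> signed_perms n" using u even_perms_signed by blast
  let ?x = "reflect i j \<circ> reflect k l"
  have "below n (reflect k l) (reflect i j \<circ> u)"
    using below_reflect_iff[OF S(3,4) ne(2)] kl S uB by (simp add: signed_perms_comp reflect_in)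
  note x = below_prepend[OF S(1,2) ne(1) ij uB this]
  have "linked ?x k l"
    using inv_funs_reflect[OF x(1)] inv_funs_mono_linked[of ?x "reflect k l"] linked_reflect_refl[of k l]
      signed_points_nonzero[OF S(3)] signed_points_nonzero[OF S(4)] by simp
  moreover have "?x \<in> even_perms n" using S abs by (intro even_perms_comp even_perms_reflect)
  moreover have "below n ?x z" if "pair_bound n u i j k l z" for z
    using below_if_inv_funs[OF x(2)] inv_funs_reflectI[OF inv_funs_reflect_single] that
    unfolding pair_bound_def by blast
  ultimately show ?thesis using x unfolding pair_bound_def by blast
qed

lemma avoid_negated:
  assumes u: "u \<in> signed_perms n" and k: "k \<in> zeros n u" "u k = - k" and "\<bar>k\<bar> \<noteq> \<bar>i\<bar>" "\<bar>k\<bar> \<noteq> \<bar>j\<bar>"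
  shows "linked (reflect i j \<circ> u) k (- k)"
proof -
  have "orbit u k \<inter> {i, j, - i, - j} = {}" using orbit_negated[OF u k(2)] assms(4,5) by auto
  then show ?thesis using linked_avoid[OF _ zeros_orbit_neg[OF u k(1)] refl] by blast
qed

lemma reflect_eq_cases:
  "\<bar>k\<bar> \<in> {\<bar>i\<bar>, \<bar>j\<bar>} \<Longrightarrow> \<bar>l\<bar> \<in> {\<bar>i\<bar>, \<bar>j\<bar>} \<Longrightarrow> \<bar>k\<bar> \<noteq> \<bar>l\<bar> \<Longrightarrow>
    reflect i j = reflect k l \<or> (k = i \<and> l = - j) \<or> (k = - i \<and> l = j) \<or> (k = j \<and> l = - i) \<or> (k = - j \<and> l = i)"
  using reflect_commute[of i j] reflect_uminus[of i j] reflect_uminus[of j i]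
  by (auto simp: abs_eq_iff)

text \<open>If the reflections share no index, the 1-cycles \<open>[k]\<close> and
  \<open>[l]\<close> survive the first one and keep \<open>k\<close> and \<open>l\<close> linked. If
  they share both, they are \<open>reflect i j\<close> and \<open>reflect i (- j)\<close>, whose
  product \<open>[i][j]\<close> lies below \<open>u\<close>.\<close>

lemma crossing_negated_triple:
  assumes u: "u \<in> signed_perms n" and z: "\<forall>s\<in>zeros n u. u s = - s"
    and S: "{i, j, k, l} \<subseteq> zeros n u" and abs: "\<bar>i\<bar> \<noteq> \<bar>j\<bar>" "\<bar>k\<bar> \<noteq> \<bar>l\<bar>"
    and c: "crossing u i j k l" "reflect i j \<noteq> reflect k l"
  shows "(\<bar>k\<bar> \<in> {\<bar>i\<bar>, \<bar>j\<bar>}) \<noteq> (\<bar>l\<bar> \<in> {\<bar>i\<bar>, \<bar>j\<bar>})"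
proof (rule ccontr)
  assume "\<not> ?thesis"
  then consider "\<bar>k\<bar> \<notin> {\<bar>i\<bar>, \<bar>j\<bar>}" "\<bar>l\<bar> \<notin> {\<bar>i\<bar>, \<bar>j\<bar>}" | "\<bar>k\<bar> \<in> {\<bar>i\<bar>, \<bar>j\<bar>}" "\<bar>l\<bar> \<in> {\<bar>i\<bar>, \<bar>j\<bar>}" by blast
  then show False
  proof cases
    case 1
    then have "linked (reflect i j \<circ> u) k (- k)" "linked (reflect i j \<circ> u) l (- l)"
      using S z by (intro avoid_negated[OF u]; auto)+
    then show False using c(1) linked_zero_zero by (auto simp: crossing_def)
  next
    case 2
    have iz: "i \<in> zeros n u" "j \<in> zeros n u" using S by auto
    have "j \<notin> orbit u i" using orbit_negated[OF u, of i] z iz abs(1) by force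
    then have "linked (reflect i j \<circ> u) i (- j)"
      using linked_reflect_zeros[OF u iz abs(1)] by blast
    then have "linked (reflect i j \<circ> u) k l"
      using reflect_eq_cases[OF 2 abs(2)] c(2) linked_neg[of "reflect i j \<circ> u" i "- j"] linked_sym by auto
    then show False using c(1) by (auto simp: crossing_def)
  qed
qed

text \<open>The paired 4-cycle below \<open>z1\<close> is the join once every upper bound links
  \<open>i\<close> with \<open>k\<close>. A bound that fails to do so links \<open>i\<close> with
  \<open>- k\<close> instead, and the two signs together contradict
  \<open>small_zeros\<close>.\<close>

lemma join_paired:
  assumes u: "u \<in> even_perms n" "small_zeros n u"
    and S: "i \<in> signed_points n" "j \<in> signed_points n" "k \<in> signed_points n" "l \<in> signed_points n"
    and abs: "\<bar>i\<bar> \<noteq> \<bar>j\<bar>" "\<bar>k\<bar> \<noteq> \<bar>l\<bar>" and c: "crossing u i j k l" "reflect i j \<noteq> reflect k l"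
    and z1: "pair_bound n u i j k l z1" "i \<notin> zeros n z1" "k \<in> orbit z1 i"
  shows "\<exists>x. pair_bound n u i j k l x \<and> (\<forall>z. pair_bound n u i j k l z \<longrightarrow> below n x z)"
proof -
  have ne: "i \<noteq> j" "k \<noteq> l" using abs by auto
  have uB: "u \<in> signed_perms n" using u even_perms_signed by blast
  have z1': "z1 \<in> even_perms n" "below n z1 u" "linked z1 i j" "linked z1 k l"
    using z1 by (auto simp: pair_bound_def)
  note B1 = below_signed1[OF z1'(2)]
  have c1: "crossing z1 i j k l" using crossing_mono[OF z1'(2) S ne z1'(3,4) c(1)] .
  have o1: "j \<in> orbit z1 i" "l \<in> orbit z1 k"
    using crossing_cases[OF B1 S c1] z1(2) by auto
  have l1: "l \<in> orbit z1 i" using orbit_trans[OF o1(2) z1(3)] .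
  note dist = crossing_distinct[OF B1 S(1) z1(2) o1(1) z1(3) l1 ne c1 c(2)]
  obtain x where x: "x \<in> even_perms n" "below n x z1" "linked x i j" "linked x k l"
    and xmin: "\<And>w. linked w i j \<Longrightarrow> linked w k l \<Longrightarrow> linked w i k \<Longrightarrow> inv_funs w \<subseteq> inv_funs x"
    using crossing_join[OF z1'(1) S(1) z1(2) o1(1) z1(3) l1 ne c1 c(2)] by blast
  have xu: "below n x u" using below_trans x z1' by blast
  have ik: "linked z i k" if z: "pair_bound n u i j k l z" for z
  proof (rule ccontr)
    assume nik: "\<not> linked z i k"
    have z': "z \<in> even_perms n" "below n z u" "linked z i j" "linked z k l"
      using z by (auto simp: pair_bound_def)
    note B = below_signed1[OF z'(2)]
    have cz: "crossing z i j k l" using crossing_mono[OF z'(2) S ne z'(3,4) c(1)] .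
    have "\<not> {i, j, k, l} \<subseteq> zeros n z" using nik zeros_both by blast
    then have q: "i \<notin> zeros n z" "k \<notin> zeros n z" "j \<in> orbit z i" "l \<in> orbit z k" "- k \<in> orbit z i"
      using crossing_cases[OF B S cz] nik orbit_linked by blast+
    have ml: "- l \<in> orbit z i" using orbit_trans[of "- l" z "- k" i] q orbit_neg[OF B] by blast
    \<comment> \<open>With both signs present below \<open>u\<close>, the point \<open>i\<close>,
      and with it all four indices, must lie on balanced cycles of \<open>u\<close>.\<close>
    have "linked u i k" "linked u i (- k)"
      using below_linked[OF z1'(2) S(1,3)] below_linked[OF z'(2) S(1), of "- k"] S orbit_linked z1(3) q(5) by auto
    then have "linked u i (- i)" using linked_trans linked_sym linked_neg by blast
    then have iu: "i \<in> zeros n u" using S by (simp add: zeros_def)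
    then have all: "{i, j, k, l} \<subseteq> zeros n u" using crossing_cases[OF uB S c(1)] by blast
    consider m where "\<forall>i\<in>zeros n u. \<forall>j\<in>zeros n u. \<bar>i\<bar> \<noteq> \<bar>m\<bar> \<longrightarrow> \<bar>j\<bar> \<noteq> \<bar>m\<bar> \<longrightarrow> j \<in> orbit u i"
      | "\<forall>i\<in>zeros n u. u i = - i"
      using u(2) iu unfolding small_zeros_def by blast
    then show False
    proof cases
      case 1
      show False
      \<comment> \<open>The exceptional point \<open>m\<close> can occur in only one of the two
        reflections, as these share no index up to sign. The other one has both indices on the
        single remaining cycle, a situation in which \<open>crossing_unique_sign\<close> forbids
        both signs.\<close>
      proof (cases "\<bar>m\<bar> \<in> {\<bar>i\<bar>, \<bar>j\<bar>}")
        case False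
        then have "j \<in> orbit u i" using 1 all by auto
        then have "\<not> linked (reflect i j \<circ> u) i (- j)"
          using linked_reflect_zeros[OF uB _ _ abs(1)] all by blast
        then show False
          using crossing_unique_sign[OF uB z1'(2) z'(2) S(1) z1(2) q(1) ne(1) o1(1) z1(3) l1 q(3,5) ml c1 cz] by blast
      next
        case True
        then have "\<bar>k\<bar> \<noteq> \<bar>m\<bar>" "\<bar>l\<bar> \<noteq> \<bar>m\<bar>" using dist by auto
        then have "l \<in> orbit u k" using 1 all by auto
        then have n: "\<not> linked (reflect k l \<circ> u) k (- l)"
          using linked_reflect_zeros[OF uB _ _ abs(2)] all by blast
        have k1: "k \<notin> zeros n z1" using nonzero_orbit(2)[OF B1 S(1) z1(2,3)] .
        have a1: "i \<in> orbit z1 k" using z1(3) orbit_symm[OF B1] by blast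
        have b1: "j \<in> orbit z1 k" using orbit_trans[OF o1(1) a1] .
        have "i \<in> orbit z (- k)" using q(5) orbit_symm[OF B] by blast
        then have a2: "- i \<in> orbit z k" using orbit_neg[OF B, of i "- k"] by simp
        have "- j \<in> orbit z (- i)" using q(3) orbit_neg[OF B] by blast
        then have b2: "- j \<in> orbit z k" using orbit_trans[OF _ a2] by blast
        show False
          using crossing_unique_sign[OF uB z1'(2) z'(2) S(3) k1 q(2) ne(2) o1(2) a1 b1 q(4) a2 b2
              crossing_swap[THEN iffD1, OF c1] crossing_swap[THEN iffD1, OF cz]] n by blast
      qed
    next
      case 2
      then show False using crossing_negated_triple[OF uB 2 all abs c] dist by blast
    qed
  qed
  have "below n x z" if z: "pair_bound n u i j k l z" for z
  proof -
    have z': "below n z u" "linked z i j" "linked z k l" using z by (auto simp: pair_bound_def)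
    show ?thesis using below_if_inv_funs[OF xu z'(1) xmin[OF z'(2,3) ik[OF z]]] .
  qed
  then show ?thesis using x xu unfolding pair_bound_def by blast
qed

text \<open>Every function invariant under \<open>z\<close> vanishes on \<open>T\<close>, and
  \<open>x\<close> moves nothing off \<open>T\<close> and \<open>- T\<close>.\<close>

lemma below_supported:
  assumes x: "below n x u" and z: "below n z u" and fixed: "\<forall>s. s \<notin> T \<longrightarrow> - s \<notin> T \<longrightarrow> x s = s"
    and T: "T \<subseteq> zeros n z"
  shows "below n x z"
proof (rule below_if_inv_funs[OF x z])
  note B = below_signed1[OF x]
  show "inv_funs z \<subseteq> inv_funs x"
  proof
    fix f assume f: "f \<in> inv_funs z"
    have z0: "f s = 0" if "s \<in> T \<or> - s \<in> T" for s
    proof -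
      have "s \<in> zeros n z" using that T zeros_neg by blast
      then show ?thesis using f by (auto simp: zeros_def linked_zero)
    qed
    have "f (x s) = f s" for s
    proof (cases "x s = s")
      case False
      then have "x (x s) \<noteq> x s" using signed_perms_inj[OF B] by simp
      then show ?thesis using False fixed z0 by metis
    qed simp
    then show "f \<in> inv_funs x" using f by (simp add: inv_funs_def)
  qed
qed

text \<open>The join comes from \<open>restrict_to\<close> for a suitable set \<open>T\<close>: it
  must meet every balanced cycle of \<open>u\<close>, and every upper bound must have all of
  \<open>T\<close> on balanced cycles.\<close>

lemma join_all_zero:
  assumes u: "u \<in> even_perms n" "small_zeros n u"
    and S: "i \<in> signed_points n" "j \<in> signed_points n" "k \<in> signed_points n" "l \<in> signed_points n"
    and abs: "\<bar>i\<bar> \<noteq> \<bar>j\<bar>" "\<bar>k\<bar> \<noteq> \<bar>l\<bar>" and c: "crossing u i j k l" "reflect i j \<noteq> reflect k l"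
    and zero: "\<And>z. pair_bound n u i j k l z \<Longrightarrow> {i, j, k, l} \<subseteq> zeros n z"
  shows "\<exists>x. pair_bound n u i j k l x \<and> (\<forall>z. pair_bound n u i j k l z \<longrightarrow> below n x z)"
proof -
  have uB: "u \<in> signed_perms n" using u even_perms_signed by blast
  have "pair_bound n u i j k l u"
    using u c below_refl[OF uB] by (auto simp: pair_bound_def crossing_def)
  then have all: "{i, j, k, l} \<subseteq> zeros n u" by (rule zero)
  have *: ?thesis if T: "T \<subseteq> zeros n u" "{i, j, k, l} \<subseteq> T" "\<And>s. s \<in> zeros n u \<Longrightarrow> \<exists>a\<in>T. s \<in> orbit u a"
    and z: "\<And>z. pair_bound n u i j k l z \<Longrightarrow> T \<subseteq> zeros n z" for T
  proof -
    obtain x where x: "x \<in> even_perms n" "below n x u" "T \<subseteq> zeros n x" "\<forall>s. s \<notin> T \<longrightarrow> - s \<notin> T \<longrightarrow> x s = s"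
      using restrict_to[OF u(1) T(1,3)] by blast
    have "linked x i j" "linked x k l" using x(3) T(2) by (auto intro: zeros_both)
    then have "pair_bound n u i j k l x" using x by (simp add: pair_bound_def)
    moreover have "below n x z" if "pair_bound n u i j k l z" for z
      using below_supported[OF x(2) _ x(4) z[OF that]] that by (simp add: pair_bound_def)
    ultimately show ?thesis by blast
  qed
  consider m where "m \<in> zeros n u" "\<forall>i\<in>zeros n u. \<forall>j\<in>zeros n u. \<bar>i\<bar> \<noteq> \<bar>m\<bar> \<longrightarrow> \<bar>j\<bar> \<noteq> \<bar>m\<bar> \<longrightarrow> j \<in> orbit u i"
    | "\<forall>i\<in>zeros n u. u i = - i" "card (zeros n u) \<le> 8"
    using u(2) all unfolding small_zeros_def by blast
  then show ?thesis
  proof cases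
    case 1
    show ?thesis
    \<comment> \<open>Besides the four indices, parity forces every upper bound to have
      \<open>m\<close> on a balanced cycle; together these points meet all balanced cycles of
      \<open>u\<close>.\<close>
    proof (rule *[of "{i, j, k, l, m}"])
      show "\<exists>a\<in>{i, j, k, l, m}. s \<in> orbit u a" if s: "s \<in> zeros n u" for s
      proof (cases "\<bar>s\<bar> = \<bar>m\<bar>")
        case True
        then have "s = m \<or> s = - m" by (auto simp: abs_eq_iff)
        then show ?thesis using orbit_self[OF uB, of m] zeros_orbit_neg[OF uB 1(1)] by auto
      next
        case False
        then show ?thesis using 1(2) s all abs(1) by (metis insertCI insert_subset)
      qed
      show "{i, j, k, l, m} \<subseteq> zeros n z" if z: "pair_bound n u i j k l z" for z
      proof -
        have z': "z \<in> even_perms n" "below n z u" using z by (auto simp: pair_bound_def)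
        have "i \<in> zeros n z" using zero[OF z] by simp
        then have "m \<in> zeros n z" using zeros_contain_special[OF z' _ 1(2)] by blast
        then show ?thesis using zero[OF z] by simp
      qed
    qed (use all 1 in auto)
  next
    case 2
    \<comment> \<open>The crossing pair involves exactly three absolute values here, and
      \<open>t\<close> is the index of the second reflection that is not shared.\<close>
    obtain t where t: "t \<in> {k, l}" "\<bar>t\<bar> \<noteq> \<bar>i\<bar>" "\<bar>t\<bar> \<noteq> \<bar>j\<bar>"
      using crossing_negated_triple[OF uB 2(1) all abs c] by auto
    show ?thesis
    proof (rule *[of "zeros n u"])
      show "\<exists>a\<in>zeros n u. s \<in> orbit u a" if "s \<in> zeros n u" for s
        using that orbit_self[OF uB] by blast
      show "zeros n u \<subseteq> zeros n z" if z: "pair_bound n u i j k l z" for z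
      proof (rule ccontr)
        assume "\<not> zeros n u \<subseteq> zeros n z"
        then obtain d where d: "d \<in> zeros n u" "d \<notin> zeros n z" by blast
        have z': "z \<in> even_perms n" "below n z u" using z by (auto simp: pair_bound_def)
        note B = below_signed1[OF z'(2)]
        have tz: "i \<in> zeros n z" "j \<in> zeros n z" "t \<in> zeros n z" using zero[OF z] t by auto
        have nd: "\<bar>d\<bar> \<noteq> \<bar>a\<bar>" if "a \<in> zeros n z" for a
          using that d zeros_neg by (auto simp: abs_eq_iff)
        \<comment> \<open>With \<open>d\<close> missing from \<open>zeros n z\<close>, a fourth
          absolute value in \<open>zeros n z\<close> would make five of them, hence ten signed
          points, in \<open>zeros n u\<close>, against the bound 8. So \<open>z\<close> would have
          just three balanced cycles, an odd number.\<close>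
        have only: "\<bar>a\<bar> \<in> {\<bar>i\<bar>, \<bar>j\<bar>, \<bar>t\<bar>}" if a: "a \<in> zeros n z" for a
        proof (rule ccontr)
          assume na: "\<bar>a\<bar> \<notin> {\<bar>i\<bar>, \<bar>j\<bar>, \<bar>t\<bar>}"
          define A where "A = {\<bar>i\<bar>, \<bar>j\<bar>, \<bar>t\<bar>, \<bar>d\<bar>, \<bar>a\<bar>}"
          have A: "A \<subseteq> zeros n u" using tz a d zeros_mono[OF z'(2)] by (auto simp: A_def abs_if)
          have sub: "A \<union> uminus ` A \<subseteq> zeros n u" using A by auto
          have cA: "card A = 5"
            using nd[OF tz(1)] nd[OF tz(2)] nd[OF tz(3)] nd[OF a] na t abs(1) by (auto simp: A_def)
          have pos: "s > 0" if "s \<in> A" for s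
          proof -
            have "s \<noteq> 0" using that A zero_notin_zeros[of n u] by blast
            moreover have "s \<ge> 0" using that by (auto simp: A_def)
            ultimately show ?thesis by simp
          qed
          have disj: "A \<inter> uminus ` A = {}"
          proof -
            have False if "s \<in> A" "- s \<in> A" for s using pos[OF that(1)] pos[OF that(2)] by simp
            then show ?thesis by auto
          qed
          have "finite A" by (simp add: A_def)
          then have "card (A \<union> uminus ` A) = card A + card (uminus ` A)"
            using disj by (intro card_Un_disjoint) auto
          also have "card (uminus ` A) = card A" by (intro card_image) (simp add: inj_on_def)
          finally have "card (A \<union> uminus ` A) = 10" using cA by simp
          then show False using card_mono[OF finite_zeros sub] 2(2) by simp
        qed
        have neg: "orbit z a = {a, - a}" if a: "a \<in> zeros n z" for a
          using orbit_negated[OF B zeros_neg_value[OF z'(2) a]] 2(1) zeros_mono[OF z'(2)] a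
            orbit_self[OF B, of a] zeros_orbit_neg[OF B a] by blast
        have "even (card {i, j, t})"
        proof (rule even_card_reps[OF z'(1)])
          show "{i, j, t} \<subseteq> zeros n z" using tz by simp
          show "a = b" if "a \<in> {i, j, t}" "b \<in> {i, j, t}" "b \<in> orbit z a" for a b
          proof -
            have "\<bar>b\<bar> = \<bar>a\<bar>" using that(1,3) neg[of a] tz by auto
            then show ?thesis using that(1,2) abs(1) t by auto
          qed
          show "\<exists>a\<in>{i, j, t}. s \<in> orbit z a" if "s \<in> zeros n z" for s
            using only[OF that] neg[OF tz(1)] neg[OF tz(2)] neg[OF tz(3)] by (auto simp: abs_eq_iff)
        qed
        moreover have "i \<noteq> j" "t \<noteq> i" "t \<noteq> j" using t(2,3) abs(1) by auto
        then have "card {i, j, t} = 3" by simp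
        ultimately show False by simp
      qed
    qed (use all in auto)
  qed
qed

lemma join_reflections:
  assumes u: "u \<in> even_perms n" "small_zeros n u"
    and S: "i \<in> signed_points n" "j \<in> signed_points n" "k \<in> signed_points n" "l \<in> signed_points n"
    and abs: "\<bar>i\<bar> \<noteq> \<bar>j\<bar>" "\<bar>k\<bar> \<noteq> \<bar>l\<bar>" and l: "linked u i j" "linked u k l"
  shows "\<exists>x. pair_bound n u i j k l x \<and> (\<forall>z. pair_bound n u i j k l z \<longrightarrow> below n x z)"
proof -
  have ne: "i \<noteq> j" "k \<noteq> l" using abs by auto
  have uB: "u \<in> signed_perms n" using u even_perms_signed by blast
  have comm: "pair_bound n u i j k l z \<longleftrightarrow> pair_bound n u k l i j z" for z by (auto simp: pair_bound_def)
  consider "reflect i j = reflect k l" | "linked (reflect i j \<circ> u) k l" | "linked (reflect k l \<circ> u) i j"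
    | "reflect i j \<noteq> reflect k l" "crossing u i j k l" using l by (auto simp: crossing_def)
  then show ?thesis
  proof cases
    case 1
    have "linked (reflect i j) i j" "linked (reflect k l) k l"
      using S signed_points_nonzero by (auto intro!: linked_reflect_refl)
    moreover have "below n (reflect i j) u" using below_reflect_iff[OF S(1,2) ne(1) uB] l by blast
    moreover have "below n (reflect i j) z" if "pair_bound n u i j k l z" for z
      using that below_reflect_iff[OF S(1,2) ne(1) even_perms_signed] by (simp add: pair_bound_def)
    ultimately show ?thesis
      using even_perms_reflect[OF S(1,2) abs(1)] 1 unfolding pair_bound_def by metis
  next
    case 2
    then show ?thesis using join_noncrossing[OF u(1) S abs l(1)] by blast
  next
    case 3
    then show ?thesis using join_noncrossing[OF u(1) S(3,4,1,2) abs(2,1) l(2)] comm by blast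
  next
    case 4
    show ?thesis
    proof (cases "\<exists>z. pair_bound n u i j k l z \<and> \<not> {i, j, k, l} \<subseteq> zeros n z")
      case False
      then show ?thesis using join_all_zero[OF u S abs 4(2,1)] by blast
    next
      case True
      then obtain z where z: "pair_bound n u i j k l z" "\<not> {i, j, k, l} \<subseteq> zeros n z" by blast
      have z': "below n z u" "linked z i j" "linked z k l" using z by (auto simp: pair_bound_def)
      have cz: "crossing z i j k l" using crossing_mono[OF z'(1) S ne z'(2,3) 4(2)] .
      have q: "i \<notin> zeros n z" "k \<in> orbit z i \<or> - k \<in> orbit z i"
        using crossing_cases[OF below_signed1[OF z'(1)] S cz] z(2) by blast+
      have neg: "pair_bound n u i j (- k) (- l) y \<longleftrightarrow> pair_bound n u i j k l y" for y
        by (simp add: pair_bound_def linked_neg_iff)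
      show ?thesis
      proof (cases "k \<in> orbit z i")
        case True
        then show ?thesis using join_paired[OF u S abs 4(2,1) z(1) q(1)] by blast
      next
        case False
        \<comment> \<open>The pairs \<open>(k, l)\<close> and \<open>(- k, - l)\<close> denote the
          same reflection, so the sign can be chosen such that \<open>k\<close> lies on the cycle of
          \<open>i\<close>.\<close>
        have S': "- k \<in> signed_points n" "- l \<in> signed_points n" "\<bar>- k\<bar> \<noteq> \<bar>- l\<bar>" using S abs by auto
        show ?thesis
          using join_paired[OF u S(1,2) S'(1,2) abs(1) S'(3), of z] 4 z(1) q False
          unfolding neg crossing_uminus reflect_uminus by blast
      qed
    qed
  qed
qed

text \<open>In a poset of finite height it suffices to join pairs of atoms above each element
  (Bjorner, Edelman and Ziegler); left multiplication by a reflection identifies an upper interval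
  with a full interval of smaller rank.\<close>

lemma joins_exist:
  assumes "u \<in> even_perms n" "small_zeros n u" "x \<in> even_perms n" "y \<in> even_perms n" "below n x u" "below n y u"
  shows "\<exists>v\<in>even_perms n. below n v u \<and> below n x v \<and> below n y v \<and>
    (\<forall>w\<in>even_perms n. below n w u \<longrightarrow> below n x w \<longrightarrow> below n y w \<longrightarrow> below n v w)"
  using assms
proof (induction "len n u" arbitrary: u x y rule: less_induct)
  case less
  note u = less.prems(1,2) and x = less.prems(3,5) and y = less.prems(4,6)
  have uB: "u \<in> signed_perms n" using u even_perms_signed by blast
  have xB: "x \<in> signed_perms n" and yB: "y \<in> signed_perms n" using x y even_perms_signed by auto
  have above: "\<exists>v\<in>even_perms n. below n v u \<and> below n a v \<and> below n b v \<and>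
      (\<forall>w\<in>even_perms n. below n w u \<longrightarrow> below n a w \<longrightarrow> below n b w \<longrightarrow> below n v w)"
    if S: "i \<in> signed_points n" "j \<in> signed_points n" "\<bar>i\<bar> \<noteq> \<bar>j\<bar>" and a: "a \<in> even_perms n" "below n a u" "linked a i j"
      and b: "b \<in> even_perms n" "below n b u" "linked b i j" for a b i j
  proof -
    let ?t = "\<lambda>z. reflect i j \<circ> z"
    have ne: "i \<noteq> j" using S by auto
    have ul: "linked u i j" using below_linked[OF a(2) S(1,2) a(3)] .
    have tE: "?t z \<in> even_perms n" if "z \<in> even_perms n" for z
      using even_perms_comp[OF even_perms_reflect[OF S] that] .
    have iff: "below n (?t c) (?t d) \<longleftrightarrow> below n c d" if "c \<in> even_perms n" "d \<in> even_perms n" "linked c i j" "linked d i j" for c d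
      using below_reflect_both[OF S(1,2) ne that(3,4)] that(1,2) even_perms_signed by blast
    have lt: "len n (?t u) < len n u" using len_reflect(1)[OF uB S(1,2) ne ul] by simp
    have sz: "small_zeros n (?t u)"
      using small_zeros_mono[OF u(2) tE[OF u(1)] below_reflect_comp[OF uB S(1,2) ne ul]] .
    obtain v where v: "v \<in> even_perms n" "below n v (?t u)" "below n (?t a) v" "below n (?t b) v"
      and vmin: "\<And>w. w \<in> even_perms n \<Longrightarrow> below n w (?t u) \<Longrightarrow> below n (?t a) w \<Longrightarrow> below n (?t b) w \<Longrightarrow> below n v w"
      using less.hyps[OF lt tE[OF u(1)] sz tE[OF a(1)] tE[OF b(1)]] iff a b u ul by blast
    note tv = below_prepend[OF S(1,2) ne ul uB v(2)]
    have "below n a (?t v)" "below n b (?t v)"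
      using iff[OF a(1) tE[OF v(1)] a(3) tv(1)] iff[OF b(1) tE[OF v(1)] b(3) tv(1)] v by simp_all
    moreover have "below n (?t v) w" if w: "w \<in> even_perms n" "below n w u" "below n a w" "below n b w" for w
    proof -
      have wl: "linked w i j" using below_linked[OF w(3) S(1,2) a(3)] .
      have "below n v (?t w)"
        using vmin[OF tE[OF w(1)]] iff[OF w(1) u(1) wl ul] iff[OF a(1) w(1) a(3) wl] iff[OF b(1) w(1) b(3) wl] w by blast
      then show ?thesis using iff[OF tE[OF v(1)] w(1) tv(1) wl] by simp
    qed
    ultimately show ?thesis using tE[OF v(1)] tv(2) by blast
  qed
  show ?case
  proof (cases "x = id \<or> y = id")
    case True
    then show ?thesis using x y below_id below_refl xB yB by metis
  next
    case False
    obtain i j where ij: "i \<in> signed_points n" "j \<in> signed_points n" "linked x i j" "\<bar>i\<bar> \<noteq> \<bar>j\<bar>"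
      using exists_linked_reflection[OF xB] False x by blast
    obtain k l where kl: "k \<in> signed_points n" "l \<in> signed_points n" "linked y k l" "\<bar>k\<bar> \<noteq> \<bar>l\<bar>"
      using exists_linked_reflection[OF yB] False y by blast
    have lu: "linked u i j" "linked u k l"
      using below_linked[OF x(2) ij(1,2,3)] below_linked[OF y(2) kl(1,2,3)] by auto
    \<comment> \<open>Let \<open>r\<close> join an atom below \<open>x\<close> with an atom below
      \<open>y\<close>. Then \<open>x\<close> and \<open>r\<close>, next \<open>y\<close> and
      \<open>r\<close>, and finally the two joins so obtained lie above a common reflection, so
      \<open>above\<close> applies three times.\<close>
    obtain r where r: "r \<in> even_perms n" "below n r u" "linked r i j" "linked r k l"
      and rmin: "\<And>z. pair_bound n u i j k l z \<Longrightarrow> below n r z"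
      using join_reflections[OF u ij(1,2) kl(1,2) ij(4) kl(4) lu] unfolding pair_bound_def by blast
    obtain p where p: "p \<in> even_perms n" "below n p u" "below n x p" "below n r p"
      and pmin: "\<And>w. w \<in> even_perms n \<Longrightarrow> below n w u \<Longrightarrow> below n x w \<Longrightarrow> below n r w \<Longrightarrow> below n p w"
      using above[OF ij(1,2,4) x ij(3) r(1,2,3)] by blast
    obtain q where q: "q \<in> even_perms n" "below n q u" "below n y q" "below n r q"
      and qmin: "\<And>w. w \<in> even_perms n \<Longrightarrow> below n w u \<Longrightarrow> below n y w \<Longrightarrow> below n r w \<Longrightarrow> below n q w"
      using above[OF kl(1,2,4) y kl(3) r(1,2,4)] by blast
    have "linked p i j" "linked q i j"
      using below_linked[OF p(4) ij(1,2) r(3)] below_linked[OF q(4) ij(1,2) r(3)] by auto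
    then obtain v where v: "v \<in> even_perms n" "below n v u" "below n p v" "below n q v"
      and vmin: "\<And>w. w \<in> even_perms n \<Longrightarrow> below n w u \<Longrightarrow> below n p w \<Longrightarrow> below n q w \<Longrightarrow> below n v w"
      using above[OF ij(1,2,4) p(1,2) _ q(1,2)] by blast
    have "below n v w" if w: "w \<in> even_perms n" "below n w u" "below n x w" "below n y w" for w
    proof -
      have "linked w i j" "linked w k l" using below_linked[OF w(3) ij(1,2,3)] below_linked[OF w(4) kl(1,2,3)] by auto
      then have "below n r w" using rmin w unfolding pair_bound_def by blast
      then show ?thesis using vmin pmin qmin w by blast
    qed
    moreover have "below n x v" "below n y v" using below_trans p q v by blast+
    ultimately show ?thesis using v by blast
  qed
qed

section \<open>The lattice property\<close>

lemma abs_le_iff_below: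
  assumes z: "z \<in> even_perms n" and u: "u \<in> even_perms n"
  shows "abs_le n z u \<longleftrightarrow> below n z u"
proof -
  have B: "z \<in> signed_perms n" "u \<in> signed_perms n" using z u even_perms_signed by auto
  have iu: "inv_into UNIV z \<circ> u \<in> even_perms n" using even_perms_inv[OF z] u by (rule even_perms_comp)
  have u': "u = z \<circ> (inv_into UNIV z \<circ> u)" using signed_perms_inv_comp(2)[OF B(1)] by (simp add: comp_assoc[symmetric])
  have y': "inv_into UNIV z \<circ> u = y" if "u = z \<circ> y" for y
    unfolding that using signed_perms_inv_comp(1)[OF B(1)] by (simp add: comp_assoc[symmetric])
  show ?thesis
    unfolding abs_le_def word_length_D[OF z] word_length_D[OF u] word_length_D[OF iu] below_def
    using u' y' B even_perms_signed[OF iu] by metis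
qed

lemma abs_interval_carrier:
  assumes "u \<in> even_perms n"
  shows "carrier (abs_interval n u) = {z \<in> even_perms n. below n z u}"
proof -
  have "id \<in> even_perms n" by (simp add: even_perms_def del: id_apply)
  then show ?thesis
    using assms abs_le_iff_below below_id even_perms_signed
    by (auto simp: abs_interval_def coxeter_D_eq)
qed

lemma abs_interval_partial_order:
  assumes u: "u \<in> even_perms n" shows "partial_order (abs_interval n u)"
proof
  fix x y z
  note c = abs_interval_carrier[OF u]
  have le: "x \<sqsubseteq>\<^bsub>abs_interval n u\<^esub> y \<longleftrightarrow> below n x y" if "x \<in> carrier (abs_interval n u)" "y \<in> carrier (abs_interval n u)" for x y
    using that abs_le_iff_below unfolding c by (simp add: abs_interval_def)
  show "x \<sqsubseteq>\<^bsub>abs_interval n u\<^esub> x" if "x \<in> carrier (abs_interval n u)"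
    using le[OF that that] that below_refl even_perms_signed unfolding c by blast
  show "x .=\<^bsub>abs_interval n u\<^esub> y"
    if "x \<sqsubseteq>\<^bsub>abs_interval n u\<^esub> y" "y \<sqsubseteq>\<^bsub>abs_interval n u\<^esub> x" "x \<in> carrier (abs_interval n u)" "y \<in> carrier (abs_interval n u)"
  proof -
    have "below n x y" "below n y x" using that(1,2) le[OF that(3,4)] le[OF that(4,3)] by blast+
    then have "x = y" by (rule below_antisym)
    then show ?thesis by (simp add: abs_interval_def)
  qed
  show "x \<sqsubseteq>\<^bsub>abs_interval n u\<^esub> z"
    if "x \<sqsubseteq>\<^bsub>abs_interval n u\<^esub> y" "y \<sqsubseteq>\<^bsub>abs_interval n u\<^esub> z" "x \<in> carrier (abs_interval n u)"
      "y \<in> carrier (abs_interval n u)" "z \<in> carrier (abs_interval n u)"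
    using that(1,2) le[OF that(3,4)] le[OF that(4,5)] le[OF that(3,5)] below_trans[of n x y z] by blast
qed (auto simp: abs_interval_def)

definition joins_in :: "nat \<Rightarrow> (int \<Rightarrow> int) \<Rightarrow> bool" where
  "joins_in n u \<longleftrightarrow> (\<forall>x\<in>even_perms n. \<forall>y\<in>even_perms n. below n x u \<longrightarrow> below n y u \<longrightarrow>
    (\<exists>v\<in>even_perms n. below n v u \<and> below n x v \<and> below n y v \<and>
      (\<forall>w\<in>even_perms n. below n w u \<longrightarrow> below n x w \<longrightarrow> below n y w \<longrightarrow> below n v w)))"

lemma finite_even_perms: "finite (even_perms n)"
proof (rule finite_subset)
  show "even_perms n \<subseteq> {p. p permutes signed_points n}"
    using even_perms_signed signed_perms_permutes by blast
qed (simp add: finite_permutations)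

text \<open>A common lower bound of greatest length is the meet: its join with another lower bound
  is again a lower bound and cannot be longer.\<close>

lemma meets_in:
  assumes J: "joins_in n u" and x: "x \<in> even_perms n" "below n x u" and y: "y \<in> even_perms n" "below n y u"
  shows "\<exists>v\<in>even_perms n. below n v u \<and> below n v x \<and> below n v y \<and>
      (\<forall>w\<in>even_perms n. below n w u \<longrightarrow> below n w x \<longrightarrow> below n w y \<longrightarrow> below n w v)"
proof -
  define L where "L = {z \<in> even_perms n. below n z u \<and> below n z x \<and> below n z y}"
  have "id \<in> L"
    using x y below_id below_signed1 below_signed2 by (auto simp: L_def even_perms_def simp del: id_apply)
  moreover have fin: "finite L" using finite_even_perms by (simp add: L_def)
  ultimately have "Max (len n ` L) \<in> len n ` L" by (intro Max_in) auto
  then obtain v where v: "v \<in> L" and "len n v = Max (len n ` L)" by auto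
  then have max: "len n z \<le> len n v" if "z \<in> L" for z
    using fin that by simp
  have "below n w v" if w: "w \<in> L" for w
  proof -
    obtain j where j: "j \<in> even_perms n" "below n j u" "below n v j" "below n w j"
      and jmin: "\<And>z. z \<in> even_perms n \<Longrightarrow> below n z u \<Longrightarrow> below n v z \<Longrightarrow> below n w z \<Longrightarrow> below n j z"
      using J v w unfolding joins_in_def L_def by blast
    have "j \<in> L" using j jmin[OF x] jmin[OF y] v w by (simp add: L_def)
    then have "v = j" using below_len_eq[OF j(3)] max by blast
    then show ?thesis using j by simp
  qed
  then show ?thesis using v unfolding L_def by blast
qed

lemma lattice_iff_joins:
  assumes u: "u \<in> even_perms n"
  shows "lattice (abs_interval n u) \<longleftrightarrow> joins_in n u"
proof -
  note c = abs_interval_carrier[OF u]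
  have mem: "x \<in> carrier (abs_interval n u) \<longleftrightarrow> x \<in> even_perms n \<and> below n x u" for x
    unfolding c by simp
  have le: "x \<sqsubseteq>\<^bsub>abs_interval n u\<^esub> y \<longleftrightarrow> below n x y" if "x \<in> even_perms n" "y \<in> even_perms n" for x y
    using that abs_le_iff_below by (simp add: abs_interval_def)
  have Up: "s \<in> Upper (abs_interval n u) {x, y} \<longleftrightarrow> s \<in> even_perms n \<and> below n s u \<and> below n x s \<and> below n y s"
    if "x \<in> carrier (abs_interval n u)" "y \<in> carrier (abs_interval n u)" for s x y
  proof -
    have xy: "x \<in> even_perms n" "y \<in> even_perms n" using that by (simp_all add: mem)
    have "s \<in> Upper (abs_interval n u) {x, y} \<longleftrightarrow>
        x \<sqsubseteq>\<^bsub>abs_interval n u\<^esub> s \<and> y \<sqsubseteq>\<^bsub>abs_interval n u\<^esub> s \<and> s \<in> carrier (abs_interval n u)"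
      using that unfolding Upper_def by blast
    then show ?thesis using le[OF xy(1), of s] le[OF xy(2), of s] mem[of s] by blast
  qed
  have Lo: "s \<in> Lower (abs_interval n u) {x, y} \<longleftrightarrow> s \<in> even_perms n \<and> below n s u \<and> below n s x \<and> below n s y"
    if "x \<in> carrier (abs_interval n u)" "y \<in> carrier (abs_interval n u)" for s x y
  proof -
    have xy: "x \<in> even_perms n" "y \<in> even_perms n" using that by (simp_all add: mem)
    have "s \<in> Lower (abs_interval n u) {x, y} \<longleftrightarrow>
        s \<sqsubseteq>\<^bsub>abs_interval n u\<^esub> x \<and> s \<sqsubseteq>\<^bsub>abs_interval n u\<^esub> y \<and> s \<in> carrier (abs_interval n u)"
      using that unfolding Lower_def by blast
    then show ?thesis using le[OF _ xy(1), of s] le[OF _ xy(2), of s] mem[of s] by blast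
  qed
  have least: "least (abs_interval n u) s (Upper (abs_interval n u) {x, y}) \<longleftrightarrow>
      s \<in> even_perms n \<and> below n s u \<and> below n x s \<and> below n y s \<and>
      (\<forall>w\<in>even_perms n. below n w u \<longrightarrow> below n x w \<longrightarrow> below n y w \<longrightarrow> below n s w)"
    if "x \<in> carrier (abs_interval n u)" "y \<in> carrier (abs_interval n u)" for s x y
  proof -
    have "Upper (abs_interval n u) {x, y} = {s \<in> even_perms n. below n s u \<and> below n x s \<and> below n y s}"
      by (rule Set.set_eqI) (simp only: Up[OF that] mem_Collect_eq)
    then show ?thesis unfolding least_def c by (auto simp: le)
  qed
  have greatest: "greatest (abs_interval n u) s (Lower (abs_interval n u) {x, y}) \<longleftrightarrow>
      s \<in> even_perms n \<and> below n s u \<and> below n s x \<and> below n s y \<and>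
      (\<forall>w\<in>even_perms n. below n w u \<longrightarrow> below n w x \<longrightarrow> below n w y \<longrightarrow> below n w s)"
    if "x \<in> carrier (abs_interval n u)" "y \<in> carrier (abs_interval n u)" for s x y
  proof -
    have "Lower (abs_interval n u) {x, y} = {s \<in> even_perms n. below n s u \<and> below n s x \<and> below n s y}"
      by (rule Set.set_eqI) (simp only: Lo[OF that] mem_Collect_eq)
    then show ?thesis unfolding greatest_def c by (auto simp: le)
  qed
  show ?thesis
  proof
    assume "lattice (abs_interval n u)"
    then interpret L: lattice "abs_interval n u" .
    show "joins_in n u"
      unfolding joins_in_def
    proof (intro ballI impI)
      fix x y assume "x \<in> even_perms n" "y \<in> even_perms n" "below n x u" "below n y u"
      then have xy: "x \<in> carrier (abs_interval n u)" "y \<in> carrier (abs_interval n u)" by (auto simp: mem)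
      obtain s where "least (abs_interval n u) s (Upper (abs_interval n u) {x, y})"
        using L.sup_of_two_exists[OF xy] by blast
      then show "\<exists>v\<in>even_perms n. below n v u \<and> below n x v \<and> below n y v \<and>
          (\<forall>w\<in>even_perms n. below n w u \<longrightarrow> below n x w \<longrightarrow> below n y w \<longrightarrow> below n v w)"
        unfolding least[OF xy] by blast
    qed
  next
    assume J: "joins_in n u"
    interpret partial_order "abs_interval n u" by (rule abs_interval_partial_order[OF u])
    show "lattice (abs_interval n u)"
    proof
      fix x y assume xy: "x \<in> carrier (abs_interval n u)" "y \<in> carrier (abs_interval n u)"
      then have xy': "x \<in> even_perms n" "below n x u" "y \<in> even_perms n" "below n y u" by (auto simp: mem)
      show "\<exists>s. least (abs_interval n u) s (Upper (abs_interval n u) {x, y})"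
        unfolding least[OF xy] using J xy' unfolding joins_in_def by blast
      show "\<exists>s. greatest (abs_interval n u) s (Lower (abs_interval n u) {x, y})"
        unfolding greatest[OF xy] using meets_in[OF J xy'] by blast
    qed
  qed
qed

section \<open>Missing joins for the other partitions\<close>

lemma neg_list_below:
  assumes "u \<in> signed_perms n" "set as \<subseteq> zeros n u" "sorted_wrt (\<lambda>a b. b \<notin> orbit u a) as"
  shows "below n (prod_comp (map (\<lambda>a. reflect a (- a)) as)) u"
  using assms
proof (induction as arbitrary: u)
  case Nil
  then show ?case using below_id[of u n] by (simp add: id_def)
next
  case (Cons a as)
  let ?y = "reflect a (- a) \<circ> u"
  have a: "a \<in> zeros n u" using Cons.prems by simp
  have S: "a \<in> signed_points n" "- a \<in> signed_points n" "a \<noteq> - a" using a zeros_signed signed_points_neq_uminus by auto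
  have l: "linked u a (- a)" using a by (rule zeros_linked)
  have y: "?y \<in> signed_perms n" using S Cons.prems by (intro signed_perms_comp reflect_in)
  have yu: "below n ?y u" using below_reflect_comp[OF Cons.prems(1) S l] .
  \<comment> \<open>Splitting off \<open>[a]\<close> removes only the balanced cycle through
    \<open>a\<close>, so the points on the others stay available.\<close>
  have z: "set as \<subseteq> zeros n ?y"
  proof
    fix b assume b: "b \<in> set as"
    then have "b \<in> zeros n u" "b \<notin> orbit u a" using Cons.prems by auto
    then show "b \<in> zeros n ?y" using linked_reflect_neg[OF Cons.prems(1) a] by (simp add: zeros_def)
  qed
  have "sorted_wrt (\<lambda>a b. b \<notin> orbit ?y a) as"
    using Cons.prems(3) orbit_below[OF yu] z by (auto intro: sorted_wrt_mono_rel[of as "\<lambda>a b. b \<notin> orbit u a"])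
  then have "below n (prod_comp (map (\<lambda>a. reflect a (- a)) as)) ?y" using Cons.IH[OF y z] by blast
  then have "below n (reflect a (- a) \<circ> prod_comp (map (\<lambda>a. reflect a (- a)) as)) u"
    by (rule below_prepend(2)[OF S l Cons.prems(1)])
  then show ?case by (simp add: comp_def)
qed

lemma orbit_abs_neq:
  assumes u: "u \<in> signed_perms n" and ab: "a \<in> zeros n u" "b \<notin> orbit u a"
  shows "\<bar>a\<bar> \<noteq> \<bar>b\<bar>"
  using orbit_self[OF u, of a] zeros_orbit_neg[OF u ab(1)] ab(2) by (auto simp: abs_eq_iff)

lemma reflect_neg_apply: "reflect a (- a) s = (if \<bar>s\<bar> = \<bar>a\<bar> then - s else s)"
  by (cases "a = 0") (auto simp: reflect_def abs_eq_iff)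

lemma double_neg_apply:
  "\<bar>a\<bar> \<noteq> \<bar>b\<bar> \<Longrightarrow> double_neg a b s = (if \<bar>s\<bar> \<in> {\<bar>a\<bar>, \<bar>b\<bar>} then - s else s)"
  by (simp add: double_neg_def reflect_neg_apply)

lemma double_neg_even:
  assumes "a \<in> signed_points n" "b \<in> signed_points n"
  shows "double_neg a b \<in> even_perms n"
proof -
  have "reflect a (- a) \<in> signed_perms n" "reflect b (- b) \<in> signed_perms n" using assms by (auto intro: reflect_in)
  then show ?thesis
    using double_neg_in[OF assms] assms unfolding even_perms_def double_neg_def
    by (simp add: sign_prod_comp sign_prod_reflect_neg)
qed

text \<open>The reflections with indices \<open>a, u a\<close> and \<open>a, - u a\<close> force
  \<open>a\<close> onto a balanced cycle of any upper bound, and parity demands a second one, on the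
  orbit of \<open>b\<close>. Both \<open>b\<close> and \<open>u b\<close> can serve there, so a join
  would have no point of that orbit on a balanced cycle.\<close>

lemma not_joins_two_orbits:
  assumes u: "u \<in> even_perms n" and z: "a \<in> zeros n u" "b \<in> zeros n u" "b \<notin> orbit u a"
    and cover: "\<And>s. s \<in> zeros n u \<Longrightarrow> s \<in> orbit u a \<or> s \<in> orbit u b"
    and ne: "u a \<noteq> - a" "u b \<noteq> - b"
  shows "\<not> joins_in n u"
proof
  assume J: "joins_in n u"
  have uB: "u \<in> signed_perms n" using u even_perms_signed by blast
  define a' b' where "a' = u a" and "b' = u b"
  have o: "a' \<in> orbit u a" "b' \<in> orbit u b" unfolding a'_def b'_def by (auto intro: orbit.base)
  have z': "a' \<in> zeros n u" "b' \<in> zeros n u" using o z zeros_orbit[OF uB] by auto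
  have nfix: "u c \<noteq> c" if "c \<in> zeros n u" for c
    using zeros_orbit_neg[OF uB that] orbit_fixed[of u c] signed_points_neq_uminus[OF zeros_signed[OF that]] by auto
  have abs: "\<bar>a\<bar> \<noteq> \<bar>a'\<bar>" "\<bar>b\<bar> \<noteq> \<bar>b'\<bar>"
    using nfix[OF z(1)] nfix[OF z(2)] ne unfolding a'_def b'_def by (auto simp: abs_eq_iff)
  have dis: "\<bar>s\<bar> \<noteq> \<bar>t\<bar>" if "s \<in> orbit u a" "t \<in> orbit u b" for s t
  proof -
    have "s \<in> zeros n u" using zeros_orbit[OF uB z(1)] that by blast
    moreover have "t \<notin> orbit u s"
      using orbit_trans[of b u t s] orbit_trans[of b u s a] orbit_symm[OF uB, of t b] that z(3) by blast
    ultimately show ?thesis using orbit_abs_neq[OF uB] by blast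
  qed
  have S: "a \<in> signed_points n" "a' \<in> signed_points n" "- a' \<in> signed_points n" using z z' zeros_signed by auto
  have ne': "a \<noteq> a'" "a \<noteq> - a'" using abs by auto
  let ?t = "reflect a a'" and ?s = "reflect a (- a')"
  have bound: "below n ?t y \<and> below n ?s y" if "y \<in> signed_perms n" "a \<in> zeros n y" "a' \<in> zeros n y" for y
    using below_reflect_iff[OF S(1,2) ne'(1) that(1)] below_reflect_iff[OF S(1,3) ne'(2) that(1)]
      zeros_both[of a n y a'] zeros_both[of a n y "- a'"] that by simp
  have tE: "?t \<in> even_perms n" "?s \<in> even_perms n" using S abs by (auto intro!: even_perms_reflect)
  obtain w where w: "w \<in> even_perms n" "below n w u" "below n ?t w" "below n ?s w"
    and wmin: "\<And>y. y \<in> even_perms n \<Longrightarrow> below n y u \<Longrightarrow> below n ?t y \<Longrightarrow> below n ?s y \<Longrightarrow> below n w y"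
    using J tE bound[OF uB z(1) z'(1)] unfolding joins_in_def by blast
  have wB: "w \<in> signed_perms n" using w even_perms_signed by blast
  have "linked w a a'" "linked w a (- a')"
    using below_reflect_iff[OF S(1,2) ne'(1) wB] below_reflect_iff[OF S(1,3) ne'(2) wB] w by auto
  then have aw: "a \<in> zeros n w" using linked_trans linked_sym linked_neg S unfolding zeros_def by blast
  \<comment> \<open>For each choice of \<open>c\<close> on the orbit of \<open>b\<close> there is an
    upper bound supported on \<open>a\<close>, \<open>a'\<close>, \<open>c\<close> up to sign; the
    join lies below all of these.\<close>
  have sub: "\<bar>s\<bar> \<in> {\<bar>a\<bar>, \<bar>a'\<bar>, \<bar>c\<bar>}" if s: "s \<in> zeros n w" and c: "c \<in> orbit u b" for s c
  proof -
    have cz: "c \<in> zeros n u" using zeros_orbit[OF uB z(2) c] .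
    obtain y where y: "y \<in> even_perms n" "below n y u" "{a, a', c} \<subseteq> zeros n y"
      "\<forall>s. s \<notin> {a, a', c} \<longrightarrow> - s \<notin> {a, a', c} \<longrightarrow> y s = s"
    proof -
      have "\<exists>p\<in>{a, a', c}. s \<in> orbit u p" if "s \<in> zeros n u" for s
        using cover[OF that] orbit_trans[of s u b c] orbit_symm[OF uB, of c b] c by blast
      then show ?thesis using that restrict_to[OF u, of "{a, a', c}"] z z' cz by blast
    qed
    have yB: "y \<in> signed_perms n" using y even_perms_signed by blast
    have "below n w y" using wmin[OF y(1,2)] bound[OF yB] y(3) by blast
    then have "s \<in> zeros n y" using zeros_mono s by blast
    note sz = zeros_signed[OF this] zeros_linked[OF this]
    have "- s \<in> signed_points n" using sz by simp
    then have "s \<in> {a, a', c} \<or> - s \<in> {a, a', c}"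
      using zeros_fixed_off[OF yB y(4) sz(1) _ sz(2)] signed_points_neq_uminus[OF sz(1)] by blast
    then show ?thesis by auto
  qed
  obtain j where j: "j \<in> zeros n w" "j \<notin> orbit w a" using zeros_two_orbits[OF w(1) aw] by blast
  have "\<bar>j\<bar> \<in> {\<bar>a\<bar>, \<bar>a'\<bar>}" using sub[OF j(1) o(2)] sub[OF j(1) orbit_self[OF uB]] abs by auto
  then have "j \<in> orbit u a"
    using orbit_neg_zeros(1)[OF uB z(1), of a] orbit_neg_zeros(1)[OF uB z(1), of a'] orbit_self[OF uB, of a] o(1)
    by (auto simp: abs_eq_iff)
  then show False using j orbit_below[OF w(2) aw j(1)] by blast
qed

text \<open>The reflections on \<open>a, b\<close> and on \<open>b, c\<close> force these three
  points onto balanced cycles of any upper bound, and parity demands a fourth cycle. Both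
  \<open>d\<close> and \<open>e\<close> can supply it, so a join would be left with three. The
  condition on \<open>d\<close> and \<open>e\<close> concerns absolute values, so that a single long
  cycle can provide both.\<close>

lemma not_joins_three_orbits:
  assumes u: "u \<in> even_perms n" and z: "{a, b, c, d, e} \<subseteq> zeros n u"
    and o: "b \<notin> orbit u a" "c \<notin> orbit u a" "c \<notin> orbit u b"
    and d: "d \<notin> orbit u a" "d \<notin> orbit u b" "d \<notin> orbit u c"
    and e: "e \<notin> orbit u a" "e \<notin> orbit u b" "e \<notin> orbit u c"
    and de: "\<bar>d\<bar> \<noteq> \<bar>e\<bar>"
  shows "\<not> joins_in n u"
proof
  assume J: "joins_in n u"
  have uB: "u \<in> signed_perms n" using u even_perms_signed by blast
  have S: "a \<in> signed_points n" "b \<in> signed_points n" "c \<in> signed_points n" using z zeros_signed by auto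
  have az: "a \<in> zeros n u" "b \<in> zeros n u" "c \<in> zeros n u" using z by auto
  have abs: "\<bar>a\<bar> \<noteq> \<bar>b\<bar>" "\<bar>b\<bar> \<noteq> \<bar>c\<bar>" "\<bar>a\<bar> \<noteq> \<bar>c\<bar>" using orbit_abs_neq[OF uB] az o by auto
  have ne: "a \<noteq> b" "b \<noteq> c" using abs by auto
  let ?t = "reflect a b" and ?s = "reflect b c"
  have bound: "below n ?t y \<and> below n ?s y" if "y \<in> signed_perms n" "{a, b, c} \<subseteq> zeros n y" for y
    using below_reflect_iff[OF S(1,2) ne(1) that(1)] below_reflect_iff[OF S(2,3) ne(2) that(1)]
      zeros_both[of a n y b] zeros_both[of b n y c] that by simp
  have tE: "?t \<in> even_perms n" "?s \<in> even_perms n" using S abs by (auto intro!: even_perms_reflect)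
  have tu: "below n ?t u" "below n ?s u" using bound[OF uB] az by auto
  obtain w where w: "w \<in> even_perms n" "below n w u" "below n ?t w" "below n ?s w"
    and wmin: "\<And>y. y \<in> even_perms n \<Longrightarrow> below n y u \<Longrightarrow> below n ?t y \<Longrightarrow> below n ?s y \<Longrightarrow> below n w y"
    using J[unfolded joins_in_def, rule_format, OF tE tu] by blast
  have wB: "w \<in> signed_perms n" using w even_perms_signed by blast
  have lw: "linked w a b" "linked w b c"
    using below_reflect_iff[OF S(1,2) ne(1) wB] below_reflect_iff[OF S(2,3) ne(2) wB] w by auto
  \<comment> \<open>The cycle of \<open>r\<close> is untouched by the first reflection and stays
    balanced, so a link between \<open>q\<close> and \<open>r\<close> would make \<open>q\<close> a
    zero as well. As \<open>p\<close> is linked with \<open>- q\<close>, it would then be linked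
    with \<open>q\<close>, which multiplication by the reflection excludes.\<close>
  have sep: "\<not> linked (reflect p q \<circ> u) q r"
    if "p \<in> zeros n u" "q \<in> zeros n u" "r \<in> zeros n u" "q \<notin> orbit u p" "r \<notin> orbit u p" "r \<notin> orbit u q" for p q r
  proof
    let ?y = "reflect p q \<circ> u"
    assume l: "linked ?y q r"
    have pq: "\<bar>p\<bar> \<noteq> \<bar>q\<bar>" using orbit_abs_neq[OF uB that(1,4)] .
    have "p \<notin> orbit u r" "q \<notin> orbit u r" using that orbit_symm[OF uB] by auto
    then have "orbit u r \<inter> {p, q, - p, - q} = {}" using orbit_neg_zeros(1)[OF uB that(3)] by auto
    then have r: "linked ?y r (- r)" using linked_avoid[OF _ zeros_orbit_neg[OF uB that(3)] refl] by blast
    then have q: "linked ?y q (- q)" using l linked_zero_cong by blast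
    have "linked ?y p (- q)" using linked_reflect_zeros[OF uB that(1,2) pq] that(4) by blast
    then have "linked ?y p q" using q linked_trans linked_sym by blast
    moreover have "linked u p q" using zeros_both that by blast
    ultimately show False
      using linked_reflect_nand[OF uB zeros_signed[OF that(1)] zeros_signed[OF that(2)]] pq by auto
  qed
  have o': "a \<notin> orbit u b" "a \<notin> orbit u c" "b \<notin> orbit u c" using o orbit_symm[OF uB] by auto
  have "\<not> linked (reflect a b \<circ> u) b c" using sep[OF az o] .
  moreover have "\<not> linked (reflect b c \<circ> u) a b"
    using sep[OF az(3,2,1) o'(3,2,1)] reflect_commute[of b c] linked_sym by auto
  ultimately have "crossing u a b b c" using zeros_both az unfolding crossing_def by blast
  then have cw: "crossing w a b b c" using crossing_mono[OF w(2) S(1,2,2,3) ne lw] by blast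
  \<comment> \<open>The only other possibility is a paired cycle through all three points, where a
    triple never crosses.\<close>
  have wz: "{a, b, c} \<subseteq> zeros n w"
  proof (rule ccontr)
    assume "\<not> ?thesis"
    then have q: "a \<notin> zeros n w" "b \<in> orbit w a" "c \<in> orbit w b"
      using crossing_cases[OF wB S(1,2,2,3) cw] by auto
    have "c \<in> orbit w a" using orbit_trans[OF q(3,2)] .
    moreover have "a \<noteq> c" using abs by auto
    ultimately show False
      using not_crossing_triple[OF wB S(1) q(1,2)] ne cw unfolding crossing_def by blast
  qed
  have sub: "\<bar>s\<bar> \<in> {\<bar>a\<bar>, \<bar>b\<bar>, \<bar>c\<bar>, \<bar>x\<bar>}"
    if s: "s \<in> zeros n w" and x: "x \<in> zeros n u" "x \<notin> orbit u a" "x \<notin> orbit u b" "x \<notin> orbit u c" for s x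
  proof -
    \<comment> \<open>The upper bound \<open>[a][b][c][x]\<close> takes one point from each of four
      different balanced cycles of \<open>u\<close>.\<close>
    let ?y = "double_neg a b \<circ> double_neg c x"
    have ax: "\<bar>a\<bar> \<noteq> \<bar>x\<bar>" "\<bar>b\<bar> \<noteq> \<bar>x\<bar>" "\<bar>c\<bar> \<noteq> \<bar>x\<bar>" using orbit_abs_neq[OF uB] az x by auto
    have "below n (prod_comp (map (\<lambda>a. reflect a (- a)) [a, b, c, x])) u"
      using az x o by (intro neg_list_below[OF uB]) auto
    then have yu: "below n ?y u" by (simp add: double_neg_def comp_def)
    have yE: "?y \<in> even_perms n" using S zeros_signed[OF x(1)] by (intro even_perms_comp double_neg_even)
    have yB: "?y \<in> signed_perms n" using yE even_perms_signed by blast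
    have "?y p = - p" if "p \<in> {a, b, c}" for p
      using that abs ax by (auto simp: double_neg_apply)
    then have "linked ?y p (- p)" if "p \<in> {a, b, c}" for p
      using that linked_app[of ?y p] by metis
    then have "{a, b, c} \<subseteq> zeros n ?y" using S by (auto simp: zeros_def)
    then have "below n w ?y" using wmin[OF yE yu] bound[OF yB] by blast
    then have sz: "s \<in> zeros n ?y" using zeros_mono s by blast
    have fixed: "\<forall>s. s \<notin> {a, b, c, x} \<longrightarrow> - s \<notin> {a, b, c, x} \<longrightarrow> ?y s = s"
      using abs ax by (auto simp: double_neg_apply abs_eq_iff)
    have "- s \<in> signed_points n" using zeros_signed[OF sz] by simp
    then have "s \<in> {a, b, c, x} \<or> - s \<in> {a, b, c, x}"
      using zeros_fixed_off[OF yB fixed zeros_signed[OF sz] _ zeros_linked[OF sz]]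
        signed_points_neq_uminus[OF zeros_signed[OF sz]] by blast
    then show ?thesis by auto
  qed
  have only: "\<bar>s\<bar> \<in> {\<bar>a\<bar>, \<bar>b\<bar>, \<bar>c\<bar>}" if "s \<in> zeros n w" for s
    using sub[OF that _ d] sub[OF that _ e] z de by auto
  have "even (card {a, b, c})"
  proof (rule even_card_reps[OF w(1) wz])
    show "i = j" if "i \<in> {a, b, c}" "j \<in> {a, b, c}" "j \<in> orbit w i" for i j
    proof -
      have "j \<in> orbit u i" using orbit_below[OF w(2)] that wz by blast
      then show ?thesis using that(1,2) o o' by auto
    qed
    show "\<exists>p\<in>{a, b, c}. s \<in> orbit w p" if s: "s \<in> zeros n w" for s
    proof -
      have *: "p \<in> orbit w p" "- p \<in> orbit w p" if "p \<in> {a, b, c}" for p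
        using orbit_self[OF wB] zeros_orbit_neg[OF wB] wz that by blast+
      show ?thesis using only[OF s] *[of a] *[of b] *[of c] by (auto simp: abs_eq_iff)
    qed
  qed
  moreover have "a \<noteq> c" using abs by auto
  ultimately show False using ne by simp
qed

theorem joins_iff_small_zeros:
  assumes u: "u \<in> even_perms n" shows "joins_in n u \<longleftrightarrow> small_zeros n u"
proof
  assume "small_zeros n u"
  then show "joins_in n u" unfolding joins_in_def using joins_exist[OF u] by blast
next
  assume J: "joins_in n u"
  have uB: "u \<in> signed_perms n" using u even_perms_signed by blast
  show "small_zeros n u"
  proof (rule ccontr)
    assume ns: "\<not> small_zeros n u"
    then obtain a where a: "a \<in> zeros n u" unfolding small_zeros_def by blast
    obtain b where b: "b \<in> zeros n u" "b \<notin> orbit u a" using zeros_two_orbits[OF u a] by blast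
    have cross: "t \<in> orbit u s" if "s \<in> orbit u p" "t \<in> orbit u p" for s t p
      using orbit_trans[OF that(2)] orbit_symm[OF uB, of s p] that(1) by blast
    \<comment> \<open>With only two balanced cycles, a 1-cycle among them would be the part 1 of a
      partition \<open>(k, 1)\<close>.\<close>
    have neg: "u p \<noteq> - p" if p: "p \<in> zeros n u" and q: "\<And>s. s \<in> zeros n u \<Longrightarrow> s \<in> orbit u p \<or> s \<in> orbit u q" for p q
    proof
      assume m: "u p = - p"
      have "j \<in> orbit u i" if "i \<in> zeros n u" "j \<in> zeros n u" "\<bar>i\<bar> \<noteq> \<bar>p\<bar>" "\<bar>j\<bar> \<noteq> \<bar>p\<bar>" for i j
      proof -
        have "i \<notin> orbit u p" "j \<notin> orbit u p" using orbit_negated[OF uB m] that(3,4) by auto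
        then show ?thesis using q that(1,2) cross by blast
      qed
      then show False using ns p m unfolding small_zeros_def by blast
    qed
    show False
    proof (cases "\<forall>s\<in>zeros n u. s \<in> orbit u a \<or> s \<in> orbit u b")
      case True
      then show False
        using not_joins_two_orbits[OF u a b] neg[OF a, of b] neg[OF b(1), of a] J by blast
    next
      case False
      then obtain c where c: "c \<in> zeros n u" "c \<notin> orbit u a" "c \<notin> orbit u b" by blast
      have "\<exists>d\<in>zeros n u. d \<notin> orbit u a \<and> d \<notin> orbit u b \<and> d \<notin> orbit u c"
      proof (rule ccontr)
        assume nd: "\<not> ?thesis"
        have "even (card {a, b, c})"
        proof (rule even_card_reps[OF u])
          show "i = j" if "i \<in> {a, b, c}" "j \<in> {a, b, c}" "j \<in> orbit u i" for i j
            using that b c orbit_symm[OF uB] by auto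
        qed (use a b c nd in auto)
        moreover have "a \<noteq> b" "a \<noteq> c" "b \<noteq> c" using b c orbit_self[OF uB] by auto
        ultimately show False by simp
      qed
      then obtain d where d: "d \<in> zeros n u" "d \<notin> orbit u a" "d \<notin> orbit u b" "d \<notin> orbit u c" by blast
      \<comment> \<open>Joins fail as soon as three of the four cycles avoid two zeros of
        \<open>u\<close> with distinct absolute values. Such zeros are \<open>s\<close> and
        \<open>u s\<close> on a long cycle or, if all cycles are 1-cycles, the fourth and a fifth
        one.\<close>
      have three: False
        if s: "s \<in> zeros n u" "t \<in> zeros n u" "\<bar>s\<bar> \<noteq> \<bar>t\<bar>" and p: "{p, q, r} \<subseteq> {a, b, c, d}" "p \<noteq> q" "p \<noteq> r" "q \<noteq> r"
          and n: "\<forall>x\<in>{p, q, r}. s \<notin> orbit u x \<and> t \<notin> orbit u x" for s t p q r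
      proof -
        have "y \<notin> orbit u x" if "x \<in> {a, b, c, d}" "y \<in> {a, b, c, d}" "x \<noteq> y" for x y
          using that b c d orbit_symm[OF uB] by auto
        then have "q \<notin> orbit u p" "r \<notin> orbit u p" "r \<notin> orbit u q" using p by auto
        moreover have "{p, q, r, s, t} \<subseteq> zeros n u" using p(1) a b c d s by blast
        ultimately show False
          using not_joins_three_orbits[OF u, of p q r s t] n s(3) J by blast
      qed
      have dist: "a \<noteq> b" "a \<noteq> c" "a \<noteq> d" "b \<noteq> c" "b \<noteq> d" "c \<noteq> d" using b c d orbit_self[OF uB] by auto
      show False
      proof (cases "\<forall>s\<in>zeros n u. u s = - s")
        case False
        then obtain s where s: "s \<in> zeros n u" "u s \<noteq> - s" by blast
        have o: "u s \<in> orbit u s" by (rule orbit.base)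
        have t: "u s \<in> zeros n u" using zeros_orbit[OF uB s(1) o] .
        have "u s \<noteq> s"
          using zeros_orbit_neg[OF uB s(1)] orbit_fixed[of u s] signed_points_neq_uminus[OF zeros_signed[OF s(1)]] by auto
        then have st: "\<bar>s\<bar> \<noteq> \<bar>u s\<bar>" using s(2) by (auto simp: abs_eq_iff)
        have same: "u s \<in> orbit u x \<longleftrightarrow> s \<in> orbit u x" for x using orbit_step_iff[OF uB] .
        have once: "y \<in> orbit u x" if "s \<in> orbit u x" "s \<in> orbit u y" for x y
          using orbit_trans[of y u s x] orbit_symm[OF uB, of s y] that by blast
        \<comment> \<open>The point \<open>s\<close> lies on at most one of the four cycles, so the
          other three can be used.\<close>
        consider "\<forall>x\<in>{a, b, c}. s \<notin> orbit u x" | "\<forall>x\<in>{a, b, d}. s \<notin> orbit u x"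
          | "\<forall>x\<in>{a, c, d}. s \<notin> orbit u x" | "\<forall>x\<in>{b, c, d}. s \<notin> orbit u x"
          using once[of a b] once[of a c] once[of a d] once[of b c] once[of b d] once[of c d] b c d by blast
        then show False
          using three[OF s(1) t st] dist same by cases blast+
      next
        case True
        then have c8: "card (zeros n u) > 8" using ns unfolding small_zeros_def by linarith
        have "\<exists>e\<in>zeros n u. e \<notin> {a, b, c, d, - a, - b, - c, - d}"
        proof (rule ccontr)
          assume "\<not> ?thesis"
          then have "zeros n u \<subseteq> {a, b, c, d, - a, - b, - c, - d}" by blast
          then have "card (zeros n u) \<le> card {a, b, c, d, - a, - b, - c, - d}" by (intro card_mono) auto
          also have "\<dots> \<le> 8" using card_length[of "[a, b, c, d, - a, - b, - c, - d]"] by simp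
          finally show False using c8 by simp
        qed
        then obtain e where e: "e \<in> zeros n u" "e \<notin> {a, b, c, d, - a, - b, - c, - d}" by blast
        have "\<bar>d\<bar> \<noteq> \<bar>e\<bar>" using e by (auto simp: abs_eq_iff)
        moreover have "e \<notin> orbit u x" if "x \<in> {a, b, c}" for x
          using orbit_negated[OF uB, of x] True that a b(1) c(1) e(2) by blast
        ultimately show False using three[OF d(1) e(1), of a b c] dist d by blast
      qed
    qed
  qed
qed

section \<open>Balanced cycles and the partition\<close>

lemma support_orbit: "permutation w \<Longrightarrow> set (support w i) = orbit w i"
  unfolding support_set orbit_altdef_permutation by blast

lemma cycle_of_support:
  assumes "permutation w" shows "cycle_of_list (support w i) = perm_restrict w (orbit w i)"
proof
  fix x
  show "cycle_of_list (support w i) x = perm_restrict w (orbit w i) x"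
    using cycle_restrict[OF assms, of x i] id_outside_supp[of x "support w i"]
    unfolding perm_restrict_def support_orbit[OF assms] by simp
qed

lemma funpow_uminus: "w \<in> signed_perms n \<Longrightarrow> (w ^^ k) (- i) = - (w ^^ k) i"
  by (induction k) (simp_all add: signed_perms_uminus)

text \<open>If \<open>- i\<close> is reached after \<open>k\<close> steps, with \<open>k\<close>
  positive and less than the period, then \<open>2 k\<close> is a multiple of the period and so
  equals it. The second half of the cycle is therefore the negative of the first.\<close>

lemma balanced_cycle_orbit:
  assumes w: "w \<in> signed_perms n" and i: "i \<in> zeros n w"
  shows "is_balanced_cycle n (perm_restrict w (orbit w i))"
proof -
  note p = signed_perms_permutation[OF w]
  have iS: "i \<in> signed_points n" using i by (rule zeros_signed)
  let ?L = "least_power w i"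
  have "- i \<in> set (support w i)" using zeros_orbit_neg[OF w i] support_orbit[OF p] by blast
  then obtain k where k: "k < ?L" "(w ^^ k) i = - i" by auto
  have k0: "k > 0" using k(2) signed_points_neq_uminus[OF iS] by (cases k) auto
  have neg: "(w ^^ (k + q)) i = - (w ^^ q) i" for q
    using funpow_add[of q k w] k(2) funpow_uminus[OF w] by (simp add: add.commute)
  have "(w ^^ (k + k)) i = i" using neg[of k] k(2) by simp
  then have "?L dvd k + k" by (rule least_power_minimal)
  then obtain c where c: "k + k = ?L * c" by blast
  have "?L * c < ?L * 2" "0 < ?L * c" using c k(1) k0 by linarith+
  then have "c < 2" "0 < c" unfolding mult_less_cancel1 nat_0_less_mult_iff by blast+
  then have "c = 1" by linarith
  then have L: "?L = k + k" using c by simp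
  define as where "as = map (\<lambda>q. (w ^^ q) i) [0..<k]"
  have sup: "support w i = as @ map uminus as"
  proof -
    have "[0..<?L] = [0..<k] @ map (\<lambda>q. k + q) [0..<k]"
      unfolding L upt_add_eq_append[OF le0] by (simp add: map_add_upt add.commute)
    then show ?thesis by (simp add: as_def neg comp_def)
  qed
  have dist: "distinct (as @ map uminus as)" using cycle_of_permutation[OF p, of i] sup by simp
  have "distinct (map abs as)"
  proof (subst distinct_map, intro conjI inj_onI)
    show "distinct as" using dist by simp
    fix x y assume "x \<in> set as" "y \<in> set as" "\<bar>x\<bar> = \<bar>y\<bar>"
    then show "x = y" using dist by (auto simp: abs_eq_iff)
  qed
  moreover have "as \<noteq> []" using k0 by (simp add: as_def)
  moreover have "set as \<subseteq> signed_points n"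
    using orbit_signed_points[OF w iS] support_orbit[OF p, of i] sup by auto
  ultimately have "cycle_word n as" by (simp add: cycle_word_def)
  moreover have "perm_restrict w (orbit w i) = balanced_cycle as"
    using cycle_of_support[OF p, of i] unfolding sup balanced_cycle_def by simp
  ultimately show ?thesis unfolding is_balanced_cycle_def by blast
qed

text \<open>The periods of \<open>i\<close> and \<open>- i\<close> agree, so negating the list of
  one orbit lists the other.\<close>

lemma paired_cycle_orbit:
  assumes w: "w \<in> signed_perms n" and i: "i \<in> signed_points n" "i \<notin> zeros n w"
  shows "is_paired_cycle n (perm_restrict w (orbit w i \<union> orbit w (- i)))"
proof -
  note p = signed_perms_permutation[OF w]
  let ?as = "support w i"
  have "(w ^^ q) (- i) = - i \<longleftrightarrow> (w ^^ q) i = i" for q using funpow_uminus[OF w] by simp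
  then have "least_power w (- i) = least_power w i" unfolding least_power_def by simp
  then have m: "map uminus ?as = support w (- i)" by (simp add: funpow_uminus[OF w])
  have "distinct (map abs ?as)"
  proof (subst distinct_map, intro conjI inj_onI)
    show "distinct ?as" by (rule cycle_of_permutation[OF p])
    fix x y assume xy: "x \<in> set ?as" "y \<in> set ?as" "\<bar>x\<bar> = \<bar>y\<bar>"
    then have "x \<in> orbit w i" "y \<in> orbit w i" using support_orbit[OF p] by blast+
    then show "x = y" using nonzero_orbit(1)[OF w i] xy(3) by (auto simp: abs_eq_iff)
  qed
  moreover have "?as \<noteq> []" using least_power_of_permutation(2)[OF p, of i] by simp
  moreover have "set ?as \<subseteq> signed_points n" using orbit_signed_points[OF w i(1)] support_orbit[OF p] by blast
  ultimately have "cycle_word n ?as" by (simp add: cycle_word_def)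
  moreover have "perm_restrict w (orbit w i \<union> orbit w (- i)) = paired_cycle ?as"
  proof
    fix x
    have disj: "y \<notin> orbit w i" if "y \<in> orbit w (- i)" for y
      using that nonzero_orbit(1)[OF w i, of y] orbit_neg[OF w, of "- y" i] by auto
    have "w x \<in> orbit w (- i) \<longleftrightarrow> x \<in> orbit w (- i)" by (rule orbit_step_iff[OF w])
    then show "perm_restrict w (orbit w i \<union> orbit w (- i)) x = paired_cycle ?as x"
      unfolding paired_cycle_def m cycle_of_support[OF p] using disj by (auto simp: perm_restrict_def)
  qed
  ultimately show ?thesis unfolding is_paired_cycle_def by blast
qed

section \<open>Decomposition into disjoint cycles\<close>

definition invariant_set :: "(int \<Rightarrow> int) \<Rightarrow> int set \<Rightarrow> bool" where
  "invariant_set w P \<longleftrightarrow> (\<forall>x. w x \<in> P \<longleftrightarrow> x \<in> P) \<and> (\<forall>x. - x \<in> P \<longleftrightarrow> x \<in> P)"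

lemma invariant_balanced: "w \<in> signed_perms n \<Longrightarrow> i \<in> zeros n w \<Longrightarrow> invariant_set w (orbit w i)"
  by (simp add: invariant_set_def orbit_step_iff orbit_neg_zeros)

lemma invariant_paired: "w \<in> signed_perms n \<Longrightarrow> invariant_set w (orbit w i \<union> orbit w (- i))"
  using orbit_neg[of w n] orbit_step_iff[of w n] unfolding invariant_set_def by (metis UnE UnI1 UnI2 minus_minus)

lemma invariant_compl: "invariant_set w P \<Longrightarrow> invariant_set w (- P)"
  by (simp add: invariant_set_def)

lemma perm_restrict_signed:
  assumes w: "w \<in> signed_perms n" and P: "invariant_set w P"
  shows "perm_restrict w P \<in> signed_perms n"
proof -
  have P': "w x \<in> P \<longleftrightarrow> x \<in> P" "- x \<in> P \<longleftrightarrow> x \<in> P" for x using P by (auto simp: invariant_set_def)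
  have "inj_on (perm_restrict w P) (signed_points n)"
  proof (rule inj_onI)
    fix x y assume "perm_restrict w P x = perm_restrict w P y"
    then show "x = y" using P'(1)[of x] P'(1)[of y] signed_perms_inj[OF w] by (auto simp: perm_restrict_def split: if_splits)
  qed
  moreover have "perm_restrict w P ` signed_points n \<subseteq> signed_points n"
    using signed_perms_mem[OF w] by (auto simp: perm_restrict_def)
  ultimately have "bij_betw (perm_restrict w P) (signed_points n) (signed_points n)"
    by (simp add: bij_betw_def endo_inj_surj)
  then have "perm_restrict w P permutes signed_points n"
    by (rule bij_imp_permutes) (auto simp: perm_restrict_def signed_perms_fix[OF w])
  then show ?thesis
    by (simp add: signed_perms_iff perm_restrict_def P'(2) signed_perms_uminus[OF w])
qed

lemma perm_restrict_split:
  assumes "invariant_set w P"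
  shows "w = perm_restrict w P \<circ> perm_restrict w (- P)"
proof
  fix x
  show "w x = (perm_restrict w P \<circ> perm_restrict w (- P)) x"
    using assms by (cases "x \<in> P") (simp_all add: perm_restrict_def invariant_set_def)
qed

lemma cycle_decomposition_Cons:
  assumes P: "invariant_set w P" and c: "is_paired_cycle n (perm_restrict w P) \<or> is_balanced_cycle n (perm_restrict w P)"
    and cs: "cycle_decomposition n (perm_restrict w (- P)) cs"
      "\<And>d. d \<in> set cs \<Longrightarrow> {x. d x \<noteq> x} \<subseteq> {x. perm_restrict w (- P) x \<noteq> x}"
  shows "cycle_decomposition n w (perm_restrict w P # cs)"
proof -
  have "disjnt {x. perm_restrict w P x \<noteq> x} {x. d x \<noteq> x}" if "d \<in> set cs" for d
    using cs(2)[OF that] unfolding disjnt_def perm_restrict_def by auto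
  moreover have "w = prod_comp (perm_restrict w P # cs)"
    using perm_restrict_split[OF P] cs(1) unfolding cycle_decomposition_def prod_comp_simps by metis
  ultimately show ?thesis
    using c cs(1) unfolding cycle_decomposition_def by simp
qed

text \<open>One orbit, together with its negative, is split off at a time. The inclusion of supports
  is carried along to keep the later cycles disjoint from the one just removed.\<close>

lemma cycle_decomposition_exists:
  assumes "w \<in> signed_perms n"
  shows "\<exists>cs. cycle_decomposition n w cs \<and> (\<forall>c\<in>set cs. {x. c x \<noteq> x} \<subseteq> {x. w x \<noteq> x})"
  using assms
proof (induction "card {x. w x \<noteq> x}" arbitrary: w rule: less_induct)
  case less
  show ?case
  proof (cases "w = id")
    case True
    then show ?thesis by (intro exI[of _ "[]"]) (simp add: cycle_decomposition_def)
  next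
    case False
    then obtain i where i: "w i \<noteq> i" by (auto simp: fun_eq_iff)
    then have iS: "i \<in> signed_points n" using signed_perms_fix[OF less.prems] by blast
    obtain P where P: "invariant_set w P" "i \<in> P"
      and c: "is_paired_cycle n (perm_restrict w P) \<or> is_balanced_cycle n (perm_restrict w P)"
    proof (cases "i \<in> zeros n w")
      case True
      then show ?thesis
        using that invariant_balanced[OF less.prems True] orbit_self[OF less.prems] balanced_cycle_orbit[OF less.prems True] by blast
    next
      case False
      then show ?thesis
        using that invariant_paired[OF less.prems] orbit_self[OF less.prems, of i] paired_cycle_orbit[OF less.prems iS False] by blast
    qed
    let ?w = "perm_restrict w (- P)"
    have w: "?w \<in> signed_perms n" using perm_restrict_signed[OF less.prems invariant_compl[OF P(1)]] .
    have sub: "{x. ?w x \<noteq> x} \<subset> {x. w x \<noteq> x}" using i P(2) by (auto simp: perm_restrict_def)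
    have "finite {x. w x \<noteq> x}"
      by (rule finite_subset[of _ "signed_points n"]) (use signed_perms_fix[OF less.prems] in auto)
    then have "card {x. ?w x \<noteq> x} < card {x. w x \<noteq> x}" using sub by (rule psubset_card_mono)
    from less.hyps[OF this w] obtain cs where cs: "cycle_decomposition n ?w cs"
      "\<forall>c\<in>set cs. {x. c x \<noteq> x} \<subseteq> {x. ?w x \<noteq> x}" by blast
    have "cycle_decomposition n w (perm_restrict w P # cs)"
      using cycle_decomposition_Cons[OF P(1) c cs(1)] cs(2) by blast
    moreover have "{x. perm_restrict w P x \<noteq> x} \<subseteq> {x. w x \<noteq> x}" by (auto simp: perm_restrict_def)
    ultimately show ?thesis using cs(2) sub by (intro exI[of _ "perm_restrict w P # cs"]) auto
  qed
qed

lemma prod_comp_fix: "(\<And>d. d \<in> set cs \<Longrightarrow> d x = x) \<Longrightarrow> prod_comp cs x = x"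
  by (induction cs) auto

text \<open>The other factors fix both \<open>x\<close> and \<open>c x\<close>, because
  \<open>c\<close> moves these two points.\<close>

lemma prod_comp_disjoint:
  assumes "sorted_wrt (\<lambda>c d. disjnt {x. c x \<noteq> x} {x. d x \<noteq> x}) cs" "c \<in> set cs" "inj c" "c x \<noteq> x"
  shows "prod_comp cs x = c x"
  using assms
proof (induction cs)
  case (Cons d ds)
  show ?case
  proof (cases "c = d")
    case True
    have "e x = x" if "e \<in> set ds" for e
      using Cons.prems(1,4) that True unfolding disjnt_def by auto
    then have "prod_comp ds x = x" by (rule prod_comp_fix)
    then show ?thesis using True by simp
  next
    case False
    then have c: "c \<in> set ds" using Cons.prems by simp
    then have IH: "prod_comp ds x = c x" using Cons by simp
    have "c (c x) \<noteq> c x" using Cons.prems(3,4) by (simp add: inj_eq)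
    moreover have "disjnt {x. d x \<noteq> x} {x. c x \<noteq> x}" using Cons.prems(1) c by simp
    ultimately have "d (c x) = c x" unfolding disjnt_def by auto
    then show ?thesis using IH by simp
  qed
qed simp

text \<open>On the points moved by \<open>c\<close> the product \<open>w\<close> agrees with
  \<open>c\<close>, so these points form an orbit of \<open>w\<close>. Hence the balanced cycles do
  not depend on the chosen decomposition.\<close>

lemma balanced_cycle_in_decomposition:
  assumes w: "w \<in> signed_perms n" and cs: "cycle_decomposition n w cs" "c \<in> set cs" and c: "is_balanced_cycle n c"
  shows "\<exists>i\<in>zeros n w. c = perm_restrict w (orbit w i)"
proof -
  obtain as where as: "cycle_word n as" "c = balanced_cycle as" using c unfolding is_balanced_cycle_def by blast
  define bs where "bs = as @ map uminus as"
  have cb: "c = cycle_of_list bs" using as(2) by (simp add: balanced_cycle_def bs_def)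
  have as': "as \<noteq> []" "set as \<subseteq> signed_points n" "distinct (map abs as)" using as(1) by (auto simp: cycle_word_def)
  have dist: "distinct bs"
  proof -
    have "distinct as" using as'(3) by (simp add: distinct_map)
    moreover have "x \<noteq> - y" if "x \<in> set as" "y \<in> set as" for x y
    proof
      assume "x = - y"
      then have "\<bar>x\<bar> = \<bar>y\<bar>" by simp
      then have "x = y" using as'(3) that unfolding distinct_map by (blast dest: inj_onD)
      then have "y = - y" using \<open>x = - y\<close> by simp
      then show False using as'(2) that(2) signed_points_neq_uminus by blast
    qed
    ultimately show ?thesis by (auto simp: bs_def distinct_map)
  qed
  have inj: "inj c" unfolding cb using cycle_permutes permutes_inj by blast
  have rot: "(c ^^ k) (bs ! q) = bs ! ((k + q) mod length bs)" if "q < length bs" for k q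
  proof -
    have "map (c ^^ k) bs ! q = rotate k bs ! q" unfolding cb using cyclic_rotation[OF dist] by simp
    then show ?thesis using that by (simp add: nth_rotate add.commute)
  qed
  define a where "a = as ! 0"
  have len: "length bs = 2 * length as" "length as > 0" using as'(1) by (simp_all add: bs_def)
  have a0: "a = bs ! 0" "a \<in> set bs" "a \<in> signed_points n"
    using as' by (auto simp: a_def bs_def nth_append)
  have bsk: "bs ! k = (c ^^ k) a" if "k < length bs" for k
    using rot[of 0 k] that len a0(1) by auto
  have moved: "c x \<noteq> x" if x: "x \<in> set bs" for x
  proof -
    obtain q where q: "q < length bs" "x = bs ! q" using x by (auto simp: in_set_conv_nth)
    \<comment> \<open>Even a balanced 1-cycle has two entries, so no entry is its own
      successor.\<close>
    have "length bs \<ge> 2" using len by linarith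
    then have "(1 + q) mod length bs \<noteq> q" using q(1) by (auto simp: mod_if)
    then have "bs ! ((1 + q) mod length bs) \<noteq> bs ! q" using dist q(1) len by (simp add: nth_eq_iff_index_eq)
    then show ?thesis using rot[OF q(1), of 1] q(2) by simp
  qed
  have agree: "w x = c x" if "x \<in> set bs" for x
    using prod_comp_disjoint[OF _ cs(2) inj moved[OF that]] cs(1) by (simp add: cycle_decomposition_def)
  have closed: "c x \<in> set bs" if "x \<in> set bs" for x
    unfolding cb using that cycle_permutes[of bs] by (metis permutes_in_image)
  have pow: "(w ^^ k) a = (c ^^ k) a \<and> (c ^^ k) a \<in> set bs" for k
    by (induction k) (use a0 agree closed in auto)
  have orb: "orbit w a = set bs"
  proof
    show "orbit w a \<subseteq> set bs"
      unfolding orbit_altdef_permutation[OF signed_perms_permutation[OF w]] using pow by auto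
    show "set bs \<subseteq> orbit w a"
    proof
      fix x assume "x \<in> set bs"
      then obtain k where "k < length bs" "x = bs ! k" by (auto simp: in_set_conv_nth)
      then have "x = (w ^^ k) a" using bsk pow by simp
      then show "x \<in> orbit w a" unfolding orbit_altdef_permutation[OF signed_perms_permutation[OF w]] by blast
    qed
  qed
  have "- a \<in> set bs" using as'(1) by (simp add: bs_def a_def)
  then have "a \<in> zeros n w" using orb linked_zero_iff[OF w] a0(3) by (simp add: zeros_def)
  moreover have "c = perm_restrict w (orbit w a)"
  proof
    fix x
    show "c x = perm_restrict w (orbit w a) x"
      using agree[of x] id_outside_supp[of x bs] unfolding orb cb perm_restrict_def by auto
  qed
  ultimately show ?thesis by blast
qed

lemma balanced_cycles_of_eq:
  assumes w: "w \<in> signed_perms n"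
  shows "balanced_cycles_of n w = perm_restrict w ` orbit w ` zeros n w"
proof
  show "balanced_cycles_of n w \<subseteq> perm_restrict w ` orbit w ` zeros n w"
    using balanced_cycle_in_decomposition[OF w] unfolding balanced_cycles_of_def by blast
  show "perm_restrict w ` orbit w ` zeros n w \<subseteq> balanced_cycles_of n w"
  proof
    fix c assume "c \<in> perm_restrict w ` orbit w ` zeros n w"
    then obtain i where i: "i \<in> zeros n w" "c = perm_restrict w (orbit w i)" by blast
    note P = invariant_balanced[OF w i(1)]
    note b = balanced_cycle_orbit[OF w i(1)]
    obtain cs where cs: "cycle_decomposition n (perm_restrict w (- orbit w i)) cs"
      "\<forall>c\<in>set cs. {x. c x \<noteq> x} \<subseteq> {x. perm_restrict w (- orbit w i) x \<noteq> x}"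
      using cycle_decomposition_exists[OF perm_restrict_signed[OF w invariant_compl[OF P]]] by blast
    have "cycle_decomposition n w (c # cs)"
      unfolding i(2) using cycle_decomposition_Cons[OF P _ cs(1)] b cs(2) by blast
    then show "c \<in> balanced_cycles_of n w"
      unfolding balanced_cycles_of_def using b i(2) by (intro CollectI conjI exI[of _ "c # cs"]) auto
  qed
qed

section \<open>Lengths of balanced cycles and the multiset of parts\<close>

definition half_card :: "nat \<Rightarrow> int set \<Rightarrow> nat" where
  "half_card n P = card (P \<inter> {1..int n})"

text \<open>The functions invariant under a balanced k-cycle are the odd functions that vanish on
  it. This leaves \<open>3 ^ (n - k)\<close> ternary ones, hence the length is \<open>k\<close>, the
  number of positive points on the cycle.\<close>

lemma len_balanced_cycle:
  assumes w: "w \<in> signed_perms n" and i: "i \<in> zeros n w"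
  shows "len n (perm_restrict w (orbit w i)) = half_card n (orbit w i)"
proof -
  let ?O = "orbit w i" and ?c = "perm_restrict w (orbit w i)"
  note P = invariant_balanced[OF w i]
  have c: "?c \<in> signed_perms n" by (rule perm_restrict_signed[OF w P])
  have nO: "- x \<in> ?O \<longleftrightarrow> x \<in> ?O" and wO: "w x \<in> ?O \<longleftrightarrow> x \<in> ?O" for x using P by (auto simp: invariant_set_def)
  have aO: "\<bar>x\<bar> \<in> ?O \<longleftrightarrow> x \<in> ?O" for x using nO by (auto simp: abs_if)
  have zero: "f x = 0" if f: "f \<in> inv_funs ?c" and x: "x \<in> ?O" for f x
  proof -
    have con: "f s = f i" if "s \<in> ?O" for s
      using that
    proof (induction rule: orbit.induct)
      case base
      show ?case using inv_funs_inv[OF f, of i] orbit_self[OF w, of i] by (simp add: perm_restrict_def)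
    next
      case (step s)
      then show ?case using inv_funs_inv[OF f, of s] by (simp add: perm_restrict_def)
    qed
    have "f (- i) = f i" using con zeros_orbit_neg[OF w i] by blast
    then show ?thesis using con[OF x] inv_funs_odd[OF f, of i] by simp
  qed
  have "ternary n ?c = {f. (\<forall>x. f (- x) = - f x) \<and> (\<forall>x. f x \<in> {-1, 0, 1}) \<and>
     (\<forall>x. \<bar>x\<bar> \<notin> {1..int n} - ?O \<longrightarrow> f x = 0)}" (is "_ = ?A")
  proof
    show "ternary n ?c \<subseteq> ?A"
    proof
      fix f assume f: "f \<in> ternary n ?c"
      then have "f x = 0" if "\<bar>x\<bar> \<notin> {1..int n} - ?O" for x
        using that zero[OF ternary_inv_funs[OF f], of x] aO[of x] by (auto simp: ternary_def signed_points_def)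
      then show "f \<in> ?A" using f by (simp add: ternary_def inv_funs_def)
    qed
    show "?A \<subseteq> ternary n ?c"
    proof
      fix f assume f: "f \<in> ?A"
      have z: "f x = 0" if "x \<in> ?O" for x using f that aO[of x] by auto
      have "f (?c x) = f x" for x using z[of x] z[of "w x"] wO[of x] by (auto simp: perm_restrict_def)
      moreover have "f x = 0" if "x \<notin> signed_points n" for x
        using f that by (auto simp: signed_points_def)
      ultimately show "f \<in> ternary n ?c" using f by (simp add: ternary_def inv_funs_def)
    qed
  qed
  then have "card (ternary n ?c) = 3 ^ card ({1..int n} - ?O)"
    using card_odd_ternary[of "{1..int n} - ?O" n] by auto
  moreover have "card ({1..int n} - ?O) + half_card n ?O = n"
    using card_Diff_subset_Int[of "{1..int n}" ?O] card_mono[of "{1..int n}" "?O \<inter> {1..int n}"]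
    by (simp add: half_card_def Int_commute)
  ultimately have "(3::nat) ^ (card ({1..int n} - ?O) + len n ?c) = 3 ^ (card ({1..int n} - ?O) + half_card n ?O)"
    using len_card[OF c] by (simp add: power_add)
  then show ?thesis by simp
qed

text \<open>A balanced cycle moves every point of its orbit, which can therefore be read off as its
  support. Equal parts from different cycles are thus counted separately.\<close>

lemma perm_restrict_orbits_inj:
  assumes w: "w \<in> signed_perms n" shows "inj_on (perm_restrict w) (orbit w ` zeros n w)"
proof (rule inj_onI)
  have "{x. perm_restrict w P x \<noteq> x} = P" if P: "P \<in> orbit w ` zeros n w" for P
  proof -
    obtain i where i: "i \<in> zeros n w" "P = orbit w i" using P by blast
    have "w x \<noteq> x" if "x \<in> P" for x
    proof -
      have "x \<in> zeros n w" using zeros_orbit[OF w i(1)] that i(2) by blast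
      then show ?thesis
        using zeros_orbit_neg[OF w, of x] orbit_fixed[of w x] signed_points_neq_uminus[of x n] zeros_signed[of x n w] by auto
    qed
    then show ?thesis by (auto simp: perm_restrict_def)
  qed
  then show "P = Q" if "P \<in> orbit w ` zeros n w" "Q \<in> orbit w ` zeros n w" "perm_restrict w P = perm_restrict w Q" for P Q
    using that by metis
qed

definition balanced_parts :: "nat \<Rightarrow> (int \<Rightarrow> int) \<Rightarrow> nat multiset" where
  "balanced_parts n w = image_mset (half_card n) (mset_set (orbit w ` zeros n w))"

lemma mu_eq:
  assumes w: "w \<in> signed_perms n"
  shows "mu n w = rev (sorted_list_of_multiset (balanced_parts n w))"
proof -
  have "image_mset (len n) (mset_set (balanced_cycles_of n w))
      = image_mset (len n) (image_mset (perm_restrict w) (mset_set (orbit w ` zeros n w)))"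
    unfolding balanced_cycles_of_eq[OF w] image_mset_mset_set[OF perm_restrict_orbits_inj[OF w]] ..
  also have "\<dots> = balanced_parts n w"
    unfolding balanced_parts_def multiset.map_comp
    by (rule image_mset_cong) (use len_balanced_cycle[OF w] in auto)
  finally show ?thesis by (simp add: mu_def)
qed

lemma rev_sorted_list_iff:
  "sorted (rev xs) \<Longrightarrow> rev (sorted_list_of_multiset M) = xs \<longleftrightarrow> M = mset xs"
proof
  assume "rev (sorted_list_of_multiset M) = xs"
  then show "M = mset xs" by (metis mset_rev mset_sorted_list_of_multiset)
next
  assume "sorted (rev xs)" "M = mset xs"
  then show "rev (sorted_list_of_multiset M) = xs"
    by (metis mset_rev rev_rev_ident sort_key_id_if_sorted sorted_list_of_multiset_mset sorted_sort_id)
qed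

lemma half_card_pos:
  assumes w: "w \<in> signed_perms n" and i: "i \<in> zeros n w"
  shows "\<bar>i\<bar> \<in> orbit w i \<inter> {1..int n}" "half_card n (orbit w i) > 0"
proof -
  have "\<bar>i\<bar> \<in> orbit w i" using orbit_self[OF w, of i] zeros_orbit_neg[OF w i] by (auto simp: abs_if)
  moreover have "\<bar>i\<bar> \<in> {1..int n}" using zeros_signed[OF i] by (auto simp: signed_points_def)
  ultimately show "\<bar>i\<bar> \<in> orbit w i \<inter> {1..int n}" by blast
  then have "orbit w i \<inter> {1..int n} \<noteq> {}" by blast
  then show "half_card n (orbit w i) > 0" unfolding half_card_def by (simp add: card_gt_0_iff)
qed

lemma half_card_one_iff:
  assumes w: "w \<in> signed_perms n" and i: "i \<in> zeros n w"
  shows "half_card n (orbit w i) = 1 \<longleftrightarrow> w i = - i"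
proof
  assume "half_card n (orbit w i) = 1"
  then obtain x where x: "orbit w i \<inter> {1..int n} = {x}" unfolding half_card_def by (auto simp: card_1_singleton_iff)
  have o: "w i \<in> orbit w i" by (rule orbit.base)
  then have wz: "w i \<in> zeros n w" using zeros_orbit[OF w i] by blast
  have "\<bar>w i\<bar> \<in> orbit w i" using o orbit_neg_zeros(1)[OF w i, of "w i"] by (auto simp: abs_if)
  then have "\<bar>w i\<bar> \<in> {x}" using IntD2[OF half_card_pos(1)[OF w wz]] unfolding x[symmetric] by blast
  moreover have "\<bar>i\<bar> \<in> {x}" using half_card_pos(1)[OF w i] unfolding x .
  moreover have "w i \<noteq> i"
    using zeros_orbit_neg[OF w i] orbit_fixed[of w i] signed_points_neq_uminus[OF zeros_signed[OF i]] by auto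
  ultimately show "w i = - i" by (auto simp: abs_eq_iff)
next
  assume "w i = - i"
  then have "orbit w i \<subseteq> {i, - i}" using orbit_negated[OF w] by blast
  then have "orbit w i \<inter> {1..int n} = {\<bar>i\<bar>}" using half_card_pos(1)[OF w i] by auto
  then show "half_card n (orbit w i) = 1" by (simp add: half_card_def)
qed

text \<open>Evenness supplies a second balanced cycle, and all zeros other than \<open>m\<close> and
  \<open>- m\<close> lie on it. It has at most \<open>n - 1\<close> positive points because
  \<open>m\<close> takes one coordinate.\<close>

lemma small_zeros_special:
  assumes w: "w \<in> even_perms n" and m: "m \<in> zeros n w" "w m = - m"
    and one: "\<And>i j. i \<in> zeros n w \<Longrightarrow> j \<in> zeros n w \<Longrightarrow> \<bar>i\<bar> \<noteq> \<bar>m\<bar> \<Longrightarrow> \<bar>j\<bar> \<noteq> \<bar>m\<bar> \<Longrightarrow> j \<in> orbit w i"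
  shows "\<exists>k\<ge>1. k \<le> n - 1 \<and> balanced_parts n w = {#k, 1#}"
proof -
  have wB: "w \<in> signed_perms n" using w even_perms_signed by blast
  obtain b where b: "b \<in> zeros n w" "b \<notin> orbit w m" using zeros_two_orbits[OF w m(1)] by blast
  have om: "s \<in> orbit w m" if "\<bar>s\<bar> = \<bar>m\<bar>" for s
    using that orbit_self[OF wB, of m] zeros_orbit_neg[OF wB m(1)] by (auto simp: abs_eq_iff)
  have eq: "orbit w x = orbit w y" if "x \<in> orbit w y" for x y
    using that orbit_trans[of _ w x y] orbit_trans[of _ w y x] orbit_symm[OF wB, of x y] by blast
  have orbs: "orbit w ` zeros n w = {orbit w b, orbit w m}"
  proof
    show "orbit w ` zeros n w \<subseteq> {orbit w b, orbit w m}"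
    proof
      fix P assume "P \<in> orbit w ` zeros n w"
      then obtain s where s: "s \<in> zeros n w" "P = orbit w s" by blast
      show "P \<in> {orbit w b, orbit w m}"
      proof (cases "\<bar>s\<bar> = \<bar>m\<bar>")
        case True
        then show ?thesis using eq[OF om[OF True]] s(2) by simp
      next
        case False
        then have "s \<in> orbit w b" using one[OF b(1) s(1)] om[of b] b(2) by blast
        then show ?thesis using eq s(2) by simp
      qed
    qed
  qed (use b m in auto)
  have ne: "orbit w b \<noteq> orbit w m" using b(2) orbit_self[OF wB, of b] by auto
  let ?k = "half_card n (orbit w b)"
  have hm: "half_card n (orbit w m) = 1" using half_card_one_iff[OF wB m(1)] m(2) by blast
  have "balanced_parts n w = {#?k, 1#}"
    unfolding balanced_parts_def orbs using ne hm by simp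
  moreover have "?k + 1 \<le> n"
  proof -
    have "orbit w b \<inter> orbit w m = {}"
      using eq ne by blast
    then have "card ((orbit w b \<inter> {1..int n}) \<union> (orbit w m \<inter> {1..int n})) = ?k + half_card n (orbit w m)"
      unfolding half_card_def by (intro card_Un_disjoint) auto
    moreover have "card ((orbit w b \<inter> {1..int n}) \<union> (orbit w m \<inter> {1..int n})) \<le> card {1..int n}"
      by (intro card_mono) auto
    ultimately show ?thesis using hm by simp
  qed
  moreover have "?k \<ge> 1" using half_card_pos(2)[OF wB b(1)] by simp
  ultimately show ?thesis by (intro exI[of _ ?k]) auto
qed

text \<open>The third alternative of \<open>small_zeros\<close> allows 0, 2 or 4 balanced 1-cycles
  by parity; two of them give \<open>(1, 1)\<close>, which is \<open>(k, 1)\<close> with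
  \<open>k = 1\<close>. The bound 8 counts two signed points for each of four 1-cycles.\<close>

lemma small_zeros_iff_parts:
  assumes w: "w \<in> even_perms n"
  shows "small_zeros n w \<longleftrightarrow> balanced_parts n w = {#} \<or> (\<exists>k\<ge>1. k \<le> n - 1 \<and> balanced_parts n w = {#k, 1#})
    \<or> balanced_parts n w = {#1, 1, 1, 1#}"
proof -
  have wB: "w \<in> signed_perms n" using w even_perms_signed by blast
  have fin: "finite (orbit w ` zeros n w)" by simp
  have eq: "orbit w x = orbit w y" if "x \<in> orbit w y" for x y
    using that orbit_trans[of _ w x y] orbit_trans[of _ w y x] orbit_symm[OF wB, of x y] by blast
  show ?thesis
  proof
    assume "small_zeros n w"
    then consider "zeros n w = {}" | m where "m \<in> zeros n w" "w m = - m"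
        "\<forall>i\<in>zeros n w. \<forall>j\<in>zeros n w. \<bar>i\<bar> \<noteq> \<bar>m\<bar> \<longrightarrow> \<bar>j\<bar> \<noteq> \<bar>m\<bar> \<longrightarrow> j \<in> orbit w i"
      | "\<forall>i\<in>zeros n w. w i = - i" "card (zeros n w) \<le> 8"
      unfolding small_zeros_def by blast
    then show "balanced_parts n w = {#} \<or> (\<exists>k\<ge>1. k \<le> n - 1 \<and> balanced_parts n w = {#k, 1#})
      \<or> balanced_parts n w = {#1, 1, 1, 1#}"
    proof cases
      case 1
      then show ?thesis by (simp add: balanced_parts_def)
    next
      case 2
      then show ?thesis using small_zeros_special[OF w 2(1,2)] by blast
    next
      case 3
      define R where "R = zeros n w \<inter> {1..int n}"
      have orb: "orbit w i = {i, - i}" if "i \<in> zeros n w" for i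
        using orbit_negated[OF wB, of i] 3(1) that orbit_self[OF wB, of i] zeros_orbit_neg[OF wB that] by blast
      have ev: "even (card R)"
      proof (rule even_card_balanced[OF w])
        show "i = j" if "i \<in> R" "j \<in> R" "j \<in> orbit w i" for i j
          using that orb[of i] by (auto simp: R_def)
        show "\<exists>a\<in>R. s \<in> orbit w a" if s: "s \<in> zeros n w" for s
        proof (intro bexI[of _ "\<bar>s\<bar>"])
          have az: "\<bar>s\<bar> \<in> zeros n w" using s by (simp add: abs_if)
          then show "\<bar>s\<bar> \<in> R" using zeros_signed[of "\<bar>s\<bar>" n w] by (auto simp: R_def signed_points_def)
          show "s \<in> orbit w \<bar>s\<bar>" unfolding orb[OF az] by (simp add: abs_if)
        qed
      qed (simp add: R_def)
      have orbs: "orbit w ` zeros n w = orbit w ` R"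
      proof
        show "orbit w ` zeros n w \<subseteq> orbit w ` R"
        proof
          fix P assume "P \<in> orbit w ` zeros n w"
          then obtain s where s: "s \<in> zeros n w" "P = orbit w s" by blast
          have az: "\<bar>s\<bar> \<in> zeros n w" using s by (simp add: abs_if)
          then have "\<bar>s\<bar> \<in> R" using zeros_signed[of "\<bar>s\<bar>" n w] by (auto simp: R_def signed_points_def)
          moreover have "P = orbit w \<bar>s\<bar>" unfolding s(2) orb[OF az] orb[OF s(1)] by (auto simp: abs_if)
          ultimately show "P \<in> orbit w ` R" by blast
        qed
      qed (auto simp: R_def)
      have inj: "inj_on (orbit w) R"
        using orb by (intro inj_onI) (auto simp: R_def doubleton_eq_iff)
      have "balanced_parts n w = image_mset (half_card n) (image_mset (orbit w) (mset_set R))"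
        unfolding balanced_parts_def orbs image_mset_mset_set[OF inj] ..
      also have "\<dots> = image_mset (\<lambda>_. 1) (mset_set R)"
        unfolding multiset.map_comp
        by (rule image_mset_cong) (use half_card_one_iff[OF wB] 3(1) in \<open>auto simp: R_def\<close>)
      finally have parts: "balanced_parts n w = replicate_mset (card R) 1" by (simp add: image_mset_const_eq)
      have "card R \<le> 4"
      proof -
        have "R \<union> uminus ` R \<subseteq> zeros n w" by (auto simp: R_def)
        then have "card (R \<union> uminus ` R) \<le> 8" using card_mono[OF finite_zeros] 3(2) le_trans by blast
        moreover have "card (R \<union> uminus ` R) = card R + card (uminus ` R)"
          by (intro card_Un_disjoint) (auto simp: R_def)
        moreover have "card (uminus ` R) = card R" by (intro card_image) (simp add: inj_on_def)
        ultimately show ?thesis by simp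
      qed
      then have "card R = 0 \<or> card R = 2 \<or> card R = 4" using ev by (auto elim!: evenE)
      moreover have "2 \<le> n" if "card R = 2"
      proof -
        have "card R \<le> card {1..int n}" by (intro card_mono) (auto simp: R_def)
        then show ?thesis using that by simp
      qed
      ultimately show ?thesis unfolding parts by (auto simp: numeral_eq_Suc intro: exI[of _ 1])
    qed
  next
    assume "balanced_parts n w = {#} \<or> (\<exists>k\<ge>1. k \<le> n - 1 \<and> balanced_parts n w = {#k, 1#})
      \<or> balanced_parts n w = {#1, 1, 1, 1#}"
    then consider "balanced_parts n w = {#}" | k where "balanced_parts n w = {#k, 1#}"
      | "balanced_parts n w = {#1, 1, 1, 1#}" by blast
    then show "small_zeros n w"
    proof cases
      case 1
      then have "zeros n w = {}" using fin by (auto simp: balanced_parts_def mset_set_empty_iff)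
      then show ?thesis by (simp add: small_zeros_def)
    next
      case 2
      have "card (orbit w ` zeros n w) = size (balanced_parts n w)" by (simp add: balanced_parts_def)
      then have c2: "card (orbit w ` zeros n w) = 2" using 2 by simp
      have "1 \<in># balanced_parts n w" using 2 by simp
      then obtain m where m: "m \<in> zeros n w" "half_card n (orbit w m) = 1"
        using fin by (auto simp: balanced_parts_def)
      have wm: "w m = - m" using half_card_one_iff[OF wB m(1)] m(2) by blast
      have "j \<in> orbit w i" if ij: "i \<in> zeros n w" "j \<in> zeros n w" "\<bar>i\<bar> \<noteq> \<bar>m\<bar>" "\<bar>j\<bar> \<noteq> \<bar>m\<bar>" for i j
      proof (rule ccontr)
        assume nj: "j \<notin> orbit w i"
        have "i \<notin> orbit w m" "j \<notin> orbit w m" using orbit_negated[OF wB wm] ij(3,4) by auto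
        then have "orbit w i \<noteq> orbit w m" "orbit w j \<noteq> orbit w m" "orbit w i \<noteq> orbit w j"
          using nj orbit_self[OF wB] by blast+
        then have "card {orbit w i, orbit w j, orbit w m} = 3" by simp
        moreover have "card {orbit w i, orbit w j, orbit w m} \<le> 2"
          unfolding c2[symmetric] using ij m(1) by (intro card_mono fin) auto
        ultimately show False by simp
      qed
      then show ?thesis unfolding small_zeros_def using m(1) wm by blast
    next
      case 3
      have one: "w i = - i" if "i \<in> zeros n w" for i
      proof -
        have "half_card n (orbit w i) \<in># balanced_parts n w" using that by (simp add: balanced_parts_def)
        then show ?thesis using 3 half_card_one_iff[OF wB that] by simp
      qed
      have "card (orbit w ` zeros n w) = size (balanced_parts n w)" by (simp add: balanced_parts_def)
      then have c4: "card (orbit w ` zeros n w) = 4" using 3 by simp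
      have "zeros n w \<subseteq> \<Union> (orbit w ` zeros n w)" using orbit_self[OF wB] by blast
      moreover have sm: "finite P \<and> card P \<le> 2" if P: "P \<in> orbit w ` zeros n w" for P
      proof -
        obtain i where i: "i \<in> zeros n w" "P = orbit w i" using P by blast
        then have sub: "P \<subseteq> {i, - i}" using orbit_negated[OF wB one[OF i(1)]] by simp
        have "card {i, - i} \<le> 2" by (simp add: card_insert_if)
        then show ?thesis using sub card_mono[OF _ sub] finite_subset[OF sub] by simp
      qed
      ultimately have "card (zeros n w) \<le> card (\<Union> (orbit w ` zeros n w))"
        using fin by (intro card_mono) auto
      also have "\<dots> \<le> sum card (orbit w ` zeros n w)" by (rule card_Union_le_sum_card)
      also have "\<dots> \<le> card (orbit w ` zeros n w) * 2" using sm by (intro sum_bounded_above[of _ card 2, simplified]) auto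
      finally have "card (zeros n w) \<le> 8" using c4 by simp
      then show ?thesis unfolding small_zeros_def using one by blast
    qed
  qed
qed

theorem theorem5p2:
  fixes n :: nat and w :: "int \<Rightarrow> int"
  assumes "w \<in> coxeter_D n"
  shows "lattice (abs_interval n w) \<longleftrightarrow>
    mu n w = [] \<or> (\<exists>k. k \<le> n - 1 \<and> mu n w = [k, 1]) \<or> mu n w = [1, 1, 1, 1]"
proof -
  have w: "w \<in> even_perms n" using assms by (simp add: coxeter_D_eq)
  then have wB: "w \<in> signed_perms n" by (rule even_perms_signed)
  have "mu n w = [k, 1] \<longleftrightarrow> k \<ge> 1 \<and> balanced_parts n w = {#k, 1#}" for k
  proof (cases "k \<ge> 1")
    case True
    then show ?thesis unfolding mu_eq[OF wB] using rev_sorted_list_iff[of "[k, 1]"] by simp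
  next
    case False
    \<comment> \<open>The list \<open>[0, 1]\<close> is not weakly decreasing and so is never a
      value of \<open>mu\<close>.\<close>
    have "sorted (rev (mu n w))" unfolding mu_eq[OF wB] by simp
    then show ?thesis using False by auto
  qed
  moreover have "mu n w = [] \<longleftrightarrow> balanced_parts n w = {#}" "mu n w = [1, 1, 1, 1] \<longleftrightarrow> balanced_parts n w = {#1, 1, 1, 1#}"
    unfolding mu_eq[OF wB] using rev_sorted_list_iff[of "[]"] rev_sorted_list_iff[of "[1, 1, 1, 1 :: nat]"] by simp_all
  ultimately have "small_zeros n w \<longleftrightarrow> mu n w = [] \<or> (\<exists>k. k \<le> n - 1 \<and> mu n w = [k, 1]) \<or> mu n w = [1, 1, 1, 1]"
    unfolding small_zeros_iff_parts[OF w] by blast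
  then show ?thesis using lattice_iff_joins[OF w] joins_iff_small_zeros[OF w] by blast
qed

end
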